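(* Assume the following. (Generator) For every $\theta\in\Theta$, $Q_\theta=(q_{ij}(\theta))_{1\le i,j\le N}$ is a real matrix with $q_{ij}(\theta)\ge0$ for $i\neq j$ and $q_{ii}(\theta)=-\sum_{j\ne i}q_{ij}(\theta)$, and there exists $L_Q>0$ with $\|Q_\theta^*-Q_{\bar\theta}^*\|_{1\to1}\le L_Q|\theta-\bar\theta|$ for all $\theta,\bar\theta\in\Theta$. (Mixing) There exist $C_{\mathrm{mix}}\ge1$ and $\gamma>0$ such that $|e^{tQ_\theta^*}\xi|_1\le C_{\mathrm{mix}}e^{-\gamma t}|\xi|_1$ for all $\theta\in\Theta$, $\xi\in\mathcal{Z}$, $t\ge0$. (Pathwise stability) There exist constants $C_{\mathrm{path}}\ge1$ and $\gamma_{\mathrm{path}}>0$ such that, for every $\delta>0$ and every measurable path $\vartheta:[0,\infty)\to\Theta$, the evolution family $U_\vartheta^\delta(t,s):\mathcal{Z}\to\mathcal{Z}$ of $\delta\dot\xi(t)=Q_{\vartheta(t)}^*\xi(t)$, $\xi(s)=\xi_s\in\mathcal{Z}$, satisfies $|U_\vartheta^\delta(t,s)\xi|_1\le C_{\mathrm{path}}e^{-\gamma_{\mathrm{path}}(t-s)/\delta}|\xi|_1$ for all $\xi\in\mathcal{Z}$, $0\le s\le t$. Fix $T>0$. Then there exists a constant $C_T>0$, independent of $\delta\in(0,1]$, such that the following holds. For $x_0=(\theta_0,w_0,\mu_0)\in K$ and $\delta\in(0,1]$ write $S_\delta(t)x_0=(\theta^\delta(t),w^\delta(t),\mu^\delta(t))$,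 let $(\bar\theta(t),\bar w(t)):=\bar S(t)(\theta_0,w_0)$, and define $\Gamma_0(t)x_0:=(\bar\theta(t),\bar w(t),\mu_{\bar\theta(t)})$. Then, for every $t\in[0,T]$, $$\bigl|\mu^\delta(t)-\mu_{\theta^\delta(t)}\bigr|_1\le C_T\Bigl(e^{-\gamma_{\mathrm{path}}t/\delta}\,|\mu_0-\mu_{\theta_0}|_1+\delta\Bigr)$$ and $$d_X\bigl(S_\delta(t)x_0,\Gamma_0(t)x_0\bigr)\le C_T\Bigl(e^{-\gamma_{\mathrm{path}}t/\delta}\,|\mu_0-\mu_{\theta_0}|_1+\delta\Bigr).$$ Consequently, for every fixed $t_*\in(0,T]$, $$\sup_{x_0\in K}\ \sup_{t_*\le t\le T}d_X\bigl(S_\delta(t)x_0,\Gamma_0(t)x_0\bigr)\longrightarrow0\qquad\text{as }\delta\to0.$$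
   Context: Fix integers $N,K_0,d,m\ge1$ (number of states, number of actions, actor dimension, critic dimension) and positive constants $R_\theta,\tau,\lambda_c$. Below, $i$ ranges over $\{1,\dots,N\}$ and $a,b$ over $\{1,\dots,K_0\}$ when used as action indices. Fix data $r_{i,a}\in\mathbb{R}$, $\psi_{i,a}\in\mathbb{R}^d$, $\varphi_{i,a}\in\mathbb{R}^m$. Let $$\Theta=[-R_\theta,R_\theta]^d,\qquad \Delta_S=\Bigl\{\mu\in[0,\infty)^N:\sum_i\mu_i=1\Bigr\},\qquad \mathcal{Z}=\Bigl\{\xi\in\mathbb{R}^N:\sum_i\xi_i=0\Bigr\}.$$ Here $R_\theta$ is a constant (the subscript is part of its name). Define $$\pi_\theta(a\mid i)=\frac{\exp(\psi_{i,a}\cdot\theta/\tau)}{\sum_{b=1}^{K_0}\exp(\psi_{i,b}\cdot\theta/\tau)},\qquad \nu_{\theta,\mu}(i,a)=\mu_i\,\pi_\theta(a\mid i),$$ $$b(\theta,\mu)=\sum_{i,a}\nu_{\theta,\mu}(i,a)\,r_{i,a}\,\varphi_{i,a}\in\mathbb{R}^m,\qquad A(\theta,\mu)=\lambda_c I_m+\sum_{i,a}\nu_{\theta,\mu}(i,a)\,\varphi_{i,a}\varphi_{i,a}^\top,$$ $$\widetilde G(\theta,w,\mu)=\sum_{i,a}\nu_{\theta,\mu}(i,a)\bigl(r_{i,a}+\varphi_{i,a}\cdot w-\tau\log\pi_\theta(a\mid i)\bigr)\nabla_\theta\log\pi_\theta(a\mid i)\in\mathbb{R}^d,$$ $$D(\theta)=\operatorname{diag}(R_\theta^2-\theta_1^2,\dots,R_\theta^2-\theta_d^2),\qquad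 G(\theta,w,\mu)=D(\theta)\widetilde G(\theta,w,\mu).$$ $Q_\theta^*$ is the transpose of $Q_\theta$, acting on column vectors of $\mathbb{R}^N$; $|\cdot|_1$ is the $\ell^1$-norm on $\mathbb{R}^N$ and $\|\cdot\|_{1\to1}$ the induced operator norm. $|\cdot|$ is the Euclidean norm on $\mathbb{R}^d$ and $\mathbb{R}^m$. The state space $X=\Theta\times\mathbb{R}^m\times\Delta_S$ carries the metric $d_X((\theta,w,\mu),(\bar\theta,\bar w,\bar\mu))=|\theta-\bar\theta|+|w-\bar w|+|\mu-\bar\mu|_1$. Constants: $M_r=\max_{i,a}|r_{i,a}|$, $M_\varphi=\max_{i,a}|\varphi_{i,a}|$, $B_b=M_rM_\varphi$, $R_w=\max\{1,2B_b/\lambda_c\}$, and $K=\Theta\times\overline{B_{R_w}(0)}\times\Delta_S$, where $\overline{B_{R_w}(0)}$ is the closed Euclidean ball in $\mathbb{R}^m$. For $\delta>0$, $S_\delta(t)$, $t\ge0$, denotes the continuous semiflow on $X$ generated by the exact system $$\dot\theta=G(\theta,w,\mu),\qquad \dot w=b(\theta,\mu)-A(\theta,\mu)w,\qquad \delta\dot\mu=Q_\theta^*\mu,$$ i.e. $S_\delta(t)x_0$ is the value at time $t$ of the unique $X$-valued solution on $[0,\infty)$ starting at $x_0$. Under the mixing hypothesis, $\mu_\theta$ denotes the unique element of $\Delta_S$ with $Q_\theta^*\mu_\theta=0$, and $\bar S(t)$ denotes the continuous semiflow on $Y=\Theta\times\mathbb{R}^m$ generated by the reduced system $$\dot{\bar\theta}=G(\bar\theta,\bar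 w,\mu_{\bar\theta}),\qquad \dot{\bar w}=b(\bar\theta,\mu_{\bar\theta})-A(\bar\theta,\mu_{\bar\theta})\bar w.$$ Solutions of the non-autonomous linear equation along a measurable path are understood as absolutely continuous functions satisfying the equation almost everywhere (Carathéodory solutions); $U_\vartheta^\delta(t,s)$ maps the value at time $s$ to the value at time $t$. *)

theory Defs
  imports "HOL-Analysis.Analysis"
begin

section \<open>Preliminaries\<close>

definition l1norm :: "real^'n \<Rightarrow> real" where
  "l1norm x = (\<Sum>i\<in>UNIV. \<bar>x $ i\<bar>)"

definition opnorm1 :: "real^'n^'n \<Rightarrow> real" where
  "opnorm1 A = (SUP x. l1norm (A *v x) / l1norm x)"

text \<open>The operations \<open>*\<close> and \<open>^\<close> on the type \<open>real^'n^'n\<close> are componentwise, so powers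
  of a matrix are iterates of \<open>**\<close>.\<close>

definition matexp :: "real^'n^'n \<Rightarrow> real^'n^'n" where
  "matexp A = (\<Sum>k. (1 / fact k) *\<^sub>R (((**) A ^^ k) (mat 1)))"

definition grad :: "('a::real_inner \<Rightarrow> real) \<Rightarrow> 'a \<Rightarrow> 'a" where
  "grad f x = (THE D. GDERIV f x :> D)"

text \<open>Absolute continuity on \<open>[a, b]\<close>: the finite families of non-overlapping subintervals
  in the usual definition are the divisions of subsets of \<open>{a..b}\<close>.\<close>

definition abs_cont_on :: "real \<Rightarrow> real \<Rightarrow> (real \<Rightarrow> 'a::real_normed_vector) \<Rightarrow> bool" where
  "abs_cont_on a b f \<longleftrightarrow>
     (\<forall>\<epsilon>>0. \<exists>\<eta>>0. \<forall>\<D> S. \<D> division_of S \<longrightarrow> S \<subseteq> {a..b} \<longrightarrow>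
        (\<Sum>k\<in>\<D>. Sup k - Inf k) < \<eta> \<longrightarrow>
        (\<Sum>k\<in>\<D>. norm (f (Sup k) - f (Inf k))) < \<epsilon>)"

text \<open>Value at time \<open>t\<close> of the unique \<open>X\<close>-valued solution on \<open>[0, \<infinity>)\<close> of \<open>x' = F x\<close>,
  \<open>x 0 = x0\<close>. Uniqueness concerns the values on \<open>[0, \<infinity>)\<close> only, hence the description of
  the value rather than of the function.\<close>

definition semiflow ::
    "'a::real_normed_vector set \<Rightarrow> ('a \<Rightarrow> 'a) \<Rightarrow> real \<Rightarrow> 'a \<Rightarrow> 'a" where
  "semiflow X F t x0 = (THE y. \<exists>x.
      (\<forall>s\<ge>0. x s \<in> X \<and> (x has_vector_derivative F (x s)) (at s within {0..})) \<and>
      x 0 = x0 \<and> x t = y)"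

section \<open>The actor-critic data\<close>

text \<open>States, actions and the coordinates of actor and critic are indexed by the finite types
  \<open>'n\<close>, \<open>'k\<close>, \<open>'d\<close>, \<open>'m\<close>. Only the values of \<open>gen\<close> on the box \<open>Theta\<close> are
  relevant.\<close>

record ('n, 'k, 'd, 'm) ac_data =
  rew :: "'n::finite \<Rightarrow> 'k::finite \<Rightarrow> real"
  psi :: "'n \<Rightarrow> 'k \<Rightarrow> real^('d::finite)"
  phi :: "'n \<Rightarrow> 'k \<Rightarrow> real^('m::finite)"
  Rtheta :: real
  tau :: real
  lamc :: real
  gen :: "real^'d \<Rightarrow> real^'n^'n"

definition Theta :: "('n::finite,'k::finite,'d::finite,'m::finite) ac_data \<Rightarrow> (real^'d) set" where
  "Theta P = {\<theta>. \<forall>j. - Rtheta P \<le> \<theta> $ j \<and> \<theta> $ j \<le> Rtheta P}"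

definition DeltaS :: "(real^'n) set" where
  "DeltaS = {\<mu>. (\<forall>i. 0 \<le> \<mu> $ i) \<and> (\<Sum>i\<in>UNIV. \<mu> $ i) = 1}"

definition Zset :: "(real^'n) set" where
  "Zset = {\<xi>. (\<Sum>i\<in>UNIV. \<xi> $ i) = 0}"

definition policy ::
    "('n::finite,'k::finite,'d::finite,'m::finite) ac_data \<Rightarrow> real^'d \<Rightarrow> 'n \<Rightarrow> 'k \<Rightarrow> real" where
  "policy P \<theta> i a =
     exp ((psi P i a \<bullet> \<theta>) / tau P) / (\<Sum>b\<in>UNIV. exp ((psi P i b \<bullet> \<theta>) / tau P))"

definition nu ::
    "('n::finite,'k::finite,'d::finite,'m::finite) ac_data \<Rightarrow> real^'d \<Rightarrow> real^'n \<Rightarrow>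
     'n \<Rightarrow> 'k \<Rightarrow> real" where
  "nu P \<theta> \<mu> i a = \<mu> $ i * policy P \<theta> i a"

definition bvec ::
    "('n::finite,'k::finite,'d::finite,'m::finite) ac_data \<Rightarrow> real^'d \<Rightarrow> real^'n \<Rightarrow> real^'m" where
  "bvec P \<theta> \<mu> = (\<Sum>i\<in>UNIV. \<Sum>a\<in>UNIV. (nu P \<theta> \<mu> i a * rew P i a) *\<^sub>R phi P i a)"

definition outer :: "real^'m \<Rightarrow> real^'m \<Rightarrow> real^'m^'m" where
  "outer u v = (\<chi> k l. u $ k * v $ l)"

definition Amat ::
    "('n::finite,'k::finite,'d::finite,'m::finite) ac_data \<Rightarrow> real^'d \<Rightarrow> real^'n \<Rightarrow> real^'m^'m" where
  "Amat P \<theta> \<mu> = lamc P *\<^sub>R mat 1 +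
     (\<Sum>i\<in>UNIV. \<Sum>a\<in>UNIV. nu P \<theta> \<mu> i a *\<^sub>R outer (phi P i a) (phi P i a))"

definition Gtilde ::
    "('n::finite,'k::finite,'d::finite,'m::finite) ac_data \<Rightarrow> real^'d \<Rightarrow> real^'m \<Rightarrow> real^'n \<Rightarrow>
     real^'d" where
  "Gtilde P \<theta> w \<mu> = (\<Sum>i\<in>UNIV. \<Sum>a\<in>UNIV.
     (nu P \<theta> \<mu> i a * (rew P i a + phi P i a \<bullet> w - tau P * ln (policy P \<theta> i a))) *\<^sub>R
     grad (\<lambda>\<theta>'. ln (policy P \<theta>' i a)) \<theta>)"

definition Dmat ::
    "('n::finite,'k::finite,'d::finite,'m::finite) ac_data \<Rightarrow> real^'d \<Rightarrow> real^'d^'d" where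
  "Dmat P \<theta> = (\<chi> j l. if j = l then (Rtheta P)\<^sup>2 - (\<theta> $ j)\<^sup>2 else 0)"

definition Gfun ::
    "('n::finite,'k::finite,'d::finite,'m::finite) ac_data \<Rightarrow> real^'d \<Rightarrow> real^'m \<Rightarrow> real^'n \<Rightarrow>
     real^'d" where
  "Gfun P \<theta> w \<mu> = Dmat P \<theta> *v Gtilde P \<theta> w \<mu>"

definition Qstar ::
    "('n::finite,'k::finite,'d::finite,'m::finite) ac_data \<Rightarrow> real^'d \<Rightarrow> real^'n^'n" where
  "Qstar P \<theta> = transpose (gen P \<theta>)"

definition mu_inv ::
    "('n::finite,'k::finite,'d::finite,'m::finite) ac_data \<Rightarrow> real^'d \<Rightarrow> real^'n" where
  "mu_inv P \<theta> = (THE \<mu>. \<mu> \<in> DeltaS \<and> Qstar P \<theta> *v \<mu> = 0)"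

section \<open>State spaces and semiflows\<close>

definition Xset ::
    "('n::finite,'k::finite,'d::finite,'m::finite) ac_data \<Rightarrow> ((real^'d) \<times> (real^'m) \<times> (real^'n)) set" where
  "Xset P = Theta P \<times> UNIV \<times> DeltaS"

definition Yset ::
    "('n::finite,'k::finite,'d::finite,'m::finite) ac_data \<Rightarrow> ((real^'d) \<times> (real^'m)) set" where
  "Yset P = Theta P \<times> UNIV"

fun dX :: "(real^'d) \<times> (real^'m) \<times> (real^'n) \<Rightarrow> (real^'d) \<times> (real^'m) \<times> (real^'n) \<Rightarrow> real" where
  "dX (\<theta>, w, \<mu>) (\<theta>', w', \<mu>') = norm (\<theta> - \<theta>') + norm (w - w') + l1norm (\<mu> - \<mu>')"

definition M_r :: "('n::finite,'k::finite,'d::finite,'m::finite) ac_data \<Rightarrow> real" where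
  "M_r P = Max (range (\<lambda>(i, a). \<bar>rew P i a\<bar>))"

definition M_phi :: "('n::finite,'k::finite,'d::finite,'m::finite) ac_data \<Rightarrow> real" where
  "M_phi P = Max (range (\<lambda>(i, a). norm (phi P i a)))"

definition B_b :: "('n::finite,'k::finite,'d::finite,'m::finite) ac_data \<Rightarrow> real" where
  "B_b P = M_r P * M_phi P"

definition R_w :: "('n::finite,'k::finite,'d::finite,'m::finite) ac_data \<Rightarrow> real" where
  "R_w P = max 1 (2 * B_b P / lamc P)"

definition Kset ::
    "('n::finite,'k::finite,'d::finite,'m::finite) ac_data \<Rightarrow> ((real^'d) \<times> (real^'m) \<times> (real^'n)) set" where
  "Kset P = Theta P \<times> cball 0 (R_w P) \<times> DeltaS"

fun exact_field ::
    "('n::finite,'k::finite,'d::finite,'m::finite) ac_data \<Rightarrow> real \<Rightarrow>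
     (real^'d) \<times> (real^'m) \<times> (real^'n) \<Rightarrow> (real^'d) \<times> (real^'m) \<times> (real^'n)" where
  "exact_field P \<delta> (\<theta>, w, \<mu>) =
     (Gfun P \<theta> w \<mu>, bvec P \<theta> \<mu> - Amat P \<theta> \<mu> *v w, (1 / \<delta>) *\<^sub>R (Qstar P \<theta> *v \<mu>))"

definition Sflow ::
    "('n::finite,'k::finite,'d::finite,'m::finite) ac_data \<Rightarrow> real \<Rightarrow> real \<Rightarrow>
     (real^'d) \<times> (real^'m) \<times> (real^'n) \<Rightarrow> (real^'d) \<times> (real^'m) \<times> (real^'n)" where
  "Sflow P \<delta> = semiflow (Xset P) (exact_field P \<delta>)"

fun reduced_field ::
    "('n::finite,'k::finite,'d::finite,'m::finite) ac_data \<Rightarrow>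
     (real^'d) \<times> (real^'m) \<Rightarrow> (real^'d) \<times> (real^'m)" where
  "reduced_field P (\<theta>, w) =
     (Gfun P \<theta> w (mu_inv P \<theta>),
      bvec P \<theta> (mu_inv P \<theta>) - Amat P \<theta> (mu_inv P \<theta>) *v w)"

definition Sbar ::
    "('n::finite,'k::finite,'d::finite,'m::finite) ac_data \<Rightarrow> real \<Rightarrow>
     (real^'d) \<times> (real^'m) \<Rightarrow> (real^'d) \<times> (real^'m)" where
  "Sbar P = semiflow (Yset P) (reduced_field P)"

fun Gamma0 ::
    "('n::finite,'k::finite,'d::finite,'m::finite) ac_data \<Rightarrow> real \<Rightarrow>
     (real^'d) \<times> (real^'m) \<times> (real^'n) \<Rightarrow> (real^'d) \<times> (real^'m) \<times> (real^'n)" where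
  "Gamma0 P t (\<theta>0, w0, \<mu>0) =
     (let (\<theta>, w) = Sbar P t (\<theta>0, w0) in (\<theta>, w, mu_inv P \<theta>))"

section \<open>Evolution family along a path\<close>

definition path_solution ::
    "('n::finite,'k::finite,'d::finite,'m::finite) ac_data \<Rightarrow> real \<Rightarrow> (real \<Rightarrow> real^'d) \<Rightarrow>
     real \<Rightarrow> (real \<Rightarrow> real^'n) \<Rightarrow> bool" where
  "path_solution P \<delta> \<theta> s x \<longleftrightarrow>
     (\<forall>u\<ge>s. x u \<in> Zset) \<and> (\<forall>u\<ge>s. abs_cont_on s u x) \<and>
     (AE u in lebesgue. s \<le> u \<longrightarrow>
        (x has_vector_derivative (1 / \<delta>) *\<^sub>R (Qstar P (\<theta> u) *v x u)) (at u within {s..}))"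

definition evol ::
    "('n::finite,'k::finite,'d::finite,'m::finite) ac_data \<Rightarrow> real \<Rightarrow> (real \<Rightarrow> real^'d) \<Rightarrow>
     real \<Rightarrow> real \<Rightarrow> real^'n \<Rightarrow> real^'n" where
  "evol P \<delta> \<theta> t s \<xi> = (THE y. \<exists>x. path_solution P \<delta> \<theta> s x \<and> x s = \<xi> \<and> x t = y)"

section \<open>Standing hypotheses\<close>

definition generator_hyp :: "('n::finite,'k::finite,'d::finite,'m::finite) ac_data \<Rightarrow> bool" where
  "generator_hyp P \<longleftrightarrow>
     (\<forall>\<theta>\<in>Theta P.
        (\<forall>i j. i \<noteq> j \<longrightarrow> 0 \<le> gen P \<theta> $ i $ j) \<and>
        (\<forall>i. gen P \<theta> $ i $ i = - (\<Sum>j\<in>UNIV - {i}. gen P \<theta> $ i $ j))) \<and>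
     (\<exists>L_Q>0. \<forall>\<theta>\<in>Theta P. \<forall>\<theta>'\<in>Theta P.
        opnorm1 (Qstar P \<theta> - Qstar P \<theta>') \<le> L_Q * norm (\<theta> - \<theta>'))"

definition mixing_hyp :: "('n::finite,'k::finite,'d::finite,'m::finite) ac_data \<Rightarrow> bool" where
  "mixing_hyp P \<longleftrightarrow>
     (\<exists>C_mix\<ge>1. \<exists>\<gamma>>0. \<forall>\<theta>\<in>Theta P. \<forall>\<xi>\<in>Zset. \<forall>t\<ge>0.
        l1norm (matexp (t *\<^sub>R Qstar P \<theta>) *v \<xi>) \<le> C_mix * exp (- \<gamma> * t) * l1norm \<xi>)"

definition pathwise_bound ::
    "('n::finite,'k::finite,'d::finite,'m::finite) ac_data \<Rightarrow> real \<Rightarrow> real \<Rightarrow> bool" where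
  "pathwise_bound P C \<gamma> \<longleftrightarrow>
     (\<forall>\<delta>>0. \<forall>\<theta>. \<theta> \<in> borel_measurable (restrict_space borel {0..}) \<longrightarrow>
        (\<forall>u\<ge>0. \<theta> u \<in> Theta P) \<longrightarrow>
        (\<forall>\<xi>\<in>Zset. \<forall>s t. 0 \<le> s \<longrightarrow> s \<le> t \<longrightarrow>
           l1norm (evol P \<delta> \<theta> t s \<xi>) \<le> C * exp (- \<gamma> * (t - s) / \<delta>) * l1norm \<xi>))"

end

theory Submission
  imports Defs
begin

text \<open>
  The slow variables stay in a compact box, because an Euler step of small size maps the box into
  itself; this gives existence for both systems, and uniqueness is Gronwall's lemma. The invariant
  measure exists by Brouwer's theorem, and pathwise stability along constant paths makes
  \<open>\<theta> \<mapsto> \<mu>\<^sub>\<theta>\<close> Lipschitz. Along an exact trajectory \<open>\<mu>\<^sub>\<theta>\<close> is therefore Lipschitz in time,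
  uniformly in \<open>\<delta>\<close>. Duhamel's formula for the evolution family then bounds the distance of
  \<open>\<mu>\<close> to \<open>\<mu>\<^sub>\<theta>\<close> by \<open>C exp (- \<gamma> t / \<delta>)\<close> times its initial value plus \<open>O(\<delta>)\<close>. This bound has time
  integral \<open>O(\<delta>)\<close>, so Gronwall's lemma compares the slow variables with the reduced flow up to
  \<open>O(\<delta>)\<close>.
\<close>

section \<open>Differential inequalities\<close>

text \<open>The fast equation is linear once the actor trajectory is treated as given, so pathwise
  stability can be applied along the path cut out of the solution itself. That hypothesis speaks
  about \<open>evol\<close>, a definite description over Caratheodory solutions. It yields an
  estimate only after uniqueness among all absolutely continuous solutions has identified
  \<open>evol\<close> with a product of fundamental matrices, which is why a Henstock-type increment
  bound appears although the trajectories of both systems are continuously differentiable. The other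
  obstacle is uniformity in \<delta>. The exact field carries the factor
  \<open>1 / \<delta>\<close>, so its Lipschitz constant serves only existence and uniqueness; every
  constant in the final estimate comes from the slow field, the generators and the pathwise
  bound.\<close>

lemma at_within_atLeastAtMost_Ici:
  fixes t :: real
  assumes "a \<le> t" "t < b"
  shows "at t within {a..b} = at t within {a..}"
  by (rule at_within_nhd[of t "{..<b}"]) (use assms in auto)

lemma has_vector_derivative_Ici_I:
  fixes f :: "real \<Rightarrow> 'a::real_normed_vector"
  assumes "a \<le> t" "\<And>b. t < b \<Longrightarrow> (f has_vector_derivative D) (at t within {a..b})"
  shows "(f has_vector_derivative D) (at t within {a..})"
  using assms(2)[of "t+1"] at_within_atLeastAtMost_Ici[of a t "t+1"] assms(1) by simp

text \<open>Against the weight \<open>exp (- (2 * L * (s - a)))\<close> the integral term is at most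
  half the weighted maximum of \<open>v\<close> and can be absorbed. This costs the two factors 2 in
  the bound, but \<open>v\<close> need only be continuous.\<close>

lemma gronwall:
  fixes v :: "real \<Rightarrow> real"
  assumes cont: "continuous_on {a..b} v"
    and nonneg: "\<And>t. t \<in> {a..b} \<Longrightarrow> 0 \<le> v t"
    and L: "L > 0"
    and bound: "\<And>t. t \<in> {a..b} \<Longrightarrow> v t \<le> E + L * integral {a..t} v"
    and t: "t \<in> {a..b}"
  shows "v t \<le> 2 * E * exp (2 * L * (t - a))"
proof -
  have "continuous_on {a..b} (\<lambda>s. v s * exp (- (2 * L * (s - a))))"
    by (intro continuous_intros cont)
  then obtain u where u: "u \<in> {a..b}"
    and umax: "\<And>s. s \<in> {a..b} \<Longrightarrow> v s * exp (- (2 * L * (s - a))) \<le> v u * exp (- (2 * L * (u - a)))"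
    using continuous_attains_sup[of "{a..b}" "\<lambda>s. v s * exp (- (2 * L * (s - a)))"] t
    by fastforce
  define M where "M = v u * exp (- (2 * L * (u - a)))"
  have M0: "M \<ge> 0" using nonneg[OF u] by (simp add: M_def)
  have vM: "v s \<le> M * exp (2 * L * (s - a))" if "s \<in> {a..b}" for s
    using mult_right_mono[OF umax[OF that], of "exp (2 * L * (s - a))"]
    by (simp add: M_def mult.assoc flip: exp_add)
  have au: "a \<le> u" "u \<le> b" using u by auto
  have deriv: "((\<lambda>s. M / (2 * L) * exp (2 * L * (s - a))) has_vector_derivative
      M * exp (2 * L * (s - a))) (at s within {a..u})" for s
    unfolding has_real_derivative_iff_has_vector_derivative[symmetric]
    using L by (auto intro!: derivative_eq_intros)
  have I: "((\<lambda>s. M * exp (2 * L * (s - a))) has_integral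
      (M / (2 * L) * exp (2 * L * (u - a)) - M / (2 * L) * exp (2 * L * (a - a)))) {a..u}"
    by (rule fundamental_theorem_of_calculus[OF au(1) deriv])
  have "integral {a..u} v \<le> M / (2 * L) * exp (2 * L * (u - a)) - M / (2 * L) * exp (2 * L * (a - a))"
    unfolding integral_unique[OF I, symmetric]
    by (rule integral_le)
       (use I vM au continuous_on_subset[OF cont, of "{a..u}"] in
         \<open>auto intro!: integrable_continuous_real continuous_intros\<close>)
  also have "\<dots> \<le> M / (2 * L) * exp (2 * L * (u - a))"
    using M0 L by simp
  finally have "v u \<le> E + M / 2 * exp (2 * L * (u - a))"
    using bound[OF u] mult_left_mono[of "integral {a..u} v" _ L] L by (force simp: field_simps)
  hence "M \<le> (E + M / 2 * exp (2 * L * (u - a))) * exp (- (2 * L * (u - a)))"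
    unfolding M_def by (intro mult_right_mono) auto
  also have "\<dots> = E * exp (- (2 * L * (u - a))) + M / 2"
    by (simp add: distrib_right mult.assoc flip: exp_add)
  finally have 1: "M / 2 \<le> E * exp (- (2 * L * (u - a)))" by simp
  \<comment> \<open>The sign of \<open>E\<close> is forced by the estimate just obtained; it allows
    the decaying exponential to be dropped.\<close>
  have "E \<ge> 0"
    using order_trans[OF _ 1, of 0] M0 by (simp add: zero_le_mult_iff)
  hence "E * exp (- (2 * L * (u - a))) \<le> E * 1"
    using L au by (intro mult_left_mono) auto
  with 1 have "M \<le> 2 * E" by simp
  hence "M * exp (2 * L * (t - a)) \<le> 2 * E * exp (2 * L * (t - a))" by (intro mult_right_mono) auto
  with vM[OF t] show ?thesis by linarith
qed

text \<open>A mean value inequality for functions without a derivative: \<open>D\<close> needs only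
  the triangle inequality, and near each point only a rate. Being below the increment of
  \<open>g\<close> (up to slack) is additive over adjacent intervals and true on small intervals
  around any point, so bisection extends it to \<open>{a..b}\<close>. The arguments are sorted by
  \<open>min\<close> and \<open>max\<close> because \<open>D\<close> need not be symmetric.\<close>

lemma metric_increment_bound:
  fixes D :: "real \<Rightarrow> real \<Rightarrow> real" and g :: "real \<Rightarrow> real"
  assumes "a \<le> b"
    and tri: "\<And>u v w. D u w \<le> D u v + D v w"
    and loc: "\<And>s e. s \<in> {a..b} \<Longrightarrow> e > 0 \<Longrightarrow> \<exists>d>0. \<forall>v\<in>{a..b}. \<bar>v - s\<bar> < d \<longrightarrow>
        D (min v s) (max v s) \<le> (g' s + e) * \<bar>v - s\<bar>"
    and g: "\<And>s. s \<in> {a..b} \<Longrightarrow> (g has_real_derivative g' s) (at s within {a..b})"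
  shows "D a b \<le> g b - g a"
proof (rule field_le_epsilon)
  fix e :: real assume "e > 0"
  \<comment> \<open>One \<epsilon> per unit length is spent on the local rate of \<open>D\<close>,
    one on the difference quotient of \<open>g\<close>; the summand 1 covers
    \<open>a = b\<close>.\<close>
  define \<epsilon> where "\<epsilon> = e / (2 * (b - a + 1))"
  have \<epsilon>: "\<epsilon> > 0" "2 * \<epsilon> * (b - a) \<le> e" using \<open>e > 0\<close> \<open>a \<le> b\<close> by (auto simp: \<epsilon>_def field_simps)
  define Q where "Q u v \<longleftrightarrow> a \<le> u \<and> v \<le> b \<longrightarrow> D u v \<le> g v - g u + 2 * \<epsilon> * (v - u)" for u v
  have "Q a b"
    using \<open>a \<le> b\<close>
  proof (induct rule: Bolzano)
    case (trans u v w)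
    show ?case
      unfolding Q_def
    proof
      assume "a \<le> u \<and> w \<le> b"
      then have "D u v \<le> g v - g u + 2 * \<epsilon> * (v - u)" "D v w \<le> g w - g v + 2 * \<epsilon> * (w - v)"
        using trans by (auto simp: Q_def)
      with tri[of u w v] show "D u w \<le> g w - g u + 2 * \<epsilon> * (w - u)"
        by (simp add: algebra_simps)
    qed
  next
    case (local s)
    then have s: "s \<in> {a..b}" by simp
    obtain d where d: "d > 0" "\<And>v. v \<in> {a..b} \<Longrightarrow> \<bar>v - s\<bar> < d \<Longrightarrow>
        D (min v s) (max v s) \<le> (g' s + \<epsilon>) * \<bar>v - s\<bar>"
      using loc[OF s \<epsilon>(1)] by blast
    obtain d' where d': "d' > 0" "\<And>v. v \<in> {a..b} \<Longrightarrow> \<bar>v - s\<bar> < d' \<Longrightarrow>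
        \<bar>g v - g s - g' s * (v - s)\<bar> \<le> \<epsilon> * \<bar>v - s\<bar>"
      using g[OF s] \<epsilon>(1) unfolding has_field_derivative_def has_derivative_within_alt
      by (metis real_norm_def)
    show ?case
      unfolding Q_def
    proof (rule exI[of _ "min d d'"], intro conjI allI impI)
      show "0 < min d d'" using d d' by auto
      fix u v assume uv: "u \<le> s \<and> s \<le> v \<and> v - u < min d d'" "a \<le> u \<and> v \<le> b"
      have "D u s \<le> (g' s + \<epsilon>) * (s - u)" using d(2)[of u] uv s by (simp add: min_def max_def split: if_splits)
      moreover have "D s v \<le> (g' s + \<epsilon>) * (v - s)" using d(2)[of v] uv s by (simp add: min_def max_def split: if_splits)
      moreover have "g' s * (s - u) \<le> g s - g u + \<epsilon> * (s - u)"
        using d'(2)[of u] uv s by (simp add: abs_le_iff algebra_simps)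
      moreover have "g' s * (v - s) \<le> g v - g s + \<epsilon> * (v - s)"
        using d'(2)[of v] uv s by (simp add: abs_le_iff algebra_simps)
      ultimately show "D u v \<le> g v - g u + 2 * \<epsilon> * (v - u)"
        using tri[of u v s] by (simp add: algebra_simps)
    qed
  qed
  with \<epsilon> \<open>a \<le> b\<close> show "D a b \<le> g b - g a + e" by (simp add: Q_def)
qed

section \<open>Picard iteration in a closed convex set\<close>

lemma integral_has_vector_derivative_Ici:
  fixes g :: "real \<Rightarrow> 'a::banach"
  assumes "continuous_on {a..} g" "a \<le> t"
  shows "((\<lambda>u. integral {a..u} g) has_vector_derivative g t) (at t within {a..})"
proof (rule has_vector_derivative_Ici_I[OF assms(2)])
  fix b assume "t < b"
  then show "((\<lambda>u. integral {a..u} g) has_vector_derivative g t) (at t within {a..b})"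
    using assms by (intro integral_has_vector_derivative) (auto intro: continuous_on_subset)
qed

text \<open>Both signs of \<open>h\<close> occur: positive in the Picard iteration, negative for the
  decaying initial layer.\<close>

lemma has_integral_exp_div:
  assumes "(h::real) \<noteq> 0" "0 \<le> t"
  shows "((\<lambda>s. exp (s / h)) has_integral h * (exp (t / h) - 1)) {0..t}"
proof -
  have "((\<lambda>s. exp (s / h)) has_integral (h * exp (t / h) - h * exp (0 / h))) {0..t}"
    by (rule fundamental_theorem_of_calculus)
       (use assms in \<open>auto intro!: derivative_eq_intros
          simp: has_real_derivative_iff_has_vector_derivative[symmetric]\<close>)
  then show ?thesis by (simp add: right_diff_distrib)
qed

lemma has_integral_exp_mult:
  assumes "(c::real) \<noteq> 0" "0 \<le> t"
  shows "((\<lambda>s. exp (c * s)) has_integral (exp (c * t) - 1) / c) {0..t}"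
proof -
  have "((\<lambda>s. exp (c * s)) has_integral (exp (c * t) / c - exp (c * 0) / c)) {0..t}"
    by (rule fundamental_theorem_of_calculus)
       (use assms in \<open>auto intro!: derivative_eq_intros
          simp: has_real_derivative_iff_has_vector_derivative[symmetric]\<close>)
  then show ?thesis by (simp add: diff_divide_distrib)
qed

text \<open>The weight \<open>exp (- t / h)\<close> at \<open>x0\<close> and the density
  \<open>exp ((s - t) / h) / h\<close> on \<open>{0..t}\<close> have total mass one, so the point is
  a mean of elements of \<open>C\<close>. A hyperplane separating it from \<open>C\<close> would
  contradict this after integration.\<close>

lemma convex_exp_mean:
  fixes g :: "real \<Rightarrow> 'a::euclidean_space"
  assumes C: "closed C" "convex C" "x0 \<in> C" and h: "h > 0" and t: "0 \<le> t"
    and g: "continuous_on {0..t} g" "\<And>s. s \<in> {0..t} \<Longrightarrow> g s \<in> C"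
  shows "exp (- t / h) *\<^sub>R (x0 + (1 / h) *\<^sub>R integral {0..t} (\<lambda>s. exp (s / h) *\<^sub>R g s)) \<in> C"
    (is "?z \<in> C")
proof (rule ccontr)
  assume "?z \<notin> C"
  then obtain a b where ab: "a \<bullet> ?z < b" "\<And>x. x \<in> C \<Longrightarrow> a \<bullet> x > b"
    using separating_hyperplane_closed_point[OF C(2,1)] by blast
  have exp_int: "((\<lambda>s. exp (s / h)) has_integral h * (exp (t / h) - 1)) {0..t}"
    using h t by (intro has_integral_exp_div) auto
  have int_g: "(\<lambda>s. exp (s / h) *\<^sub>R g s) integrable_on {0..t}"
    by (intro integrable_continuous_real continuous_intros g) (use h in auto)
  have "b * (h * (exp (t / h) - 1)) \<le> integral {0..t} (\<lambda>s. a \<bullet> (exp (s / h) *\<^sub>R g s))"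
  proof (rule has_integral_le)
    show "((\<lambda>s. b * exp (s / h)) has_integral b * (h * (exp (t / h) - 1))) {0..t}"
      by (rule has_integral_mult_right[OF exp_int])
    show "((\<lambda>s. a \<bullet> (exp (s / h) *\<^sub>R g s)) has_integral
        integral {0..t} (\<lambda>s. a \<bullet> (exp (s / h) *\<^sub>R g s))) {0..t}"
      by (intro integrable_integral integrable_continuous_real continuous_intros g) (use h in auto)
    show "b * exp (s / h) \<le> a \<bullet> (exp (s / h) *\<^sub>R g s)" if "s \<in> {0..t}" for s
      using ab(2)[OF g(2)[OF that]] by simp
  qed
  also have "\<dots> = a \<bullet> integral {0..t} (\<lambda>s. exp (s / h) *\<^sub>R g s)"
    using integral_linear[OF int_g bounded_linear_inner_right[of a]] by (simp add: o_def)
  finally have 1: "b * (exp (t / h) - 1) \<le> (a \<bullet> integral {0..t} (\<lambda>s. exp (s / h) *\<^sub>R g s)) / h"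
    using h by (simp add: field_simps)
  have "a \<bullet> ?z = exp (- t / h) * (a \<bullet> x0 + (a \<bullet> integral {0..t} (\<lambda>s. exp (s / h) *\<^sub>R g s)) / h)"
    by (simp add: inner_add_right)
  also have "\<dots> \<ge> exp (- t / h) * (b + b * (exp (t / h) - 1))"
    using 1 ab(2)[OF C(3)] by (intro mult_left_mono add_mono) auto
  also have "exp (- t / h) * (b + b * (exp (t / h) - 1)) = b * (exp (- t / h) * exp (t / h))"
    by (simp add: algebra_simps)
  also have "\<dots> = b" by (simp flip: exp_add)
  finally show False using ab(1) by simp
qed

lemma continuous_on_lipschitz_compose:
  fixes f :: "real \<Rightarrow> 'a::real_normed_vector \<Rightarrow> 'b::real_normed_vector"
  assumes lip: "\<And>t x y. t \<in> S \<Longrightarrow> x \<in> C \<Longrightarrow> y \<in> C \<Longrightarrow> norm (f t x - f t y) \<le> L * norm (x - y)"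
    and cont: "\<And>x. x \<in> C \<Longrightarrow> continuous_on S (\<lambda>t. f t x)"
    and x: "continuous_on S x" "\<And>s. s \<in> S \<Longrightarrow> x s \<in> C"
  shows "continuous_on S (\<lambda>s. f s (x s))"
  unfolding continuous_on_def
proof
  fix s assume s: "s \<in> S"
  have "((\<lambda>u. L * norm (x u - x s)) \<longlongrightarrow> L * norm (x s - x s)) (at s within S)"
    using x(1) s by (intro tendsto_intros) (auto simp: continuous_on_def)
  then have lim0: "((\<lambda>u. L * norm (x u - x s)) \<longlongrightarrow> 0) (at s within S)"
    unfolding diff_self norm_zero mult_zero_right .
  have "\<forall>\<^sub>F u in at s within S. norm (f u (x u) - f u (x s)) \<le> L * norm (x u - x s)"
    unfolding eventually_at_filter by (intro always_eventually allI impI lip x(2) s)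
  then have "((\<lambda>u. f u (x u) - f u (x s)) \<longlongrightarrow> 0) (at s within S)"
    using lim0 by (rule Lim_null_comparison)
  moreover have "((\<lambda>u. f u (x s)) \<longlongrightarrow> f s (x s)) (at s within S)"
    using cont[OF x(2)[OF s]] s by (auto simp: continuous_on_def)
  ultimately have "((\<lambda>u. (f u (x u) - f u (x s)) + f u (x s)) \<longlongrightarrow> 0 + f s (x s)) (at s within S)"
    by (rule tendsto_add)
  then show "((\<lambda>s. f s (x s)) \<longlongrightarrow> f s (x s)) (at s within S)" by simp
qed

text \<open>The equation \<open>x' = f t x\<close> is rewritten as \<open>x' = (g t x - x) / h\<close> with
  \<open>g t x = x + h f t x\<close>. Its Duhamel formula exhibits \<open>x t\<close> as a weighted mean of \<open>x0\<close> and
  of values of \<open>g\<close>, so that the Picard iteration never leaves the closed convex set.\<close>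

lemma picard_convex:
  fixes f :: "real \<Rightarrow> 'a::euclidean_space \<Rightarrow> 'a"
  assumes C: "closed C" "convex C" "x0 \<in> C" and h: "h > 0" and L: "L \<ge> 0"
    and lip: "\<And>t x y. 0 \<le> t \<Longrightarrow> x \<in> C \<Longrightarrow> y \<in> C \<Longrightarrow> norm (f t x - f t y) \<le> L * norm (x - y)"
    and cont: "\<And>x. x \<in> C \<Longrightarrow> continuous_on {0..} (\<lambda>t. f t x)"
    and inv: "\<And>t x. 0 \<le> t \<Longrightarrow> x \<in> C \<Longrightarrow> x + h *\<^sub>R f t x \<in> C"
    and bd: "\<And>t. 0 \<le> t \<Longrightarrow> norm (f t x0) \<le> B"
  obtains x where "x 0 = x0" "\<And>t. 0 \<le> t \<Longrightarrow> x t \<in> C"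
    "\<And>t. 0 \<le> t \<Longrightarrow> (x has_vector_derivative f t (x t)) (at t within {0..})"
proof -
  define G where "G x s = exp (s / h) *\<^sub>R (x s + h *\<^sub>R f s (x s))" for x s
  define \<T> where "\<T> x t = exp (- t / h) *\<^sub>R (x0 + (1 / h) *\<^sub>R integral {0..t} (G x))" for x t
  define adm :: "(real \<Rightarrow> 'a) \<Rightarrow> bool" where "adm x \<longleftrightarrow> continuous_on {0..} x \<and> (\<forall>t\<ge>0. x t \<in> C)" for x
  \<comment> \<open>Distances of iterates are measured against \<open>exp (c * t)\<close>. With this
    \<open>c\<close> one application of \<open>\<T>\<close> halves them: the factor is
    \<open>(1 + h * L) / (h * (1 / h + c))\<close>, whose denominator equals
    \<open>1 + 2 * (1 + h * L)\<close>.\<close>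
  define c where "c = 2 * (1 / h + L)"
  have c: "c > 0" using h L by (simp add: c_def add_pos_nonneg)
  have fx: "continuous_on {0..} (\<lambda>s. f s (x s))" if "adm x" for x
    by (rule continuous_on_lipschitz_compose[where C = C and L = L])
       (use that lip cont in \<open>auto simp: adm_def\<close>)
  have Gcont: "continuous_on {0..} (G x)" if "adm x" for x
    unfolding G_def
    by (intro continuous_intros fx that) (use that h in \<open>auto simp: adm_def\<close>)
  have Gint: "G x integrable_on {0..t}" if "adm x" for x t
    by (intro integrable_continuous_real continuous_on_subset[OF Gcont[OF that]]) auto
  \<comment> \<open>The correction term vanishes exactly when \<open>\<T> x = x\<close>, so a fixed
    point solves the equation.\<close>
  have \<T>_deriv: "(\<T> x has_vector_derivative f t (x t) + (1 / h) *\<^sub>R (x t - \<T> x t)) (at t within {0..})"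
    if "adm x" "0 \<le> t" for x t
  proof -
    have "((\<lambda>t. exp (- t / h)) has_vector_derivative - exp (- t / h) / h) (at t within {0..})"
      unfolding has_real_derivative_iff_has_vector_derivative[symmetric]
      using h by (auto intro!: derivative_eq_intros)
    moreover have "((\<lambda>t. x0 + (1 / h) *\<^sub>R integral {0..t} (G x)) has_vector_derivative
        0 + (1 / h) *\<^sub>R G x t) (at t within {0..})"
      by (intro has_vector_derivative_add has_vector_derivative_const
          bounded_linear.has_vector_derivative[OF bounded_linear_scaleR_right]
          integral_has_vector_derivative_Ici Gcont that)
    ultimately have "(\<T> x has_vector_derivative exp (- t / h) *\<^sub>R (0 + (1 / h) *\<^sub>R G x t) +
        (- exp (- t / h) / h) *\<^sub>R (x0 + (1 / h) *\<^sub>R integral {0..t} (G x))) (at t within {0..})"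
      unfolding \<T>_def by (rule bounded_bilinear.has_vector_derivative[OF bounded_bilinear_scaleR])
    moreover have "exp (- t / h) *\<^sub>R (0 + (1 / h) *\<^sub>R G x t) = (1 / h) *\<^sub>R x t + f t (x t)"
      using h by (simp add: G_def exp_minus scaleR_add_right)
    moreover have "(- exp (- t / h) / h) *\<^sub>R (x0 + (1 / h) *\<^sub>R integral {0..t} (G x)) = - (1 / h) *\<^sub>R \<T> x t"
      by (simp add: \<T>_def)
    ultimately show ?thesis by (simp add: algebra_simps)
  qed
  have \<T>_adm: "adm (\<T> x)" if "adm x" for x
    unfolding adm_def
  proof (intro conjI allI impI)
    show "continuous_on {0..} (\<T> x)"
      unfolding continuous_on_eq_continuous_within
      using \<T>_deriv[OF that] by (auto intro: has_vector_derivative_continuous)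
    fix t :: real assume t: "0 \<le> t"
    show "\<T> x t \<in> C"
      unfolding \<T>_def G_def
      by (rule convex_exp_mean[OF C h t])
         (use that inv in \<open>auto simp: adm_def intro!: continuous_intros
            continuous_on_subset[OF fx[OF that]] intro: continuous_on_subset\<close>)
  qed
  have contr: "norm (\<T> x t - \<T> y t) \<le> K / 2 * exp (c * t)"
    if adm: "adm x" "adm y" and K: "\<And>s. 0 \<le> s \<Longrightarrow> norm (x s - y s) \<le> K * exp (c * s)"
      and t: "0 \<le> t" for x y K t
  proof -
    have K0: "K \<ge> 0" using order_trans[OF norm_ge_zero K[of 0]] by simp
    define q where "q = 1 / h + c"
    have q: "q > 0" using c h by (simp add: q_def add_pos_pos)
    have int: "((\<lambda>s. (1 + h * L) * K * exp (q * s)) has_integral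
        (1 + h * L) * K * ((exp (q * t) - 1) / q)) {0..t}"
      by (intro has_integral_mult_right has_integral_exp_mult) (use q t in auto)
    have "norm (integral {0..t} (\<lambda>s. G x s - G y s)) \<le>
        integral {0..t} (\<lambda>s. (1 + h * L) * K * exp (q * s))"
    proof (rule integral_norm_bound_integral)
      show "(\<lambda>s. G x s - G y s) integrable_on {0..t}"
        by (intro integrable_diff Gint adm)
      show "(\<lambda>s. (1 + h * L) * K * exp (q * s)) integrable_on {0..t}" using int by blast
      fix s assume s: "s \<in> {0..t}"
      have "norm (G x s - G y s) = exp (s / h) * norm ((x s - y s) + h *\<^sub>R (f s (x s) - f s (y s)))"
        unfolding G_def scaleR_diff_right[symmetric] norm_scaleR
        by (simp add: algebra_simps)
      also have "\<dots> \<le> exp (s / h) * (norm (x s - y s) + h * (L * norm (x s - y s)))"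
        using lip[of s "x s" "y s"] adm s h
        by (intro mult_left_mono norm_triangle_le add_mono) (auto simp: adm_def intro!: mult_left_mono)
      also have "\<dots> = exp (s / h) * ((1 + h * L) * norm (x s - y s))" by (simp add: algebra_simps)
      also have "\<dots> \<le> exp (s / h) * ((1 + h * L) * (K * exp (c * s)))"
        using K[of s] s h L by (intro mult_left_mono) auto
      also have "\<dots> = (1 + h * L) * K * exp (q * s)"
        by (simp add: q_def algebra_simps exp_add)
      finally show "norm (G x s - G y s) \<le> (1 + h * L) * K * exp (q * s)" .
    qed
    also have "\<dots> = (1 + h * L) * K * ((exp (q * t) - 1) / q)" by (rule integral_unique[OF int])
    also have "\<dots> \<le> (1 + h * L) * K * (exp (q * t) / q)"
      using K0 h L q by (intro mult_left_mono divide_right_mono) auto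
    finally have 1: "norm (integral {0..t} (\<lambda>s. G x s - G y s)) \<le> (1 + h * L) * K * (exp (q * t) / q)" .
    have "\<T> x t - \<T> y t = (exp (- t / h) / h) *\<^sub>R integral {0..t} (\<lambda>s. G x s - G y s)"
      by (simp add: \<T>_def integral_diff Gint adm algebra_simps)
    then have "norm (\<T> x t - \<T> y t) = exp (- t / h) / h * norm (integral {0..t} (\<lambda>s. G x s - G y s))"
      using h by simp
    also have "\<dots> \<le> exp (- t / h) / h * ((1 + h * L) * K * (exp (q * t) / q))"
      using 1 h by (intro mult_left_mono) auto
    also have "\<dots> = ((1 + h * L) / (h * q)) * K * (exp (- t / h) * exp (q * t))"
      using h q by (simp add: field_simps)
    also have "exp (- t / h) * exp (q * t) = exp (c * t)"
      by (simp add: q_def algebra_simps flip: exp_add)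
    also have "(1 + h * L) / (h * q) * K * exp (c * t) \<le> 1 / 2 * K * exp (c * t)"
    proof (intro mult_right_mono)
      have "h * q = 1 + 2 * (1 + h * L)" using h by (simp add: q_def c_def field_simps)
      then show "(1 + h * L) / (h * q) \<le> 1 / 2"
        using h L by (simp add: field_simps add_pos_nonneg)
    qed (use K0 in auto)
    finally show ?thesis by simp
  qed
  define xs where "xs n = (\<T> ^^ n) (\<lambda>_. x0)" for n
  have xs_adm: "adm (xs n)" for n
    by (induction n) (use C(3) \<T>_adm in \<open>auto simp: xs_def adm_def\<close>)
  have B: "B \<ge> 0" using bd[of 0] norm_ge_zero[of "f 0 x0"] by linarith
  \<comment> \<open>The base case rests on \<open>bd\<close>: applied to the constant path,
    \<open>\<T>\<close> moves it by a weighted integral of \<open>f s x0\<close>, hence by at most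
    \<open>B * h\<close>.\<close>
  have step: "norm (xs (Suc n) t - xs n t) \<le> (B * h) * (1 / 2) ^ n * exp (c * t)" if "0 \<le> t" for n t
    using that
  proof (induction n arbitrary: t)
    case 0
    have adm0: "adm (\<lambda>_. x0)" using xs_adm[of 0] by (simp add: xs_def)
    have e: "((\<lambda>s. exp (s / h)) has_integral h * (exp (t / h) - 1)) {0..t}"
      using h 0 by (intro has_integral_exp_div) auto
    have fint: "(\<lambda>s. exp (s / h) *\<^sub>R f s x0) integrable_on {0..t}"
      by (intro integrable_continuous_real continuous_intros continuous_on_subset[OF cont[OF C(3)]])
         (use h in auto)
    have "((\<lambda>s. exp (s / h) *\<^sub>R x0 + h *\<^sub>R (exp (s / h) *\<^sub>R f s x0)) has_integral
        (h * (exp (t / h) - 1)) *\<^sub>R x0 + h *\<^sub>R integral {0..t} (\<lambda>s. exp (s / h) *\<^sub>R f s x0)) {0..t}"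
      by (intro has_integral_add has_integral_scaleR_left e has_integral_cmul integrable_integral fint)
    then have "integral {0..t} (G (\<lambda>_. x0)) =
        (h * (exp (t / h) - 1)) *\<^sub>R x0 + h *\<^sub>R integral {0..t} (\<lambda>s. exp (s / h) *\<^sub>R f s x0)"
      unfolding G_def by (intro integral_unique) (simp add: scaleR_add_right mult.commute)
    then have "\<T> (\<lambda>_. x0) t = exp (- t / h) *\<^sub>R (x0 + ((exp (t / h) - 1) *\<^sub>R x0 +
        integral {0..t} (\<lambda>s. exp (s / h) *\<^sub>R f s x0)))"
      using h by (simp add: \<T>_def scaleR_add_right)
    also have "\<dots> = (exp (- t / h) * exp (t / h)) *\<^sub>R x0 +
        exp (- t / h) *\<^sub>R integral {0..t} (\<lambda>s. exp (s / h) *\<^sub>R f s x0)"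
      by (simp add: algebra_simps)
    finally have "\<T> (\<lambda>_. x0) t - x0 = exp (- t / h) *\<^sub>R integral {0..t} (\<lambda>s. exp (s / h) *\<^sub>R f s x0)"
      by (simp flip: exp_add)
    then have "norm (\<T> (\<lambda>_. x0) t - x0) = exp (- t / h) * norm (integral {0..t} (\<lambda>s. exp (s / h) *\<^sub>R f s x0))"
      by simp
    also have "norm (integral {0..t} (\<lambda>s. exp (s / h) *\<^sub>R f s x0)) \<le> integral {0..t} (\<lambda>s. exp (s / h) * B)"
      using bd by (intro integral_norm_bound_integral fint)
        (use has_integral_mult_left[OF e] in \<open>auto intro!: mult_left_mono\<close>)
    also have "integral {0..t} (\<lambda>s. exp (s / h) * B) = h * (exp (t / h) - 1) * B"
      by (rule integral_unique[OF has_integral_mult_left[OF e]])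
    also have "exp (- t / h) * (h * (exp (t / h) - 1) * B) = B * h * (exp (- t / h) * exp (t / h) - exp (- t / h))"
      by (simp add: algebra_simps)
    also have "\<dots> = B * h * (1 - exp (- t / h))" by (simp flip: exp_add)
    also have "\<dots> \<le> B * h * exp (c * t)"
      using B h c 0 by (intro mult_left_mono) (auto simp: order_trans[OF _ one_le_exp_iff[THEN iffD2]])
    finally show ?case by (simp add: xs_def)
  next
    case (Suc n)
    show ?case
      using contr[OF xs_adm[of "Suc n"] xs_adm[of n] Suc.IH Suc.prems] by (simp add: xs_def)
  qed
  \<comment> \<open>Increments are damped before they are summed, so the M-test gives convergence of
    the weighted sums uniformly on the whole half line.\<close>
  define z where "z n t = exp (- c * t) *\<^sub>R (xs (Suc n) t - xs n t)" for n t
  have "norm (z n t) \<le> (B * h) * (1 / 2) ^ n" if "t \<in> {0..}" for n t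
  proof -
    have "norm (z n t) \<le> exp (- c * t) * ((B * h) * (1 / 2) ^ n * exp (c * t))"
      using step[of t n] that by (simp add: z_def)
    also have "\<dots> = (B * h) * (1 / 2) ^ n * (exp (- c * t) * exp (c * t))"
      by (simp only: mult_ac)
    finally show ?thesis by (simp flip: exp_add)
  qed
  then have "uniform_limit {0..} (\<lambda>n t. \<Sum>i<n. z i t) (\<lambda>t. \<Sum>i. z i t) sequentially"
    by (rule Weierstrass_m_test) (auto intro!: summable_mult summable_geometric)
  moreover have "(\<Sum>i<n. z i t) = exp (- c * t) *\<^sub>R (xs n t - x0)" for n t
    unfolding z_def scaleR_right.sum[symmetric]
    using sum_lessThan_telescope[of "\<lambda>i. xs i t" n] by (simp add: xs_def)
  ultimately have ul: "uniform_limit {0..} (\<lambda>n t. exp (- c * t) *\<^sub>R (xs n t - x0)) (\<lambda>t. \<Sum>i. z i t) sequentially"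
    by simp
  define x where "x t = x0 + exp (c * t) *\<^sub>R (\<Sum>i. z i t)" for t
  have diff: "xs n t - x t = exp (c * t) *\<^sub>R (exp (- c * t) *\<^sub>R (xs n t - x0) - (\<Sum>i. z i t))" for n t
    by (simp add: x_def scaleR_diff_right flip: exp_add)
  have close: "\<forall>\<^sub>F n in sequentially. \<forall>t\<ge>0. norm (xs n t - x t) \<le> e * exp (c * t)" if "e > 0" for e
    using uniform_limitD[OF ul that]
  proof eventually_elim
    case (elim n)
    show ?case
    proof (intro allI impI)
      fix t :: real assume "0 \<le> t"
      with elim have "norm (exp (- c * t) *\<^sub>R (xs n t - x0) - (\<Sum>i. z i t)) \<le> e"
        by (auto simp: dist_norm less_imp_le)
      then show "norm (xs n t - x t) \<le> e * exp (c * t)"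
        unfolding diff by simp
    qed
  qed
  have lim: "(\<lambda>n. xs n t) \<longlonglongrightarrow> x t" if "0 \<le> t" for t
  proof (rule tendstoI)
    fix e :: real assume "e > 0"
    then have "e / 2 * exp (- c * t) > 0" by simp
    from close[OF this] show "\<forall>\<^sub>F n in sequentially. dist (xs n t) (x t) < e"
    proof eventually_elim
      case (elim n)
      then have "norm (xs n t - x t) \<le> e / 2 * (exp (- c * t) * exp (c * t))"
        using that by (simp add: mult.assoc)
      then show ?case using \<open>e > 0\<close> by (simp add: dist_norm flip: exp_add)
    qed
  qed
  have "continuous_on {0..} (\<lambda>t. \<Sum>i. z i t)"
    by (rule uniform_limit_theorem[OF _ ul])
       (use xs_adm in \<open>auto simp: adm_def intro!: always_eventually continuous_intros\<close>)
  then have "continuous_on {0..} x"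
    unfolding x_def by (intro continuous_intros)
  moreover have xC: "x t \<in> C" if "0 \<le> t" for t
    using closed_sequentially[OF C(1) _ lim[OF that]] xs_adm that by (auto simp: adm_def)
  ultimately have x_adm: "adm x" by (simp add: adm_def)
  have fixpoint: "\<T> x t = x t" if t: "0 \<le> t" for t
  proof (rule LIMSEQ_unique)
    show "(\<lambda>n. xs (Suc n) t) \<longlonglongrightarrow> x t" by (rule LIMSEQ_Suc[OF lim[OF t]])
    show "(\<lambda>n. xs (Suc n) t) \<longlonglongrightarrow> \<T> x t"
    proof (rule tendstoI)
      fix e :: real assume "e > 0"
      then have "e * exp (- c * t) > 0" by simp
      from close[OF this] show "\<forall>\<^sub>F n in sequentially. dist (xs (Suc n) t) (\<T> x t) < e"
      proof eventually_elim
        case (elim n)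
        then have "norm (\<T> (xs n) t - \<T> x t) \<le> e / 2 * (exp (- c * t) * exp (c * t))"
          using contr[OF xs_adm[of n] x_adm _ t, of "e * exp (- c * t)"] by (simp add: mult.assoc)
        then show ?case using \<open>e > 0\<close> by (simp add: xs_def dist_norm flip: exp_add)
      qed
    qed
  qed
  have "(x has_vector_derivative f t (x t)) (at t within {0..})" if "0 \<le> t" for t
  proof -
    have "(\<T> x has_vector_derivative f t (x t)) (at t within {0..})"
      using \<T>_deriv[OF x_adm that] fixpoint[OF that] by simp
    then show ?thesis
      by (rule has_vector_derivative_transform[rotated 2]) (use that fixpoint in auto)
  qed
  moreover have "x 0 = x0" using fixpoint[of 0] by (simp add: \<T>_def)
  ultimately show thesis using that xC by blast
qed

section \<open>Absolutely continuous functions and Caratheodory solutions\<close>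

lemma divisionD_real:
  fixes S :: "real set"
  assumes "\<D> division_of S" "k \<in> \<D>"
  obtains u v where "k = {u..v}" "u \<le> v" "Inf k = u" "Sup k = v" "{u..v} \<subseteq> S"
proof -
  obtain u v where "k = cbox u v" using division_ofD(4)[OF assms] by blast
  moreover have "k \<noteq> {}" "k \<subseteq> S" using division_ofD(2,3)[OF assms] by auto
  ultimately show thesis using that[of u v] by auto
qed

lemma abs_cont_on_lipschitz:
  assumes lip: "\<And>u v. a \<le> u \<Longrightarrow> u \<le> v \<Longrightarrow> v \<le> b \<Longrightarrow> norm (f v - f u) \<le> M * (v - u)"
  shows "abs_cont_on a b f"
  unfolding abs_cont_on_def
proof (intro allI impI)
  fix \<epsilon> :: real assume "\<epsilon> > 0"
  define \<eta> where "\<eta> = \<epsilon> / (\<bar>M\<bar> + 1)"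
  have \<eta>: "\<eta> > 0" using \<open>\<epsilon> > 0\<close> by (simp add: \<eta>_def add_nonneg_pos)
  show "\<exists>\<eta>>0. \<forall>\<D> S. \<D> division_of S \<longrightarrow> S \<subseteq> {a..b} \<longrightarrow>
        (\<Sum>k\<in>\<D>. Sup k - Inf k) < \<eta> \<longrightarrow> (\<Sum>k\<in>\<D>. norm (f (Sup k) - f (Inf k))) < \<epsilon>"
  proof (intro exI conjI allI impI)
    fix \<D> :: "real set set" and S
    assume D: "\<D> division_of S" "S \<subseteq> {a..b}" "(\<Sum>k\<in>\<D>. Sup k - Inf k) < \<eta>"
    have "(\<Sum>k\<in>\<D>. norm (f (Sup k) - f (Inf k))) \<le> (\<Sum>k\<in>\<D>. \<bar>M\<bar> * (Sup k - Inf k))"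
    proof (rule sum_mono)
      fix k assume "k \<in> \<D>"
      then obtain u v where k: "u \<le> v" "Inf k = u" "Sup k = v" "{u..v} \<subseteq> S"
        using divisionD_real[OF D(1)] by metis
      then have "a \<le> u" "v \<le> b"
        using order_trans[OF k(4) D(2)] by auto
      then have "norm (f v - f u) \<le> M * (v - u)" using lip k by blast
      also have "\<dots> \<le> \<bar>M\<bar> * (v - u)" using k by (intro mult_right_mono) auto
      finally show "norm (f (Sup k) - f (Inf k)) \<le> \<bar>M\<bar> * (Sup k - Inf k)" using k by simp
    qed
    also have "\<dots> = \<bar>M\<bar> * (\<Sum>k\<in>\<D>. Sup k - Inf k)" by (simp add: sum_distrib_left)
    also have "\<dots> \<le> \<bar>M\<bar> * \<eta>" using D(3) by (intro mult_left_mono) auto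
    also have "\<dots> < (\<bar>M\<bar> + 1) * \<eta>" using \<eta> by simp
    also have "\<dots> = \<epsilon>" by (simp add: \<eta>_def add_nonneg_pos pos_add_strict)
    finally show "(\<Sum>k\<in>\<D>. norm (f (Sup k) - f (Inf k))) < \<epsilon>" .
  qed (rule \<eta>)
qed

text \<open>Admits classical solutions among the candidates of \<open>path_solution\<close>, which
  gives the existence half of evaluating \<open>evol\<close>.\<close>

lemma abs_cont_on_C1:
  assumes deriv: "\<And>u. u \<in> {a..b} \<Longrightarrow> (x has_vector_derivative x' u) (at u within {a..})"
    and cont: "continuous_on {a..b} x'"
  shows "abs_cont_on a b x"
proof -
  have "bounded (x' ` {a..b})"
    using cont by (intro compact_imp_bounded compact_continuous_image) auto
  then obtain M where "\<forall>y\<in>x' ` {a..b}. norm y \<le> M"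
    unfolding bounded_iff by blast
  then have M: "norm (x' u) \<le> M" if "u \<in> {a..b}" for u
    using that by blast
  have "norm (x v - x u) \<le> M * (v - u)" if "a \<le> u" "u \<le> v" "v \<le> b" for u v
  proof -
    have "norm (x v - x u) \<le> M * norm (v - u)"
    proof (rule differentiable_bound[where S = "{a..b}" and f' = "\<lambda>u h. h *\<^sub>R x' u"])
      fix w assume w: "w \<in> {a..b}"
      show "(x has_derivative (\<lambda>h. h *\<^sub>R x' w)) (at w within {a..b})"
        using has_vector_derivative_within_subset[OF deriv[OF w]]
        by (auto simp: has_vector_derivative_def)
      show "onorm (\<lambda>h. h *\<^sub>R x' w) \<le> M"
        using M[OF w] by (simp add: onorm_scaleR_left onorm_id)
    qed (use that in auto)
    then show ?thesis using that by simp
  qed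
  then show ?thesis by (rule abs_cont_on_lipschitz)
qed

lemma abs_cont_onE:
  assumes "abs_cont_on a b f" "\<epsilon> > 0"
  obtains \<eta> where "\<eta> > 0" "\<And>\<D> S. \<lbrakk>\<D> division_of S; S \<subseteq> {a..b}; (\<Sum>k\<in>\<D>. Sup k - Inf k) < \<eta>\<rbrakk> \<Longrightarrow>
        (\<Sum>k\<in>\<D>. norm (f (Sup k) - f (Inf k))) < \<epsilon>"
  using assms unfolding abs_cont_on_def by meson

lemma abs_cont_on_diff:
  assumes "abs_cont_on a b f" "abs_cont_on a b g"
  shows "abs_cont_on a b (\<lambda>t. f t - g t)"
  unfolding abs_cont_on_def
proof (intro allI impI)
  fix \<epsilon> :: real assume "\<epsilon> > 0"
  then have e: "\<epsilon> / 2 > 0" by simp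
  obtain \<eta>1 where \<eta>1: "\<eta>1 > 0" "\<And>\<D> S. \<lbrakk>\<D> division_of S; S \<subseteq> {a..b}; (\<Sum>k\<in>\<D>. Sup k - Inf k) < \<eta>1\<rbrakk> \<Longrightarrow>
        (\<Sum>k\<in>\<D>. norm (f (Sup k) - f (Inf k))) < \<epsilon> / 2"
    using abs_cont_onE[OF assms(1) e] by metis
  obtain \<eta>2 where \<eta>2: "\<eta>2 > 0" "\<And>\<D> S. \<lbrakk>\<D> division_of S; S \<subseteq> {a..b}; (\<Sum>k\<in>\<D>. Sup k - Inf k) < \<eta>2\<rbrakk> \<Longrightarrow>
        (\<Sum>k\<in>\<D>. norm (g (Sup k) - g (Inf k))) < \<epsilon> / 2"
    using abs_cont_onE[OF assms(2) e] by metis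
  show "\<exists>\<eta>>0. \<forall>\<D> S. \<D> division_of S \<longrightarrow> S \<subseteq> {a..b} \<longrightarrow> (\<Sum>k\<in>\<D>. Sup k - Inf k) < \<eta> \<longrightarrow>
      (\<Sum>k\<in>\<D>. norm ((f (Sup k) - g (Sup k)) - (f (Inf k) - g (Inf k)))) < \<epsilon>"
  proof (intro exI conjI allI impI)
    show "min \<eta>1 \<eta>2 > 0" using \<eta>1 \<eta>2 by simp
    fix \<D> :: "real set set" and S
    assume D: "\<D> division_of S" "S \<subseteq> {a..b}" "(\<Sum>k\<in>\<D>. Sup k - Inf k) < min \<eta>1 \<eta>2"
    have "(\<Sum>k\<in>\<D>. norm ((f (Sup k) - g (Sup k)) - (f (Inf k) - g (Inf k)))) \<le>
        (\<Sum>k\<in>\<D>. norm (f (Sup k) - f (Inf k)) + norm (g (Sup k) - g (Inf k)))"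
    proof (rule sum_mono)
      fix k
      show "norm ((f (Sup k) - g (Sup k)) - (f (Inf k) - g (Inf k))) \<le>
          norm (f (Sup k) - f (Inf k)) + norm (g (Sup k) - g (Inf k))"
        using norm_triangle_ineq4[of "f (Sup k) - f (Inf k)" "g (Sup k) - g (Inf k)"]
        by (simp add: algebra_simps)
    qed
    also have "\<dots> < \<epsilon>"
      using \<eta>1(2)[OF D(1,2)] \<eta>2(2)[OF D(1,2)] D(3) by (simp add: sum.distrib)
    finally show "(\<Sum>k\<in>\<D>. norm ((f (Sup k) - g (Sup k)) - (f (Inf k) - g (Inf k)))) < \<epsilon>" .
  qed
qed

lemma abs_cont_on_subset:
  assumes "abs_cont_on a b f" "b' \<le> b"
  shows "abs_cont_on a b' f"
  unfolding abs_cont_on_def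
proof (intro allI impI)
  fix \<epsilon> :: real assume "\<epsilon> > 0"
  then obtain \<eta> where \<eta>: "\<eta> > 0" "\<And>\<D> S. \<lbrakk>\<D> division_of S; S \<subseteq> {a..b}; (\<Sum>k\<in>\<D>. Sup k - Inf k) < \<eta>\<rbrakk> \<Longrightarrow>
        (\<Sum>k\<in>\<D>. norm (f (Sup k) - f (Inf k))) < \<epsilon>"
    using abs_cont_onE[OF assms(1)] by metis
  show "\<exists>\<eta>>0. \<forall>\<D> S. \<D> division_of S \<longrightarrow> S \<subseteq> {a..b'} \<longrightarrow> (\<Sum>k\<in>\<D>. Sup k - Inf k) < \<eta> \<longrightarrow>
      (\<Sum>k\<in>\<D>. norm (f (Sup k) - f (Inf k))) < \<epsilon>"
    using \<eta>(1) assms(2) by (intro exI[of _ \<eta>] conjI allI impI \<eta>(2)) auto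
qed

lemma abs_cont_on_imp_continuous_on:
  assumes "abs_cont_on a b f"
  shows "continuous_on {a..b} f"
  unfolding continuous_on_iff
proof (intro ballI allI impI)
  fix s \<epsilon> :: real assume s: "s \<in> {a..b}" and "\<epsilon> > 0"
  then obtain \<eta> where \<eta>: "\<eta> > 0" "\<And>\<D> S. \<lbrakk>\<D> division_of S; S \<subseteq> {a..b}; (\<Sum>k\<in>\<D>. Sup k - Inf k) < \<eta>\<rbrakk> \<Longrightarrow>
        (\<Sum>k\<in>\<D>. norm (f (Sup k) - f (Inf k))) < \<epsilon>"
    using abs_cont_onE[OF assms] by metis
  have *: "norm (f v - f u) < \<epsilon>" if "a \<le> u" "u \<le> v" "v \<le> b" "v - u < \<eta>" for u v
  proof -
    have "{{u..v}} division_of {u..v}"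
      using division_of_self[of u v] that by (simp add: box_real)
    from \<eta>(2)[OF this] that show ?thesis by auto
  qed
  show "\<exists>d>0. \<forall>t\<in>{a..b}. dist t s < d \<longrightarrow> dist (f t) (f s) < \<epsilon>"
  proof (intro exI conjI ballI impI)
    fix t assume t: "t \<in> {a..b}" "dist t s < \<eta>"
    show "dist (f t) (f s) < \<epsilon>"
    proof (cases "t \<le> s")
      case True
      then show ?thesis using *[of t s] s t by (simp add: dist_norm norm_minus_commute)
    next
      case False
      then show ?thesis using *[of s t] s t by (simp add: dist_norm)
    qed
  qed (rule \<eta>(1))
qed

text \<open>A Henstock argument: intervals tagged in the exceptional null set lie in an open set of
  small measure, where absolute continuity controls the increments; all others are controlled
  by the derivative.\<close>

lemma abs_cont_norm_increment_le:
  fixes f :: "real \<Rightarrow> 'a::real_normed_vector"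
  assumes ab: "a \<le> b" and ac: "abs_cont_on a b f" and N: "negligible N"
    and loc: "\<And>s e. s \<in> {a..b} - N \<Longrightarrow> e > 0 \<Longrightarrow> \<exists>d>0. \<forall>v\<in>{a..b}. \<bar>v - s\<bar> < d \<longrightarrow>
        norm (f v - f s) \<le> (g' s + e) * \<bar>v - s\<bar>"
    and g: "\<And>s. s \<in> {a..b} \<Longrightarrow> (g has_real_derivative g' s) (at s within {a..b})"
    and mono: "mono_on {a..b} g"
  shows "norm (f b - f a) \<le> g b - g a"
proof (rule field_le_epsilon)
  fix e :: real assume "e > 0"
  \<comment> \<open>Two \<epsilon> per unit length pay for the regular tags, a single \<epsilon> for
    all tags in the null set.\<close>
  define \<epsilon> where "\<epsilon> = e / (2 * (b - a) + 1)"
  have \<epsilon>: "\<epsilon> > 0" "2 * \<epsilon> * (b - a) + \<epsilon> = e"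
  proof -
    have pos: "2 * (b - a) + 1 > 0" using ab by (intro add_nonneg_pos) auto
    then show "\<epsilon> > 0" using \<open>e > 0\<close> by (simp add: \<epsilon>_def)
    have "2 * \<epsilon> * (b - a) + \<epsilon> = \<epsilon> * (2 * (b - a) + 1)" by (simp add: algebra_simps)
    then show "2 * \<epsilon> * (b - a) + \<epsilon> = e" using pos by (simp add: \<epsilon>_def)
  qed
  obtain \<eta> where \<eta>: "\<eta> > 0" "\<And>\<D> S. \<lbrakk>\<D> division_of S; S \<subseteq> {a..b}; (\<Sum>k\<in>\<D>. Sup k - Inf k) < \<eta>\<rbrakk> \<Longrightarrow>
        (\<Sum>k\<in>\<D>. norm (f (Sup k) - f (Inf k))) < \<epsilon>"
    using abs_cont_onE[OF ac \<epsilon>(1)] by metis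
  have N_sets: "N \<in> sets lebesgue" "emeasure lebesgue N = 0"
    using N by (auto simp: negligible_iff_null_sets null_sets_def)
  obtain U where U: "open U" "N \<subseteq> U" "U - N \<in> lmeasurable" "emeasure lebesgue (U - N) < ennreal \<eta>"
    using sets_lebesgue_outer_open[OF N_sets(1) \<eta>(1)] by metis
  have U_eq: "U = (U - N) \<union> N" using U(2) by auto
  have U_lm: "U \<in> lmeasurable"
    by (subst U_eq) (intro fmeasurable.Un U(3) negligible_imp_measurable N)
  have U_meas: "measure lebesgue U < \<eta>"
  proof -
    have "emeasure lebesgue ((U - N) \<union> N) \<le> emeasure lebesgue (U - N) + emeasure lebesgue N"
      by (rule emeasure_subadditive[OF fmeasurableD[OF U(3)] N_sets(1)])
    then have "emeasure lebesgue U \<le> emeasure lebesgue (U - N) + emeasure lebesgue N"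
      using U_eq by metis
    also have "\<dots> < ennreal \<eta>" using U(4) N_sets by simp
    finally show ?thesis
      using U_lm by (simp add: emeasure_eq_measure2 ennreal_less_iff)
  qed
  have "\<exists>d>0. \<forall>v\<in>{a..b}. \<bar>v - s\<bar> < d \<longrightarrow>
      norm (f v - f s) \<le> (g' s + \<epsilon>) * \<bar>v - s\<bar> \<and> \<bar>g v - g s - g' s * (v - s)\<bar> \<le> \<epsilon> * \<bar>v - s\<bar>"
    if s: "s \<in> {a..b} - N" for s
  proof -
    obtain d1 where d1: "d1 > 0" "\<And>v. v \<in> {a..b} \<Longrightarrow> \<bar>v - s\<bar> < d1 \<Longrightarrow>
        norm (f v - f s) \<le> (g' s + \<epsilon>) * \<bar>v - s\<bar>"
      using loc[OF s \<epsilon>(1)] by blast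
    obtain d2 where d2: "d2 > 0" "\<And>v. v \<in> {a..b} \<Longrightarrow> \<bar>v - s\<bar> < d2 \<Longrightarrow>
        \<bar>g v - g s - g' s * (v - s)\<bar> \<le> \<epsilon> * \<bar>v - s\<bar>"
      using g[of s] s \<epsilon>(1) unfolding has_field_derivative_def has_derivative_within_alt
      by (metis DiffD1 real_norm_def)
    show ?thesis
      by (rule exI[of _ "min d1 d2"]) (use d1 d2 in auto)
  qed
  then obtain d where d: "\<And>s. s \<in> {a..b} - N \<Longrightarrow> d s > 0"
    "\<And>s v. s \<in> {a..b} - N \<Longrightarrow> v \<in> {a..b} \<Longrightarrow> \<bar>v - s\<bar> < d s \<Longrightarrow>
       norm (f v - f s) \<le> (g' s + \<epsilon>) * \<bar>v - s\<bar> \<and> \<bar>g v - g s - g' s * (v - s)\<bar> \<le> \<epsilon> * \<bar>v - s\<bar>"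
    by metis
  define \<gamma> where "\<gamma> s = (if s \<in> N then U else if s \<in> {a..b} then ball s (d s) else UNIV)" for s
  have "gauge \<gamma>"
    using U d(1) by (auto simp: gauge_def \<gamma>_def)
  then obtain p where p: "p tagged_division_of {a..b}" "\<gamma> fine p"
    using fine_division_exists_real by blast
  have fin: "finite p" using p(1) by blast
  define p1 where "p1 = {(s, k) \<in> p. s \<in> N}"
  define p2 where "p2 = {(s, k) \<in> p. s \<notin> N}"
  have split: "p = p1 \<union> p2" "p1 \<inter> p2 = {}" "p1 \<subseteq> p" by (auto simp: p1_def p2_def)
  have pk: "\<exists>u v. k = {u..v} \<and> u \<le> s \<and> s \<le> v \<and> a \<le> u \<and> v \<le> b \<and> Inf k = u \<and> Sup k = v"
    if sk: "(s, k) \<in> p" for s k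
  proof -
    obtain u v where k: "k = cbox u v" using tagged_division_ofD(4)[OF p(1) sk] by blast
    have "s \<in> k" "k \<subseteq> {a..b}" using tagged_division_ofD(2,3)[OF p(1) sk] by auto
    with k show ?thesis by (intro exI[of _ u] exI[of _ v]) auto
  qed
  have "f b - f a = (\<Sum>(s, k)\<in>p. f (Sup k) - f (Inf k))"
    by (rule additive_tagged_division_1[OF ab p(1), symmetric])
  then have "norm (f b - f a) \<le> (\<Sum>(s, k)\<in>p. norm (f (Sup k) - f (Inf k)))"
    by (simp add: sum_norm_le case_prod_beta)
  also have "\<dots> = (\<Sum>(s, k)\<in>p1. norm (f (Sup k) - f (Inf k))) + (\<Sum>(s, k)\<in>p2. norm (f (Sup k) - f (Inf k)))"
    using fin split by (subst split(1), intro sum.union_disjoint) (auto intro: finite_subset)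
  also have "(\<Sum>(s, k)\<in>p1. norm (f (Sup k) - f (Inf k))) < \<epsilon>"
  proof -
    have "p1 tagged_partial_division_of {a..b}"
      using p(1) split(3) tagged_partial_division_subset tagged_division_of_def by metis
    then have p1: "p1 tagged_division_of (\<Union>(snd ` p1))"
      by (rule tagged_partial_division_of_Union_self)
    have div: "snd ` p1 division_of \<Union>(snd ` p1)" by (rule division_of_tagged_division[OF p1])
    have "(\<Sum>k\<in>snd ` p1. Sup k - Inf k) = (\<Sum>k\<in>snd ` p1. measure lebesgue k)"
    proof (rule sum.cong)
      fix k assume "k \<in> snd ` p1"
      then obtain u v where "k = {u..v}" "u \<le> v" "Inf k = u" "Sup k = v"
        using divisionD_real[OF div] by metis
      then show "Sup k - Inf k = measure lebesgue k" by simp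
    qed simp
    also have "\<dots> = measure lebesgue (\<Union>(snd ` p1))"
      using content_division[OF div] by simp
    also have "\<dots> \<le> measure lebesgue U"
    proof (rule measure_mono_fmeasurable)
      show "\<Union>(snd ` p1) \<subseteq> U"
        using p(2) by (fastforce simp: p1_def fine_def \<gamma>_def split: if_splits)
      show "\<Union>(snd ` p1) \<in> sets lebesgue"
        using lmeasurable_division[OF div] by (rule fmeasurableD)
    qed (rule U_lm)
    finally have "(\<Sum>k\<in>snd ` p1. Sup k - Inf k) < \<eta>" using U_meas by simp
    moreover have "\<Union>(snd ` p1) \<subseteq> {a..b}"
      using tagged_division_ofD(3)[OF p(1)] split(3) by fastforce
    ultimately have "(\<Sum>k\<in>snd ` p1. norm (f (Sup k) - f (Inf k))) < \<epsilon>"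
      using \<eta>(2)[OF div] by blast
    moreover have "(\<Sum>(s, k)\<in>p1. norm (f (Sup k) - f (Inf k))) = (\<Sum>k\<in>snd ` p1. norm (f (Sup k) - f (Inf k)))"
    proof -
      \<comment> \<open>\<open>Sup\<close> and \<open>Inf\<close> of the empty set are unspecified,
        so the summand is set to 0 there; the passage from tagged intervals to their set requires it
        to vanish on degenerate boxes.\<close>
      define D where "D k = (if k = {} then 0 else norm (f (Sup k) - f (Inf k)))" for k
      have ne: "k \<noteq> {}" if "(s, k) \<in> p1" for s k
        using tagged_division_ofD(2)[OF p1 that] by blast
      have "(\<Sum>(s, k)\<in>p1. norm (f (Sup k) - f (Inf k))) = (\<Sum>(s, k)\<in>p1. D k)"
        using ne by (intro sum.cong) (auto simp: D_def)
      also have "\<dots> = (\<Sum>k\<in>snd ` p1. D k)"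
      proof (rule sum.over_tagged_division_lemma[OF p1])
        fix u v :: real assume "box u v = {}"
        then have "v \<le> u" by simp
        then show "D (cbox u v) = 0" by (cases "u = v") (auto simp: D_def)
      qed
      also have "\<dots> = (\<Sum>k\<in>snd ` p1. norm (f (Sup k) - f (Inf k)))"
        using ne by (intro sum.cong) (auto simp: D_def)
      finally show ?thesis .
    qed
    ultimately show ?thesis by simp
  qed
  also have "(\<Sum>(s, k)\<in>p2. norm (f (Sup k) - f (Inf k))) \<le>
      (\<Sum>(s, k)\<in>p2. g (Sup k) - g (Inf k) + 2 * \<epsilon> * (Sup k - Inf k))"
  proof (rule sum_mono, clarify)
    fix s k assume "(s, k) \<in> p2"
    then have sk: "(s, k) \<in> p" "s \<notin> N" by (auto simp: p2_def)
    obtain u v where k: "k = {u..v}" "u \<le> s" "s \<le> v" "a \<le> u" "v \<le> b" "Inf k = u" "Sup k = v"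
      using pk[OF sk(1)] by blast
    have s: "s \<in> {a..b} - N" using k sk by auto
    have "k \<subseteq> ball s (d s)" using fineD[OF p(2) sk(1)] sk(2) s by (auto simp: \<gamma>_def)
    moreover have "u \<in> k" "v \<in> k" using k by auto
    ultimately have "u \<in> ball s (d s)" "v \<in> ball s (d s)" by blast+
    then have uv: "\<bar>u - s\<bar> < d s" "\<bar>v - s\<bar> < d s"
      by (auto simp: dist_real_def)
    have u': "norm (f u - f s) \<le> (g' s + \<epsilon>) * (s - u)" "g' s * (s - u) \<le> g s - g u + \<epsilon> * (s - u)"
      using d(2)[OF s _ uv(1)] k by (auto simp: abs_le_iff algebra_simps)
    have v': "norm (f v - f s) \<le> (g' s + \<epsilon>) * (v - s)" "g' s * (v - s) \<le> g v - g s + \<epsilon> * (v - s)"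
      using d(2)[OF s _ uv(2)] k by (auto simp: abs_le_iff algebra_simps)
    have "norm (f v - f u) \<le> norm (f v - f s) + norm (f u - f s)"
      by (metis norm_triangle_ineq4 diff_diff_eq2 diff_add_cancel)
    also have "\<dots> \<le> g v - g u + 2 * \<epsilon> * (v - u)"
      using u' v' by (simp add: algebra_simps)
    finally show "norm (f (Sup k) - f (Inf k)) \<le> g (Sup k) - g (Inf k) + 2 * \<epsilon> * (Sup k - Inf k)"
      using k by simp
  qed
  \<comment> \<open>The exceptional intervals are put back so that the sum telescopes; monotonicity
    of \<open>g\<close> makes their terms nonnegative.\<close>
  also have "\<dots> \<le> (\<Sum>(s, k)\<in>p. g (Sup k) - g (Inf k) + 2 * \<epsilon> * (Sup k - Inf k))"
  proof (rule sum_mono2[OF fin])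
    show "p2 \<subseteq> p" by (auto simp: p2_def)
    fix x assume "x \<in> p - p2"
    then obtain s k where x: "x = (s, k)" "(s, k) \<in> p" by (cases x) auto
    obtain u v where "u \<le> v" "a \<le> u" "v \<le> b" "Inf k = u" "Sup k = v"
      using pk[OF x(2)] by fastforce
    moreover from this have "g u \<le> g v" by (intro mono_onD[OF mono]) auto
    ultimately show "0 \<le> (case x of (s, k) \<Rightarrow> g (Sup k) - g (Inf k) + 2 * \<epsilon> * (Sup k - Inf k))"
      using \<epsilon>(1) by (simp add: x)
  qed
  also have "\<dots> = (g b - g a) + 2 * \<epsilon> * (b - a)"
    using additive_tagged_division_1[OF ab p(1), of g]
      additive_tagged_division_1[OF ab p(1), of "\<lambda>x. x"]
    by (simp add: sum.distrib case_prod_beta flip: sum_distrib_left)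
  finally show "norm (f b - f a) \<le> g b - g a + e" using \<epsilon>(2) by simp
qed

text \<open>Uniqueness has to be shown among all absolutely continuous solutions, since \<open>evol\<close> is a
  definite description over these.\<close>

lemma linear_caratheodory_zero:
  fixes z :: "real \<Rightarrow> 'a::real_normed_vector"
  assumes ab: "a \<le> b" and ac: "abs_cont_on a b z"
    and deriv: "AE u in lebesgue. a \<le> u \<longrightarrow> (z has_vector_derivative A u (z u)) (at u within {a..})"
    and A: "\<And>u v. a \<le> u \<Longrightarrow> norm (A u v) \<le> K * norm v" and K: "K > 0"
    and z0: "z a = 0"
  shows "z b = 0"
proof -
  have cont: "continuous_on {a..b} (\<lambda>t. norm (z t))"
    by (intro continuous_intros abs_cont_on_imp_continuous_on ac)
  obtain N where N': "{u \<in> space lebesgue. \<not> (a \<le> u \<longrightarrow>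
      (z has_vector_derivative A u (z u)) (at u within {a..}))} \<subseteq> N"
    "emeasure lebesgue N = 0" "N \<in> sets lebesgue"
    using AE_E[OF deriv] by blast
  have N: "negligible N"
    "\<And>u. u \<notin> N \<Longrightarrow> a \<le> u \<Longrightarrow> (z has_vector_derivative A u (z u)) (at u within {a..})"
    using N' by (auto simp: negligible_iff_null_sets null_sets_def)
  have "norm (z t) \<le> 0 + K * integral {a..t} (\<lambda>s. norm (z s))" if t: "t \<in> {a..b}" for t
  proof -
    \<comment> \<open>The majorant is the integral term of Gronwall's lemma. As \<open>z\<close>
      starts at 0, that lemma applies with \<open>E = 0\<close>.\<close>
    define g where "g s = K * integral {a..s} (\<lambda>s. norm (z s))" for s
    have cont_t: "continuous_on {a..t} (\<lambda>s. norm (z s))"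
      using cont t by (auto intro: continuous_on_subset)
    have "norm (z t - z a) \<le> g t - g a"
    proof (rule abs_cont_norm_increment_le[OF _ _ N(1)])
      show "a \<le> t" using t by simp
      show "abs_cont_on a t z" using abs_cont_on_subset[OF ac] t by simp
      show "(g has_real_derivative K * norm (z s)) (at s within {a..t})" if "s \<in> {a..t}" for s
        unfolding g_def has_real_derivative_iff_has_vector_derivative
        by (intro has_vector_derivative_mult_right integral_has_vector_derivative cont_t that)
      show "mono_on {a..t} g"
      proof (rule mono_onI)
        fix r s assume "r \<in> {a..t}" "s \<in> {a..t}" "r \<le> s"
        then show "g r \<le> g s"
          unfolding g_def using K
          by (intro mult_left_mono integral_subset_le integrable_continuous_real
              continuous_on_subset[OF cont_t]) auto
      qed
      fix s e :: real assume s: "s \<in> {a..t} - N" and "e > 0"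
      then have "(z has_vector_derivative A s (z s)) (at s within {a..})" by (intro N(2)) auto
      then obtain d where d: "d > 0" "\<And>v. v \<in> {a..} \<Longrightarrow> \<bar>v - s\<bar> < d \<Longrightarrow>
          norm (z v - z s - (v - s) *\<^sub>R A s (z s)) \<le> e * \<bar>v - s\<bar>"
        using \<open>e > 0\<close> unfolding has_vector_derivative_def has_derivative_within_alt
        by (metis real_norm_def)
      show "\<exists>d>0. \<forall>v\<in>{a..t}. \<bar>v - s\<bar> < d \<longrightarrow> norm (z v - z s) \<le> (K * norm (z s) + e) * \<bar>v - s\<bar>"
      proof (intro exI conjI ballI impI)
        fix v assume v: "v \<in> {a..t}" "\<bar>v - s\<bar> < d"
        have "norm (z v - z s) \<le> norm (z v - z s - (v - s) *\<^sub>R A s (z s)) + norm ((v - s) *\<^sub>R A s (z s))"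
          by (metis norm_triangle_ineq diff_add_cancel)
        also have "\<dots> \<le> e * \<bar>v - s\<bar> + \<bar>v - s\<bar> * (K * norm (z s))"
          using d(2)[of v] v s A[of s "z s"] by (auto intro!: add_mono mult_left_mono)
        finally show "norm (z v - z s) \<le> (K * norm (z s) + e) * \<bar>v - s\<bar>"
          by (simp add: algebra_simps)
      qed (rule d(1))
    qed
    then show ?thesis by (simp add: g_def z0)
  qed
  then have "norm (z b) \<le> 2 * 0 * exp (2 * K * (b - a))"
    using ab by (intro gronwall[OF cont _ K]) auto
  then show ?thesis by simp
qed

section \<open>Linear systems and semiflows\<close>

lemma bounded_bilinear_matrix_mult:
  "bounded_bilinear ((**) :: real^'n^'n \<Rightarrow> real^'n^'n \<Rightarrow> real^'n^'n)"
  unfolding bilinear_conv_bounded_bilinear[symmetric] bilinear_def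
  by (auto intro!: linearI simp: matrix_matrix_mult_def vec_eq_iff algebra_simps sum.distrib
      sum_distrib_left mult.left_commute)

lemma bounded_bilinear_matrix_vector_mult:
  "bounded_bilinear ((*v) :: real^'n^'m \<Rightarrow> real^'n \<Rightarrow> real^'m)"
  unfolding bilinear_conv_bounded_bilinear[symmetric] bilinear_def
  by (auto intro!: linearI simp: matrix_vector_mult_def vec_eq_iff algebra_simps sum.distrib
      sum_distrib_left mult.left_commute)

text \<open>\<open>Y\<close> is obtained from its own equation rather than by inverting
  \<open>X\<close>. The product \<open>Y t ** X t\<close> has derivative zero and starts at the
  identity, and for square matrices a left inverse is a right inverse. Thus
  \<open>X t ** Y s\<close> is the evolution family with an explicit derivative in
  \<open>s\<close>.\<close>

lemma linear_fundamental_solution: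
  fixes A :: "real \<Rightarrow> real^'n^'n"
  assumes cont: "continuous_on {0..} A" and bd: "\<And>t. 0 \<le> t \<Longrightarrow> norm (A t) \<le> M"
  obtains X Y where "X 0 = mat 1" "Y 0 = mat 1"
    "\<And>t. 0 \<le> t \<Longrightarrow> (X has_vector_derivative A t ** X t) (at t within {0..})"
    "\<And>t. 0 \<le> t \<Longrightarrow> (Y has_vector_derivative - (Y t ** A t)) (at t within {0..})"
    "\<And>t. 0 \<le> t \<Longrightarrow> X t ** Y t = mat 1"
proof -
  interpret mm: bounded_bilinear "(**) :: real^'n^'n \<Rightarrow> real^'n^'n \<Rightarrow> real^'n^'n"
    by (rule bounded_bilinear_matrix_mult)
  obtain k where k: "k \<ge> 0" "\<And>(P :: real^'n^'n) (Q :: real^'n^'n). norm (P ** Q) \<le> norm P * norm Q * k"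
    using mm.nonneg_bounded by metis
  have M: "M \<ge> 0" using order_trans[OF norm_ge_zero bd[of 0]] by simp
  have left: "norm (A t ** P) \<le> (M * k) * norm P" if "0 \<le> t" for t and P :: "real^'n^'n"
  proof -
    have "norm (A t ** P) \<le> norm (A t) * norm P * k" by (rule k)
    also have "\<dots> \<le> M * norm P * k" using bd[OF that] k(1) by (intro mult_right_mono) auto
    finally show ?thesis by (simp add: mult_ac)
  qed
  have right: "norm (P ** A t) \<le> (M * k) * norm P" if "0 \<le> t" for t and P :: "real^'n^'n"
  proof -
    have "norm (P ** A t) \<le> norm P * norm (A t) * k" by (rule k)
    also have "\<dots> \<le> norm P * M * k" using bd[OF that] k(1) by (intro mult_right_mono mult_left_mono) auto
    finally show ?thesis by (simp add: mult_ac)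
  qed
  \<comment> \<open>With \<open>UNIV\<close> as convex set the Euler step is trivially invariant, so
    any step length serves.\<close>
  obtain X where X: "X 0 = mat 1" "\<And>t. 0 \<le> t \<Longrightarrow> (X has_vector_derivative A t ** X t) (at t within {0..})"
  proof (rule picard_convex[of UNIV "mat 1 :: real^'n^'n" 1 "M * k" "\<lambda>t P. A t ** P"
        "(M * k) * norm (mat 1 :: real^'n^'n)"])
    show "norm (A t ** x - A t ** y) \<le> M * k * norm (x - y)" if "0 \<le> t" for t and x y :: "real^'n^'n"
      using left[OF that, of "x - y"] by (simp add: mm.diff_right)
    show "continuous_on {0..} (\<lambda>t. A t ** x)" for x :: "real^'n^'n"
      by (intro mm.continuous_on cont continuous_on_const)
    show "norm (A t ** mat 1) \<le> M * k * norm (mat 1 :: real^'n^'n)" if "0 \<le> t" for t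
      by (rule left[OF that])
  qed (use M k(1) in auto)
  obtain Y where Y: "Y 0 = mat 1" "\<And>t. 0 \<le> t \<Longrightarrow> (Y has_vector_derivative - (Y t ** A t)) (at t within {0..})"
  proof (rule picard_convex[of UNIV "mat 1 :: real^'n^'n" 1 "M * k" "\<lambda>t P. - (P ** A t)"
        "(M * k) * norm (mat 1 :: real^'n^'n)"])
    show "norm (- (x ** A t) - - (y ** A t)) \<le> M * k * norm (x - y)" if "0 \<le> t" for t and x y :: "real^'n^'n"
      using right[OF that, of "y - x"] by (simp add: mm.diff_left norm_minus_commute)
    show "continuous_on {0..} (\<lambda>t. - (x ** A t))" for x :: "real^'n^'n"
      by (intro continuous_intros mm.continuous_on cont)
    show "norm (- (mat 1 ** A t)) \<le> M * k * norm (mat 1 :: real^'n^'n)" if "0 \<le> t" for t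
      using right[OF that, of "mat 1"] by simp
  qed (use M k(1) in auto)
  have "((\<lambda>t. Y t ** X t) has_vector_derivative 0) (at t within {0..})" if "t \<in> {0..}" for t
  proof -
    have "((\<lambda>t. Y t ** X t) has_vector_derivative Y t ** (A t ** X t) + - (Y t ** A t) ** X t)
        (at t within {0..})"
      by (rule mm.has_vector_derivative) (use X Y that in auto)
    then show ?thesis by (simp add: mm.minus_left matrix_mul_assoc)
  qed
  then obtain c where c: "\<And>t. t \<in> {0..} \<Longrightarrow> Y t ** X t = c"
    using has_vector_derivative_zero_constant[of "{0..}" "\<lambda>t. Y t ** X t"] by auto
  have "Y t ** X t = mat 1" if "0 \<le> t" for t
    using c[of t] c[of 0] that X(1) Y(1) by simp
  then have "X t ** Y t = mat 1" if "0 \<le> t" for t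
    using that matrix_left_right_inverse by blast
  with X Y show thesis using that by blast
qed

section \<open>Autonomous systems and their semiflows\<close>

lemma vector_integral_equation:
  fixes x :: "real \<Rightarrow> 'a::banach"
  assumes "0 \<le> t" "\<And>s. s \<in> {0..t} \<Longrightarrow> (x has_vector_derivative x' s) (at s within {0..})"
  shows "(x' has_integral (x t - x 0)) {0..t}"
proof (rule fundamental_theorem_of_calculus[OF assms(1)])
  show "(x has_vector_derivative x' s) (at s within {0..t})" if "s \<in> {0..t}" for s
    by (rule has_vector_derivative_within_subset[OF assms(2)[OF that]]) auto
qed

text \<open>The predicate inside the definite description of \<open>semiflow\<close>, isolated so
  that \<open>semiflow_def\<close> folds onto it.\<close>

definition ode_solution_on :: "'a::real_normed_vector set \<Rightarrow> ('a \<Rightarrow> 'a) \<Rightarrow> (real \<Rightarrow> 'a) \<Rightarrow> bool" where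
  "ode_solution_on S F x \<longleftrightarrow>
     (\<forall>s\<ge>0. x s \<in> S \<and> (x has_vector_derivative F (x s)) (at s within {0..}))"

lemma ode_solution_onD:
  assumes "ode_solution_on S F x"
  shows "0 \<le> s \<Longrightarrow> x s \<in> S"
    and "0 \<le> s \<Longrightarrow> (x has_vector_derivative F (x s)) (at s within {0..})"
    and "continuous_on {0..} x"
proof -
  show *: "0 \<le> s \<Longrightarrow> x s \<in> S" "0 \<le> s \<Longrightarrow> (x has_vector_derivative F (x s)) (at s within {0..})" for s
    using assms by (auto simp: ode_solution_on_def)
  show "continuous_on {0..} x"
    unfolding continuous_on_eq_continuous_within
    using *(2) has_vector_derivative_continuous by fastforce
qed

lemma ode_solution_on_mono: "ode_solution_on S F x \<Longrightarrow> S \<subseteq> T \<Longrightarrow> ode_solution_on T F x"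
  by (auto simp: ode_solution_on_def)

text \<open>Both state spaces are unbounded in the critic variable, so a Lipschitz constant is
  available only on bounded parts. On \<open>{0..t}\<close> two continuous solutions share a ball,
  and Gronwall's lemma works with its constant.\<close>

lemma ode_solution_unique:
  fixes F :: "'a::banach \<Rightarrow> 'a"
  assumes lip: "\<And>r. \<exists>L. L-lipschitz_on (S \<inter> cball 0 r) F"
    and x: "ode_solution_on S F x" and y: "ode_solution_on S F y" and "x 0 = y 0" and t: "0 \<le> t"
  shows "x t = y t"
proof -
  have cont: "continuous_on {0..t} x" "continuous_on {0..t} y"
    using ode_solution_onD(3)[OF x] ode_solution_onD(3)[OF y] by (auto intro: continuous_on_subset)
  have "bounded (x ` {0..t} \<union> y ` {0..t})"
    using cont by (auto intro!: compact_imp_bounded compact_continuous_image)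
  then obtain r where "\<forall>z\<in>x ` {0..t} \<union> y ` {0..t}. norm z \<le> r"
    unfolding bounded_iff by blast
  then have r: "x s \<in> S \<inter> cball 0 r" "y s \<in> S \<inter> cball 0 r" if "s \<in> {0..t}" for s
    using that ode_solution_onD(1)[OF x, of s] ode_solution_onD(1)[OF y, of s] by auto
  obtain L where L: "L-lipschitz_on (S \<inter> cball 0 r) F" using lip by blast
  define v where "v s = norm (x s - y s)" for s
  have v_cont: "continuous_on {0..t} v" unfolding v_def by (intro continuous_intros cont)
  have "v s \<le> 0 + (L + 1) * integral {0..s} v" if s: "s \<in> {0..t}" for s
  proof -
    have int: "((\<lambda>u. F (x u) - F (y u)) has_integral ((x s - x 0) - (y s - y 0))) {0..s}"
      by (intro has_integral_diff vector_integral_equation ode_solution_onD(2)[OF x]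
          ode_solution_onD(2)[OF y]) (use s in auto)
    have vint: "v integrable_on {0..s}"
      using s by (intro integrable_continuous_real continuous_on_subset[OF v_cont]) auto
    have "v s = norm (integral {0..s} (\<lambda>u. F (x u) - F (y u)))"
      using integral_unique[OF int] assms(4) by (simp add: v_def)
    also have "\<dots> \<le> integral {0..s} (\<lambda>u. (L + 1) * v u)"
    proof (rule integral_norm_bound_integral)
      show "(\<lambda>u. F (x u) - F (y u)) integrable_on {0..s}" using int by (rule has_integral_integrable)
      show "(\<lambda>u. (L + 1) * v u) integrable_on {0..s}"
        using integrable_cmul[OF vint, of "L + 1"] by simp
      fix u assume "u \<in> {0..s}"
      then have "u \<in> {0..t}" using s by auto
      then have "norm (F (x u) - F (y u)) \<le> L * v u"
        unfolding v_def using lipschitz_on_normD[OF L] r by blast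
      then show "norm (F (x u) - F (y u)) \<le> (L + 1) * v u"
        using norm_ge_zero[of "x u - y u"] unfolding v_def distrib_right by linarith
    qed
    finally show ?thesis by simp
  qed
  moreover have "L + 1 > 0" using lipschitz_on_nonneg[OF L] by simp
  moreover have "0 \<le> v s" for s by (simp add: v_def)
  ultimately have "v t \<le> 2 * 0 * exp (2 * (L + 1) * (t - 0))"
    using t by (intro gronwall[OF v_cont]) auto
  then show ?thesis by (simp add: v_def)
qed

text \<open>A solution may be constructed in any convenient subset of \<open>S\<close>; uniqueness
  in all of \<open>S\<close> makes it the value of the semiflow.\<close>

lemma semiflow_eq:
  fixes F :: "'a::banach \<Rightarrow> 'a"
  assumes lip: "\<And>r. \<exists>L. L-lipschitz_on (S \<inter> cball 0 r) F"
    and x: "ode_solution_on S F x" and t: "0 \<le> t"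
  shows "semiflow S F t (x 0) = x t"
  unfolding semiflow_def ode_solution_on_def[symmetric]
proof (rule the_equality)
  show "\<exists>z. ode_solution_on S F z \<and> z 0 = x 0 \<and> z t = x t" using x by blast
  fix y assume "\<exists>z. ode_solution_on S F z \<and> z 0 = x 0 \<and> z t = y"
  then obtain z where "ode_solution_on S F z" "z 0 = x 0" "z t = y" by blast
  then show "y = x t" using ode_solution_unique[OF lip _ x _ t] by metis
qed

lemma ode_solution_exists:
  fixes F :: "'a::euclidean_space \<Rightarrow> 'a"
  assumes "closed C" "convex C" "x0 \<in> C" "h > 0"
    and lip: "L-lipschitz_on C F" and inv: "\<And>x. x \<in> C \<Longrightarrow> x + h *\<^sub>R F x \<in> C"
  obtains x where "ode_solution_on C F x" "x 0 = x0"
proof (rule picard_convex[of C x0 h L "\<lambda>_. F" "norm (F x0)"])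
  show "0 \<le> L" using lip by (rule lipschitz_on_nonneg)
  show "norm (F x - F y) \<le> L * norm (x - y)" if "x \<in> C" "y \<in> C" for x y
    by (rule lipschitz_on_normD[OF lip that])
  fix x assume "x 0 = x0" "\<And>t. 0 \<le> t \<Longrightarrow> x t \<in> C"
    "\<And>t. 0 \<le> t \<Longrightarrow> (x has_vector_derivative F (x t)) (at t within {0..})"
  then show thesis using that[of x] unfolding ode_solution_on_def by blast
qed (use assms(1-4) inv in \<open>simp_all add: continuous_on_const\<close>)

section \<open>Bounded Lipschitz functions\<close>

text \<open>Lipschitz functions alone are not closed under products. Together with boundedness they
  are, so the regularity of the vector fields follows by structural rules.\<close>

definition bounded_lipschitz_on ::
    "'a::metric_space set \<Rightarrow> ('a \<Rightarrow> 'b::real_normed_vector) \<Rightarrow> bool" where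
  "bounded_lipschitz_on S f \<longleftrightarrow> bounded (f ` S) \<and> (\<exists>L. L-lipschitz_on S f)"

lemma bounded_lipschitz_onI:
  assumes "\<And>x. x \<in> S \<Longrightarrow> norm (f x) \<le> B"
    and "\<And>x y. x \<in> S \<Longrightarrow> y \<in> S \<Longrightarrow> norm (f x - f y) \<le> L * dist x y"
  shows "bounded_lipschitz_on S f"
  unfolding bounded_lipschitz_on_def
proof
  show "bounded (f ` S)" using assms(1) by (auto simp: bounded_iff)
  have "dist (f x) (f y) \<le> \<bar>L\<bar> * dist x y" if "x \<in> S" "y \<in> S" for x y
    using order_trans[OF assms(2)[OF that] mult_right_mono[OF abs_ge_self zero_le_dist]]
    by (simp add: dist_norm)
  then show "\<exists>L. L-lipschitz_on S f" by (intro exI[of _ "\<bar>L\<bar>"] lipschitz_onI) auto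
qed

lemma bounded_lipschitz_onE:
  assumes "bounded_lipschitz_on S f"
  obtains B L where "B \<ge> 0" "L \<ge> 0" "\<And>x. x \<in> S \<Longrightarrow> norm (f x) \<le> B"
    "\<And>x y. x \<in> S \<Longrightarrow> y \<in> S \<Longrightarrow> norm (f x - f y) \<le> L * dist x y"
proof -
  obtain B where "\<forall>y\<in>f ` S. norm y \<le> B"
    using assms unfolding bounded_lipschitz_on_def bounded_iff by blast
  then have B: "norm (f x) \<le> max B 0" if "x \<in> S" for x using that by (auto simp: le_max_iff_disj)
  obtain L where L: "L-lipschitz_on S f" using assms unfolding bounded_lipschitz_on_def by blast
  show thesis
    by (rule that[of "max B 0" L])
       (use B lipschitz_on_nonneg[OF L] lipschitz_onD[OF L] in \<open>auto simp: dist_norm\<close>)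
qed

lemma bounded_lipschitz_on_const: "bounded_lipschitz_on S (\<lambda>_. c)"
  by (rule bounded_lipschitz_onI[of _ _ "norm c" 0]) auto

lemma bounded_lipschitz_on_add:
  assumes "bounded_lipschitz_on S f" "bounded_lipschitz_on S g"
  shows "bounded_lipschitz_on S (\<lambda>x. f x + g x)"
proof -
  obtain B L where f: "\<And>x. x \<in> S \<Longrightarrow> norm (f x) \<le> B"
    "\<And>x y. x \<in> S \<Longrightarrow> y \<in> S \<Longrightarrow> norm (f x - f y) \<le> L * dist x y"
    using bounded_lipschitz_onE[OF assms(1)] by metis
  obtain B' L' where g: "\<And>x. x \<in> S \<Longrightarrow> norm (g x) \<le> B'"
    "\<And>x y. x \<in> S \<Longrightarrow> y \<in> S \<Longrightarrow> norm (g x - g y) \<le> L' * dist x y"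
    using bounded_lipschitz_onE[OF assms(2)] by metis
  show ?thesis
  proof (rule bounded_lipschitz_onI[of _ _ "B + B'" "L + L'"])
    show "norm (f x + g x) \<le> B + B'" if "x \<in> S" for x
      using f(1)[OF that] g(1)[OF that] by (rule norm_triangle_mono)
    show "norm (f x + g x - (f y + g y)) \<le> (L + L') * dist x y" if "x \<in> S" "y \<in> S" for x y
      using norm_triangle_mono[OF f(2)[OF that] g(2)[OF that]] by (simp add: algebra_simps)
  qed
qed

text \<open>Splitting the increment as \<open>p (f x - f y) (g x) + p (f y) (g x - g y)\<close>
  pairs each increment with a bound. This single rule covers products, scalings, inner products and
  matrix action.\<close>

lemma bounded_lipschitz_on_bilinear:
  assumes bil: "bounded_bilinear p"
    and "bounded_lipschitz_on S f" "bounded_lipschitz_on S g"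
  shows "bounded_lipschitz_on S (\<lambda>x. p (f x) (g x))"
proof -
  interpret p: bounded_bilinear p by (rule bil)
  obtain B L where f: "B \<ge> 0" "L \<ge> 0" "\<And>x. x \<in> S \<Longrightarrow> norm (f x) \<le> B"
    "\<And>x y. x \<in> S \<Longrightarrow> y \<in> S \<Longrightarrow> norm (f x - f y) \<le> L * dist x y"
    using bounded_lipschitz_onE[OF assms(2)] by metis
  obtain B' L' where g: "B' \<ge> 0" "L' \<ge> 0" "\<And>x. x \<in> S \<Longrightarrow> norm (g x) \<le> B'"
    "\<And>x y. x \<in> S \<Longrightarrow> y \<in> S \<Longrightarrow> norm (g x - g y) \<le> L' * dist x y"
    using bounded_lipschitz_onE[OF assms(3)] by metis
  obtain K where K: "K \<ge> 0" "\<And>a b. norm (p a b) \<le> norm a * norm b * K"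
    using p.nonneg_bounded by metis
  show ?thesis
  proof (rule bounded_lipschitz_onI[of _ _ "B * B' * K" "(L * B' + B * L') * K"])
    show "norm (p (f x) (g x)) \<le> B * B' * K" if "x \<in> S" for x
      using f(1) f(3)[OF that] g(3)[OF that] K(1)
      by (intro order_trans[OF K(2)] mult_right_mono mult_mono) auto
    fix x y assume xy: "x \<in> S" "y \<in> S"
    have "p (f x) (g x) - p (f y) (g y) = p (f x - f y) (g x) + p (f y) (g x - g y)"
      by (simp add: p.diff_left p.diff_right)
    also have "norm \<dots> \<le> norm (f x - f y) * norm (g x) * K + norm (f y) * norm (g x - g y) * K"
      by (intro norm_triangle_mono K(2))
    also have "\<dots> \<le> (L * dist x y) * B' * K + B * (L' * dist x y) * K"
      using f(1,2) f(3)[OF xy(2)] f(4)[OF xy] g(1,2) g(3)[OF xy(1)] g(4)[OF xy] K(1)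
      by (intro add_mono mult_right_mono mult_mono) auto
    finally show "norm (p (f x) (g x) - p (f y) (g y)) \<le> (L * B' + B * L') * K * dist x y"
      by (simp add: algebra_simps)
  qed
qed

lemmas bounded_lipschitz_on_mult = bounded_lipschitz_on_bilinear[OF bounded_bilinear_mult]
lemmas bounded_lipschitz_on_scaleR = bounded_lipschitz_on_bilinear[OF bounded_bilinear_scaleR]
lemmas bounded_lipschitz_on_inner = bounded_lipschitz_on_bilinear[OF bounded_bilinear_inner]
lemmas bounded_lipschitz_on_matvec = bounded_lipschitz_on_bilinear[OF bounded_bilinear_matrix_vector_mult]

lemma bounded_lipschitz_on_diff:
  assumes "bounded_lipschitz_on S f" "bounded_lipschitz_on S g"
  shows "bounded_lipschitz_on S (\<lambda>x. f x - g x)"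
proof -
  have "bounded_lipschitz_on S (\<lambda>x. f x + (- 1) *\<^sub>R g x)"
    by (intro bounded_lipschitz_on_add bounded_lipschitz_on_scaleR bounded_lipschitz_on_const assms)
  then show ?thesis by simp
qed

lemma bounded_lipschitz_on_sum:
  assumes "\<And>i. i \<in> I \<Longrightarrow> bounded_lipschitz_on S (f i)"
  shows "bounded_lipschitz_on S (\<lambda>x. \<Sum>i\<in>I. f i x)"
  using assms
proof (induction I rule: infinite_finite_induct)
  case (insert i I)
  then show ?case by (simp add: bounded_lipschitz_on_add)
qed (simp_all add: bounded_lipschitz_on_const)

lemma bounded_lipschitz_on_compose:
  assumes f: "bounded_lipschitz_on T f" and g: "L-lipschitz_on S g" "g ` S \<subseteq> T"
  shows "bounded_lipschitz_on S (\<lambda>x. f (g x))"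
proof -
  obtain B M where f: "M \<ge> 0" "\<And>x. x \<in> T \<Longrightarrow> norm (f x) \<le> B"
    "\<And>x y. x \<in> T \<Longrightarrow> y \<in> T \<Longrightarrow> norm (f x - f y) \<le> M * dist x y"
    using bounded_lipschitz_onE[OF f] by metis
  show ?thesis
  proof (rule bounded_lipschitz_onI[of _ _ B "M * L"])
    show "norm (f (g x)) \<le> B" if "x \<in> S" for x using f(2) g(2) that by blast
    fix x y assume xy: "x \<in> S" "y \<in> S"
    then have "norm (f (g x) - f (g y)) \<le> M * dist (g x) (g y)" using f(3) g(2) by blast
    also have "\<dots> \<le> M * (L * dist x y)" using lipschitz_onD[OF g(1) xy] f(1) by (rule mult_left_mono)
    finally show "norm (f (g x) - f (g y)) \<le> M * L * dist x y" by simp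
  qed
qed

lemma bounded_lipschitz_on_subset:
  "bounded_lipschitz_on T f \<Longrightarrow> S \<subseteq> T \<Longrightarrow> bounded_lipschitz_on S f"
  unfolding bounded_lipschitz_on_def
  using bounded_subset[OF _ image_mono] lipschitz_on_subset by blast

lemma bounded_lipschitz_on_ident: "bounded S \<Longrightarrow> bounded_lipschitz_on S (\<lambda>x. x)"
  unfolding bounded_lipschitz_on_def using lipschitz_on_id by auto

lemma bounded_lipschitz_on_Pair:
  assumes "bounded_lipschitz_on S f" "bounded_lipschitz_on S g"
  shows "bounded_lipschitz_on S (\<lambda>x. (f x, g x))"
proof -
  obtain B L where f: "\<And>x. x \<in> S \<Longrightarrow> norm (f x) \<le> B"
    "\<And>x y. x \<in> S \<Longrightarrow> y \<in> S \<Longrightarrow> norm (f x - f y) \<le> L * dist x y"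
    using bounded_lipschitz_onE[OF assms(1)] by metis
  obtain B' L' where g: "\<And>x. x \<in> S \<Longrightarrow> norm (g x) \<le> B'"
    "\<And>x y. x \<in> S \<Longrightarrow> y \<in> S \<Longrightarrow> norm (g x - g y) \<le> L' * dist x y"
    using bounded_lipschitz_onE[OF assms(2)] by metis
  show ?thesis
  proof (rule bounded_lipschitz_onI[of _ _ "B + B'" "L + L'"])
    show "norm (f x, g x) \<le> B + B'" if "x \<in> S" for x
      using norm_Pair_le[of "f x" "g x"] f(1)[OF that] g(1)[OF that] by linarith
    show "norm ((f x, g x) - (f y, g y)) \<le> (L + L') * dist x y" if "x \<in> S" "y \<in> S" for x y
      using norm_Pair_le[of "f x - f y" "g x - g y"] f(2)[OF that] g(2)[OF that]
      by (simp add: algebra_simps)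
  qed
qed

lemma norm_vec_le_sum: "norm x \<le> (\<Sum>i\<in>UNIV. norm (x $ i))"
  unfolding norm_vec_def by (rule L2_set_le_sum) auto

lemma bounded_lipschitz_on_vec:
  fixes f :: "'a::metric_space \<Rightarrow> 'b::real_normed_vector^'n"
  assumes "\<And>i. bounded_lipschitz_on S (\<lambda>x. f x $ i)"
  shows "bounded_lipschitz_on S f"
proof -
  have "\<exists>B L. (\<forall>x\<in>S. norm (f x $ i) \<le> B) \<and> (\<forall>x\<in>S. \<forall>y\<in>S. norm (f x $ i - f y $ i) \<le> L * dist x y)" for i
    by (rule bounded_lipschitz_onE[OF assms[of i]]) blast
  then obtain B L where
    B: "\<And>i x. x \<in> S \<Longrightarrow> norm (f x $ i) \<le> B i" and
    L: "\<And>i x y. x \<in> S \<Longrightarrow> y \<in> S \<Longrightarrow> norm (f x $ i - f y $ i) \<le> L i * dist x y"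
    by metis
  show ?thesis
  proof (rule bounded_lipschitz_onI[of _ _ "sum B UNIV" "sum L UNIV"])
    show "norm (f x) \<le> sum B UNIV" if "x \<in> S" for x
      by (rule order_trans[OF norm_vec_le_sum sum_mono[OF B[OF that]]])
    show "norm (f x - f y) \<le> sum L UNIV * dist x y" if "x \<in> S" "y \<in> S" for x y
      unfolding sum_distrib_right
      by (rule order_trans[OF norm_vec_le_sum sum_mono]) (use L[OF that] in simp)
  qed
qed

text \<open>The derivative is bounded on the compact interval that contains the values of
  \<open>f\<close>, which makes the outer function Lipschitz there.\<close>

lemma bounded_lipschitz_on_C1_compose:
  fixes f :: "'a::metric_space \<Rightarrow> real"
  assumes f: "bounded_lipschitz_on S f" "\<And>x. x \<in> S \<Longrightarrow> f x \<in> {a..b}"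
    and \<phi>: "\<And>t. t \<in> {a..b} \<Longrightarrow> (\<phi> has_real_derivative \<phi>' t) (at t)"
    and cont: "continuous_on {a..b} \<phi>'"
  shows "bounded_lipschitz_on S (\<lambda>x. \<phi> (f x))"
proof -
  have "bounded (\<phi>' ` {a..b})"
    using cont by (intro compact_imp_bounded compact_continuous_image) auto
  then obtain M where "\<forall>y\<in>\<phi>' ` {a..b}. norm y \<le> M" unfolding bounded_iff by blast
  then have M: "norm (\<phi>' t) \<le> M" if "t \<in> {a..b}" for t using that by blast
  have "norm (\<phi> s - \<phi> t) \<le> M * norm (s - t)" if "s \<in> {a..b}" "t \<in> {a..b}" for s t
    by (rule field_differentiable_bound[of "{a..b}" \<phi> \<phi>'])
       (use that M \<phi> in \<open>auto intro: has_field_derivative_at_within\<close>)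
  then have lip: "norm (\<phi> s - \<phi> t) \<le> M * dist s t" if "s \<in> {a..b}" "t \<in> {a..b}" for s t
    using that by (simp add: dist_norm)
  have "continuous_on {a..b} \<phi>"
    using \<phi> by (intro continuous_at_imp_continuous_on ballI DERIV_isCont)
  then have "bounded (\<phi> ` {a..b})"
    by (intro compact_imp_bounded compact_continuous_image) auto
  then obtain B where "\<forall>y\<in>\<phi> ` {a..b}. norm y \<le> B" unfolding bounded_iff by blast
  then have "bounded_lipschitz_on {a..b} \<phi>"
    using lip by (intro bounded_lipschitz_onI[of _ _ B M]) blast+
  moreover obtain L where "L-lipschitz_on S f" using f(1) unfolding bounded_lipschitz_on_def by blast
  moreover have "f ` S \<subseteq> {a..b}" using f(2) by blast
  ultimately show ?thesis by (rule bounded_lipschitz_on_compose)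
qed

lemma bounded_lipschitz_on_exp:
  fixes f :: "'a::metric_space \<Rightarrow> real"
  assumes "bounded_lipschitz_on S f"
  shows "bounded_lipschitz_on S (\<lambda>x. exp (f x))"
proof -
  obtain B where "\<And>x. x \<in> S \<Longrightarrow> norm (f x) \<le> B"
    using bounded_lipschitz_onE[OF assms] by metis
  then have "f x \<in> {-B..B}" if "x \<in> S" for x using that by (force simp: abs_le_iff)
  then show ?thesis
    by (rule bounded_lipschitz_on_C1_compose[OF assms _ DERIV_exp continuous_on_exp[OF continuous_on_id]])
qed

lemma bounded_lipschitz_on_inverse_ln:
  fixes f :: "'a::metric_space \<Rightarrow> real"
  assumes f: "bounded_lipschitz_on S f" and c: "c > 0" "\<And>x. x \<in> S \<Longrightarrow> c \<le> f x"
  shows "bounded_lipschitz_on S (\<lambda>x. inverse (f x))" "bounded_lipschitz_on S (\<lambda>x. ln (f x))"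
proof -
  obtain B where "\<And>x. x \<in> S \<Longrightarrow> norm (f x) \<le> B"
    using bounded_lipschitz_onE[OF f] by metis
  then have in_cB: "f x \<in> {c..B}" if "x \<in> S" for x
    using c(2)[OF that] that by (force simp: abs_le_iff)
  have pos: "t > 0" "t \<noteq> 0" if "t \<in> {c..B}" for t using that c(1) by auto
  have inv: "continuous_on {c..B} inverse"
    by (rule continuous_on_inverse[OF continuous_on_id]) (use pos(2) in blast)
  show "bounded_lipschitz_on S (\<lambda>x. inverse (f x))"
    by (rule bounded_lipschitz_on_C1_compose[OF f in_cB DERIV_inverse[OF pos(2)]
          continuous_on_minus[OF continuous_on_power[OF inv]]])
  show "bounded_lipschitz_on S (\<lambda>x. ln (f x))"
    by (rule bounded_lipschitz_on_C1_compose[OF f in_cB DERIV_ln[OF pos(1)] inv])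
qed

section \<open>The slow vector field\<close>

lemma compact_Theta: "compact (Theta P)"
  and convex_Theta: "convex (Theta P)"
proof -
  have "Theta P = cbox (\<chi> j. - Rtheta P) (\<chi> j. Rtheta P)"
    by (auto simp: Theta_def mem_box_cart)
  then show "compact (Theta P)" "convex (Theta P)" by (simp_all add: compact_cbox convex_box)
qed

lemma DeltaS_eq: "DeltaS = {\<mu>. (\<forall>i. 0 \<le> \<mu> $ i)} \<inter> {\<mu>. (\<Sum>i\<in>UNIV. \<mu> $ i) = 1}"
  by (auto simp: DeltaS_def)

lemma closed_DeltaS: "closed DeltaS"
  unfolding DeltaS_eq
  by (intro closed_Int closed_Collect_all closed_Collect_le closed_Collect_eq
      continuous_on_const continuous_on_sum continuous_on_component continuous_on_id)

lemma convex_DeltaS: "convex DeltaS"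
  by (rule convexI) (auto simp: DeltaS_def sum.distrib simp flip: sum_distrib_left)

lemma DeltaS_le_one: "\<mu> \<in> DeltaS \<Longrightarrow> 0 \<le> \<mu> $ i \<and> \<mu> $ i \<le> 1"
  using member_le_sum[of i UNIV "\<lambda>i. \<mu> $ i"] by (auto simp: DeltaS_def)

lemma bounded_DeltaS: "bounded (DeltaS :: (real^'n) set)"
proof -
  have "norm \<mu> \<le> 1" if "\<mu> \<in> DeltaS" for \<mu> :: "real^'n"
    using norm_le_l1_cart[of \<mu>] that by (simp add: DeltaS_def)
  then show ?thesis by (auto simp: bounded_iff)
qed

lemma compact_DeltaS: "compact DeltaS"
  using closed_DeltaS bounded_DeltaS by (simp add: compact_eq_bounded_closed)

lemma DeltaS_nonempty: "(DeltaS :: (real^'n) set) \<noteq> {}"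
proof -
  have "axis undefined 1 \<in> (DeltaS :: (real^'n) set)"
    by (auto simp: DeltaS_def axis_def if_distrib sum.delta)
  then show ?thesis by blast
qed

section \<open>The softmax policy and its score\<close>

locale actor_critic =
  fixes P :: "('n::finite, 'k::finite, 'd::finite, 'm::finite) ac_data"
  assumes Rtheta_pos: "Rtheta P > 0" and tau_pos: "tau P > 0" and lamc_pos: "lamc P > 0"
begin

definition normalizer :: "real^'d \<Rightarrow> 'n \<Rightarrow> real" where
  "normalizer \<theta> i = (\<Sum>b\<in>UNIV. exp ((psi P i b \<bullet> \<theta>) / tau P))"

lemma normalizer_pos: "normalizer \<theta> i > 0"
  unfolding normalizer_def by (intro sum_pos) auto

lemma policy_eq: "policy P \<theta> i a = exp ((psi P i a \<bullet> \<theta>) / tau P) * inverse (normalizer \<theta> i)"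
  by (simp add: policy_def normalizer_def divide_inverse)

lemma ln_policy_eq: "ln (policy P \<theta> i a) = (psi P i a \<bullet> \<theta>) / tau P - ln (normalizer \<theta> i)"
  using normalizer_pos[of \<theta> i] by (simp add: policy_def normalizer_def[symmetric] ln_div)

lemma policy_pos: "policy P \<theta> i a > 0"
  unfolding policy_eq using normalizer_pos[of \<theta> i] by simp

lemma policy_sum: "(\<Sum>a\<in>UNIV. policy P \<theta> i a) = 1"
proof -
  have "(\<Sum>a\<in>UNIV. policy P \<theta> i a) = normalizer \<theta> i * inverse (normalizer \<theta> i)"
    unfolding policy_eq sum_distrib_right[symmetric] normalizer_def[symmetric] ..
  then show ?thesis using normalizer_pos[of \<theta> i] by simp
qed

text \<open>The score of a softmax policy: the feature minus its mean under the policy, at inverse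
  temperature \<open>1 / tau P\<close>.\<close>

definition score :: "'n \<Rightarrow> 'k \<Rightarrow> real^'d \<Rightarrow> real^'d" where
  "score i a \<theta> = (1 / tau P) *\<^sub>R (psi P i a - (\<Sum>b\<in>UNIV. policy P \<theta> i b *\<^sub>R psi P i b))"

lemma gderiv_normalizer:
  "GDERIV (\<lambda>\<theta>. normalizer \<theta> i) \<theta> :> (\<Sum>b\<in>UNIV. (exp ((psi P i b \<bullet> \<theta>) / tau P) / tau P) *\<^sub>R psi P i b)"
  unfolding gderiv_def normalizer_def inner_sum_right
proof (rule has_derivative_sum)
  fix b
  show "((\<lambda>\<theta>. exp (psi P i b \<bullet> \<theta> / tau P)) has_derivative
      (\<lambda>h. h \<bullet> (exp (psi P i b \<bullet> \<theta> / tau P) / tau P) *\<^sub>R psi P i b)) (at \<theta>)"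
    using tau_pos by (auto intro!: derivative_eq_intros simp: inner_commute)
qed

text \<open>\<open>grad\<close> is a definite description, so besides the derivative its uniqueness
  is needed; two gradients agree because they have equal inner products with every vector.\<close>

lemma grad_ln_policy: "grad (\<lambda>\<theta>'. ln (policy P \<theta>' i a)) \<theta> = score i a \<theta>"
proof -
  have D: "GDERIV (\<lambda>\<theta>'. ln (policy P \<theta>' i a)) \<theta> :> score i a \<theta>"
  proof -
    have "((\<lambda>\<theta>'. ln (normalizer \<theta>' i)) has_derivative
        (\<lambda>h. (h \<bullet> (\<Sum>b\<in>UNIV. (exp ((psi P i b \<bullet> \<theta>) / tau P) / tau P) *\<^sub>R psi P i b)) *
          inverse (normalizer \<theta> i))) (at \<theta>)"
      using has_derivative_ln[OF normalizer_pos gderiv_normalizer[unfolded gderiv_def]]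
      by (simp add: divide_inverse)
    moreover have "((\<lambda>\<theta>'. (psi P i a \<bullet> \<theta>') / tau P) has_derivative
        (\<lambda>h. (psi P i a \<bullet> h) / tau P)) (at \<theta>)"
      using tau_pos by (auto intro!: derivative_eq_intros)
    ultimately have "((\<lambda>\<theta>'. (psi P i a \<bullet> \<theta>') / tau P - ln (normalizer \<theta>' i)) has_derivative
        (\<lambda>h. (psi P i a \<bullet> h) / tau P -
          (h \<bullet> (\<Sum>b\<in>UNIV. (exp ((psi P i b \<bullet> \<theta>) / tau P) / tau P) *\<^sub>R psi P i b)) *
          inverse (normalizer \<theta> i))) (at \<theta>)"
      by (intro has_derivative_diff)
    moreover have "(psi P i a \<bullet> h) / tau P -
          (h \<bullet> (\<Sum>b\<in>UNIV. (exp ((psi P i b \<bullet> \<theta>) / tau P) / tau P) *\<^sub>R psi P i b)) *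
          inverse (normalizer \<theta> i) = h \<bullet> score i a \<theta>" for h
      unfolding score_def policy_eq inner_scaleR_right inner_diff_right inner_sum_right
        right_diff_distrib sum_distrib_left sum_distrib_right
      by (simp add: inner_commute mult_ac divide_inverse)
    ultimately show ?thesis unfolding gderiv_def ln_policy_eq by simp
  qed
  show ?thesis
    unfolding grad_def
  proof (rule the_equality)
    show "GDERIV (\<lambda>\<theta>'. ln (policy P \<theta>' i a)) \<theta> :> score i a \<theta>" by (rule D)
    fix g assume "GDERIV (\<lambda>\<theta>'. ln (policy P \<theta>' i a)) \<theta> :> g"
    then have "(\<lambda>h. h \<bullet> g) = (\<lambda>h. h \<bullet> score i a \<theta>)"
      using D unfolding gderiv_def by (rule has_derivative_unique)
    then have "\<forall>h. h \<bullet> g = h \<bullet> score i a \<theta>" by (rule fun_cong[THEN allI])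
    then show "g = score i a \<theta>" by (rule vector_eq_ldot[THEN iffD1])
  qed
qed

text \<open>The measure is kept as a free argument: the exact system inserts its fast variable and
  the reduced one inserts \<open>mu_inv\<close>, so one Lipschitz constant compares the two.\<close>

definition slow_field :: "(real^'d) \<times> (real^'m) \<times> (real^'n) \<Rightarrow> (real^'d) \<times> (real^'m)" where
  "slow_field x = (case x of (\<theta>, w, \<mu>) \<Rightarrow> (Gfun P \<theta> w \<mu>, bvec P \<theta> \<mu> - Amat P \<theta> \<mu> *v w))"

lemma Gfun_eq: "Gfun P \<theta> w \<mu> $ j = ((Rtheta P)\<^sup>2 - (\<theta> $ j)\<^sup>2) * Gtilde P \<theta> w \<mu> $ j"
proof -
  have "Gfun P \<theta> w \<mu> $ j =
      (\<Sum>l\<in>UNIV. (if j = l then (Rtheta P)\<^sup>2 - (\<theta> $ j)\<^sup>2 else 0) * Gtilde P \<theta> w \<mu> $ l)"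
    by (simp add: Gfun_def Dmat_def matrix_vector_mult_def)
  also have "\<dots> =
      (\<Sum>l\<in>UNIV. if l = j then ((Rtheta P)\<^sup>2 - (\<theta> $ j)\<^sup>2) * Gtilde P \<theta> w \<mu> $ j else 0)"
    by (rule sum.cong) auto
  finally show ?thesis by simp
qed

lemma outer_mult: "outer u v *v w = (v \<bullet> w) *\<^sub>R u"
  by (simp add: outer_def matrix_vector_mult_def inner_vec_def vec_eq_iff sum_distrib_left mult_ac)

lemma Amat_mult:
  "Amat P \<theta> \<mu> *v w = lamc P *\<^sub>R w +
     (\<Sum>i\<in>UNIV. \<Sum>a\<in>UNIV. (nu P \<theta> \<mu> i a * (phi P i a \<bullet> w)) *\<^sub>R phi P i a)"
proof -
  interpret mv: bounded_bilinear "(*v) :: real^'m^'m \<Rightarrow> real^'m \<Rightarrow> real^'m"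
    by (rule bounded_bilinear_matrix_vector_mult)
  show ?thesis
    unfolding Amat_def mv.add_left mv.sum_left mv.scaleR_left outer_mult by simp
qed

section \<open>Lipschitz bounds for the slow field\<close>

lemma bounded_lipschitz_linear_Theta:
  "bounded_lipschitz_on (Theta P) (\<lambda>\<theta>. (u \<bullet> \<theta>) / tau P)"
proof -
  have "bounded_lipschitz_on (Theta P) (\<lambda>\<theta>. (u \<bullet> \<theta>) * inverse (tau P))"
    by (intro bounded_lipschitz_on_mult bounded_lipschitz_on_inner bounded_lipschitz_on_const
        bounded_lipschitz_on_ident compact_imp_bounded compact_Theta)
  then show ?thesis by (simp add: divide_inverse)
qed

lemma bounded_lipschitz_exp_Theta:
  "bounded_lipschitz_on (Theta P) (\<lambda>\<theta>. exp ((u \<bullet> \<theta>) / tau P))"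
  by (intro bounded_lipschitz_on_exp bounded_lipschitz_linear_Theta)

lemma bounded_lipschitz_normalizer:
  "bounded_lipschitz_on (Theta P) (\<lambda>\<theta>. inverse (normalizer \<theta> i))"
  "bounded_lipschitz_on (Theta P) (\<lambda>\<theta>. ln (normalizer \<theta> i))"
proof -
  have bl: "bounded_lipschitz_on (Theta P) (\<lambda>\<theta>. normalizer \<theta> i)"
    unfolding normalizer_def by (intro bounded_lipschitz_on_sum bounded_lipschitz_exp_Theta)
  \<comment> \<open>One arbitrary action suffices: its summand alone keeps the normalizer away from
    0 on the box.\<close>
  fix b :: 'k
  obtain B where B: "\<And>\<theta>. \<theta> \<in> Theta P \<Longrightarrow> norm ((psi P i b \<bullet> \<theta>) / tau P) \<le> B"
    using bounded_lipschitz_onE[OF bounded_lipschitz_linear_Theta] by metis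
  have lower: "exp (- B) \<le> normalizer \<theta> i" if "\<theta> \<in> Theta P" for \<theta>
  proof -
    have "- B \<le> (psi P i b \<bullet> \<theta>) / tau P" using B[OF that] by (simp only: real_norm_def abs_le_iff) linarith
    then have "exp (- B) \<le> exp ((psi P i b \<bullet> \<theta>) / tau P)" by (simp only: exp_le_cancel_iff)
    also have "\<dots> \<le> normalizer \<theta> i"
      unfolding normalizer_def by (rule member_le_sum) auto
    finally show ?thesis .
  qed
  show "bounded_lipschitz_on (Theta P) (\<lambda>\<theta>. inverse (normalizer \<theta> i))"
    "bounded_lipschitz_on (Theta P) (\<lambda>\<theta>. ln (normalizer \<theta> i))"
    by (rule bounded_lipschitz_on_inverse_ln[OF bl exp_gt_zero lower], assumption)+
qed

lemma bounded_lipschitz_policy: "bounded_lipschitz_on (Theta P) (\<lambda>\<theta>. policy P \<theta> i a)"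
  unfolding policy_eq by (intro bounded_lipschitz_on_mult bounded_lipschitz_exp_Theta bounded_lipschitz_normalizer)

lemma bounded_lipschitz_ln_policy: "bounded_lipschitz_on (Theta P) (\<lambda>\<theta>. ln (policy P \<theta> i a))"
  unfolding ln_policy_eq by (intro bounded_lipschitz_on_diff bounded_lipschitz_linear_Theta bounded_lipschitz_normalizer)

lemma bounded_lipschitz_score: "bounded_lipschitz_on (Theta P) (\<lambda>\<theta>. score i a \<theta>)"
  unfolding score_def
  by (intro bounded_lipschitz_on_scaleR bounded_lipschitz_on_diff bounded_lipschitz_on_sum
      bounded_lipschitz_on_const bounded_lipschitz_policy)

lemma bounded_lipschitz_theta_component: "bounded_lipschitz_on (Theta P) (\<lambda>\<theta>. \<theta> $ j)"
proof -
  have "bounded_lipschitz_on (Theta P) (\<lambda>\<theta>. \<theta> \<bullet> axis j 1)"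
    by (intro bounded_lipschitz_on_inner bounded_lipschitz_on_const
        bounded_lipschitz_on_ident compact_imp_bounded compact_Theta)
  then show ?thesis by (simp add: inner_axis)
qed

text \<open>The radius is free, unlike in \<open>Kset\<close>: uniqueness in \<open>Xset\<close>
  asks for a Lipschitz constant on every bounded part.\<close>

definition state_box :: "real \<Rightarrow> ((real^'d) \<times> (real^'m) \<times> (real^'n)) set" where
  "state_box \<rho> = Theta P \<times> cball 0 \<rho> \<times> DeltaS"

lemma bounded_lipschitz_box_fst:
  assumes "bounded_lipschitz_on (Theta P) f"
  shows "bounded_lipschitz_on (state_box \<rho>) (\<lambda>x. f (fst x))"
proof (rule bounded_lipschitz_on_compose[OF assms])
  show "1-lipschitz_on (state_box \<rho>) fst"
    by (rule lipschitz_onI) (simp_all add: dist_fst_le)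
  show "fst ` state_box \<rho> \<subseteq> Theta P" by (auto simp: state_box_def)
qed

lemma bounded_lipschitz_box_w: "bounded_lipschitz_on (state_box \<rho>) (\<lambda>x. fst (snd x))"
proof (rule bounded_lipschitz_onI[of _ _ \<rho> 1])
  fix x y :: "(real^'d) \<times> (real^'m) \<times> (real^'n)"
  show "norm (fst (snd x) - fst (snd y)) \<le> 1 * dist x y"
    using order_trans[OF dist_fst_le[of "snd x" "snd y"] dist_snd_le[of x y]]
    by (simp add: dist_norm)
qed (auto simp: state_box_def)

lemma bounded_lipschitz_box_mu: "bounded_lipschitz_on (state_box \<rho>) (\<lambda>x. snd (snd x) $ i)"
proof (rule bounded_lipschitz_onI[of _ _ 1 1])
  fix x y :: "(real^'d) \<times> (real^'m) \<times> (real^'n)"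
  have "\<bar>(snd (snd x) - snd (snd y)) $ i\<bar> \<le> dist (snd (snd x)) (snd (snd y))"
    unfolding dist_norm by (rule component_le_norm_cart)
  also have "\<dots> \<le> dist x y"
    using order_trans[OF dist_snd_le[of "snd x" "snd y"] dist_snd_le[of x y]] .
  finally show "norm (snd (snd x) $ i - snd (snd y) $ i) \<le> 1 * dist x y" by simp
next
  fix x :: "(real^'d) \<times> (real^'m) \<times> (real^'n)" assume "x \<in> state_box \<rho>"
  then have "snd (snd x) \<in> DeltaS" by (auto simp: state_box_def)
  from DeltaS_le_one[OF this, of i] show "norm (snd (snd x) $ i) \<le> 1" by simp
qed

lemma bounded_lipschitz_nu: "bounded_lipschitz_on (state_box \<rho>) (\<lambda>x. nu P (fst x) (snd (snd x)) i a)"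
  unfolding nu_def by (intro bounded_lipschitz_on_mult bounded_lipschitz_box_mu bounded_lipschitz_box_fst bounded_lipschitz_policy)

lemma bounded_lipschitz_Gtilde: "bounded_lipschitz_on (state_box \<rho>) (\<lambda>x. Gtilde P (fst x) (fst (snd x)) (snd (snd x)))"
  unfolding Gtilde_def grad_ln_policy
  by (intro bounded_lipschitz_on_sum bounded_lipschitz_on_scaleR bounded_lipschitz_on_mult
      bounded_lipschitz_on_add bounded_lipschitz_on_diff bounded_lipschitz_on_const
      bounded_lipschitz_on_inner bounded_lipschitz_nu bounded_lipschitz_box_w bounded_lipschitz_box_fst[OF bounded_lipschitz_ln_policy] bounded_lipschitz_box_fst[OF bounded_lipschitz_score])

lemma bounded_lipschitz_Gtilde_component:
  "bounded_lipschitz_on (state_box \<rho>) (\<lambda>x. Gtilde P (fst x) (fst (snd x)) (snd (snd x)) $ j)"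
  using bounded_lipschitz_on_inner[OF bounded_lipschitz_Gtilde bounded_lipschitz_on_const, of \<rho> "axis j 1"]
  by (simp add: inner_axis)

lemma bounded_lipschitz_slow: "bounded_lipschitz_on (state_box \<rho>) slow_field"
proof -
  have G: "bounded_lipschitz_on (state_box \<rho>) (\<lambda>x. Gfun P (fst x) (fst (snd x)) (snd (snd x)))"
    by (rule bounded_lipschitz_on_vec, unfold Gfun_eq power2_eq_square)
       (intro bounded_lipschitz_on_mult bounded_lipschitz_on_diff bounded_lipschitz_on_const
         bounded_lipschitz_Gtilde_component bounded_lipschitz_box_fst[OF bounded_lipschitz_theta_component])
  have W: "bounded_lipschitz_on (state_box \<rho>)
      (\<lambda>x. bvec P (fst x) (snd (snd x)) - Amat P (fst x) (snd (snd x)) *v fst (snd x))"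
    unfolding bvec_def Amat_mult
    by (intro bounded_lipschitz_on_sum bounded_lipschitz_on_scaleR bounded_lipschitz_on_mult
      bounded_lipschitz_on_add bounded_lipschitz_on_diff bounded_lipschitz_on_const
      bounded_lipschitz_on_inner bounded_lipschitz_nu bounded_lipschitz_box_w)
  have "slow_field = (\<lambda>x. (Gfun P (fst x) (fst (snd x)) (snd (snd x)),
      bvec P (fst x) (snd (snd x)) - Amat P (fst x) (snd (snd x)) *v fst (snd x)))"
    by (auto simp: slow_field_def fun_eq_iff)
  with bounded_lipschitz_on_Pair[OF G W] show ?thesis by simp
qed

section \<open>Invariance under small Euler steps\<close>

lemma theta_step:
  assumes G: "\<And>j. \<bar>Gtilde P \<theta> w \<mu> $ j\<bar> \<le> M" and \<theta>: "\<theta> \<in> Theta P"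
    and h: "0 < h" "h * (2 * Rtheta P * M) \<le> 1"
  shows "\<theta> + h *\<^sub>R Gfun P \<theta> w \<mu> \<in> Theta P"
  unfolding Theta_def
proof (intro CollectI allI)
  fix j
  define g where "g = Gtilde P \<theta> w \<mu> $ j"
  have \<theta>j: "0 \<le> Rtheta P - \<theta> $ j" "0 \<le> Rtheta P + \<theta> $ j"
  proof -
    have "- Rtheta P \<le> \<theta> $ j" "\<theta> $ j \<le> Rtheta P" using \<theta> by (auto simp: Theta_def)
    then show "0 \<le> Rtheta P - \<theta> $ j" "0 \<le> Rtheta P + \<theta> $ j" by linarith+
  qed
  have bound: "\<bar>h * (c * g)\<bar> \<le> 1" if "0 \<le> c" "c \<le> 2 * Rtheta P" for c
  proof -
    have "\<bar>h * (c * g)\<bar> = h * (c * \<bar>g\<bar>)" using h that by (simp add: abs_mult)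
    also have "\<dots> \<le> h * (2 * Rtheta P * M)"
      using that h G[of j] Rtheta_pos by (intro mult_left_mono mult_mono) (auto simp: g_def)
    finally show ?thesis using h by simp
  qed
  \<comment> \<open>The factor \<open>(Rtheta P)\<^sup>2 - (\<theta> $ j)\<^sup>2\<close> splits, so
    the new distance to each face is the old distance times a factor that is nonnegative for small
    \<open>h\<close>.\<close>
  have "0 \<le> (Rtheta P - \<theta> $ j) * (1 - h * ((Rtheta P + \<theta> $ j) * g))"
    using bound[of "Rtheta P + \<theta> $ j"] \<theta>j by (intro mult_nonneg_nonneg) (auto simp: abs_le_iff)
  moreover have "0 \<le> (Rtheta P + \<theta> $ j) * (1 + h * ((Rtheta P - \<theta> $ j) * g))"
    using bound[of "Rtheta P - \<theta> $ j"] \<theta>j by (intro mult_nonneg_nonneg) (auto simp: abs_le_iff)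
  ultimately show "- Rtheta P \<le> (\<theta> + h *\<^sub>R Gfun P \<theta> w \<mu>) $ j \<and> (\<theta> + h *\<^sub>R Gfun P \<theta> w \<mu>) $ j \<le> Rtheta P"
    by (simp add: Gfun_eq g_def[symmetric] algebra_simps power2_eq_square)
qed

lemma nu_nonneg: "\<mu> \<in> DeltaS \<Longrightarrow> 0 \<le> nu P \<theta> \<mu> i a"
  using DeltaS_le_one[of \<mu> i] policy_pos[of \<theta> i a] by (simp add: nu_def less_imp_le)

lemma nu_sum: "\<mu> \<in> DeltaS \<Longrightarrow> (\<Sum>i\<in>UNIV. \<Sum>a\<in>UNIV. nu P \<theta> \<mu> i a) = 1"
  by (simp add: nu_def policy_sum DeltaS_def flip: sum_distrib_left)

lemma M_phi: "norm (phi P i a) \<le> M_phi P" and M_r: "\<bar>rew P i a\<bar> \<le> M_r P"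
  unfolding M_phi_def M_r_def by (auto intro!: Max_ge rev_image_eqI[of "(i, a)"])

lemma M_r_nonneg: "0 \<le> M_r P" and M_phi_nonneg: "0 \<le> M_phi P"
  using order_trans[OF abs_ge_zero M_r] order_trans[OF norm_ge_zero M_phi] by blast+

lemma R_w: "B_b P \<le> lamc P * R_w P" "R_w P \<ge> 1"
proof -
  have "0 \<le> B_b P" using M_r_nonneg M_phi_nonneg by (simp add: B_b_def)
  moreover have "2 * B_b P \<le> lamc P * R_w P"
    using lamc_pos by (simp add: R_w_def max_mult_distrib_left)
  ultimately show "B_b P \<le> lamc P * R_w P" by simp
  show "R_w P \<ge> 1" by (simp add: R_w_def)
qed

text \<open>Since \<open>nu\<close> sums to one, an Euler step of the critic is a \<open>nu\<close>-average of vectors that each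
  lie in the ball.\<close>

lemma critic_step:
  assumes \<mu>: "\<mu> \<in> DeltaS" and w: "norm w \<le> R_w P"
    and h: "0 < h" "h * lamc P \<le> 1 / 2" "h * (M_phi P)\<^sup>2 \<le> 1"
  shows "norm (w + h *\<^sub>R (bvec P \<theta> \<mu> - Amat P \<theta> \<mu> *v w)) \<le> R_w P"
proof -
  define c where "c = 1 - h * lamc P"
  have c: "c \<ge> 1 / 2" using h by (simp add: c_def)
  define z where "z i a = c *\<^sub>R w - (h * (phi P i a \<bullet> w)) *\<^sub>R phi P i a + (h * rew P i a) *\<^sub>R phi P i a" for i a
  have "norm (z i a) \<le> R_w P" for i a
  proof -
    \<comment> \<open>Expanding the square shows that the rank-one term can only shorten
      \<open>c *\<^sub>R w\<close>, as long as \<open>h * (norm (phi P i a))\<^sup>2\<close> is at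
      most \<open>2 * c\<close>.\<close>
    have "(norm (c *\<^sub>R w - (h * (phi P i a \<bullet> w)) *\<^sub>R phi P i a))\<^sup>2 =
        c\<^sup>2 * (norm w)\<^sup>2 - h * (phi P i a \<bullet> w)\<^sup>2 * (2 * c - h * (norm (phi P i a))\<^sup>2)"
      unfolding power2_norm_eq_inner
      by (simp add: inner_diff_left inner_diff_right inner_commute power2_eq_square algebra_simps)
    also have "\<dots> \<le> c\<^sup>2 * (norm w)\<^sup>2"
    proof -
      have "h * (norm (phi P i a))\<^sup>2 \<le> h * (M_phi P)\<^sup>2"
        using M_phi[of i a] h by (intro mult_left_mono power_mono) auto
      then have "0 \<le> 2 * c - h * (norm (phi P i a))\<^sup>2" using c h by linarith
      then have "0 \<le> h * (phi P i a \<bullet> w)\<^sup>2 * (2 * c - h * (norm (phi P i a))\<^sup>2)"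
        using h by (intro mult_nonneg_nonneg) auto
      then show ?thesis by linarith
    qed
    finally have "(norm (c *\<^sub>R w - (h * (phi P i a \<bullet> w)) *\<^sub>R phi P i a))\<^sup>2 \<le> (c * norm w)\<^sup>2"
      by (simp only: power_mult_distrib)
    then have "norm (c *\<^sub>R w - (h * (phi P i a \<bullet> w)) *\<^sub>R phi P i a) \<le> c * norm w"
      by (rule power2_le_imp_le) (use c in simp)
    also have "\<dots> \<le> c * R_w P" using c w by (intro mult_left_mono) auto
    finally have 1: "norm (c *\<^sub>R w - (h * (phi P i a \<bullet> w)) *\<^sub>R phi P i a) \<le> c * R_w P" .
    have "norm ((h * rew P i a) *\<^sub>R phi P i a) = h * (\<bar>rew P i a\<bar> * norm (phi P i a))"
      using h by (simp add: abs_mult)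
    also have "\<dots> \<le> h * B_b P"
      unfolding B_b_def using h by (intro mult_left_mono mult_mono M_r M_phi M_r_nonneg) auto
    \<comment> \<open>The choice of \<open>R_w\<close> lets the damping \<open>lamc P\<close> absorb
      the reward: \<open>c * R_w P\<close> falls short of \<open>R_w P\<close> by exactly this
      amount.\<close>
    also have "\<dots> \<le> h * (lamc P * R_w P)" using R_w(1) h by (intro mult_left_mono) auto
    finally have "norm (z i a) \<le> c * R_w P + h * (lamc P * R_w P)"
      unfolding z_def by (intro norm_triangle_mono 1)
    also have "\<dots> = R_w P" by (simp add: c_def algebra_simps)
    finally show ?thesis .
  qed
  note z_le = this
  have "(\<Sum>i\<in>UNIV. \<Sum>a\<in>UNIV. nu P \<theta> \<mu> i a *\<^sub>R z i a) =
      (\<Sum>i\<in>UNIV. \<Sum>a\<in>UNIV. nu P \<theta> \<mu> i a) *\<^sub>R (c *\<^sub>R w)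
      - h *\<^sub>R (\<Sum>i\<in>UNIV. \<Sum>a\<in>UNIV. (nu P \<theta> \<mu> i a * (phi P i a \<bullet> w)) *\<^sub>R phi P i a)
      + h *\<^sub>R bvec P \<theta> \<mu>"
    unfolding z_def bvec_def scaleR_add_right scaleR_diff_right sum.distrib sum_subtractf
      scaleR_sum_left scaleR_sum_right
    by (simp add: mult_ac)
  then have "w + h *\<^sub>R (bvec P \<theta> \<mu> - Amat P \<theta> \<mu> *v w) = (\<Sum>i\<in>UNIV. \<Sum>a\<in>UNIV. nu P \<theta> \<mu> i a *\<^sub>R z i a)"
    unfolding nu_sum[OF \<mu>] Amat_mult by (simp add: c_def algebra_simps)
  also have "norm \<dots> \<le> (\<Sum>i\<in>UNIV. \<Sum>a\<in>UNIV. nu P \<theta> \<mu> i a * R_w P)"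
    using nu_nonneg[OF \<mu>] z_le by (intro order_trans[OF norm_sum] sum_mono) (auto intro!: mult_left_mono)
  also have "\<dots> = R_w P" by (simp add: nu_sum[OF \<mu>] flip: sum_distrib_right)
  finally show ?thesis .
qed

lemma slow_step:
  obtains h0 where "h0 > 0"
    "\<And>\<theta> w \<mu> h. (\<theta>, w, \<mu>) \<in> Kset P \<Longrightarrow> 0 < h \<Longrightarrow> h \<le> h0 \<Longrightarrow>
       (\<theta>, w) + h *\<^sub>R slow_field (\<theta>, w, \<mu>) \<in> Theta P \<times> cball 0 (R_w P)"
proof -
  obtain M where M: "M \<ge> 0" "\<And>x. x \<in> state_box (R_w P) \<Longrightarrow> norm (Gtilde P (fst x) (fst (snd x)) (snd (snd x))) \<le> M"
    using bounded_lipschitz_onE[OF bounded_lipschitz_Gtilde] by metis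
  \<comment> \<open>Dominates each rate that the actor and critic steps require to be at most
    \<open>1 / h\<close>; the summand 1 keeps it positive.\<close>
  define D where "D = 1 + 2 * Rtheta P * M + 2 * lamc P + (M_phi P)\<^sup>2"
  have D: "D > 0" "2 * Rtheta P * M \<le> D" "2 * lamc P \<le> D" "(M_phi P)\<^sup>2 \<le> D"
    unfolding D_def using Rtheta_pos lamc_pos M(1)
    by (auto intro!: add_nonneg_nonneg add_pos_nonneg simp: less_imp_le)
  show thesis
  proof (rule that[of "1 / D"])
    show "1 / D > 0" using D by simp
    fix \<theta> w \<mu> and h :: real assume x: "(\<theta>, w, \<mu>) \<in> Kset P" and h: "0 < h" "h \<le> 1 / D"
    have small: "h * b \<le> 1" if "b \<le> D" for b
    proof -
      have "h * b \<le> h * D" using that h by (intro mult_left_mono) auto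
      also have "\<dots> \<le> 1" using h D(1) by (simp add: field_simps)
      finally show ?thesis .
    qed
    have "\<bar>Gtilde P \<theta> w \<mu> $ j\<bar> \<le> M" for j
      using order_trans[OF component_le_norm_cart M(2)[of "(\<theta>, w, \<mu>)"]] x
      by (simp add: state_box_def Kset_def)
    then have "\<theta> + h *\<^sub>R Gfun P \<theta> w \<mu> \<in> Theta P"
      using x h small[OF D(2)] by (intro theta_step) (auto simp: Kset_def)
    moreover have "norm (w + h *\<^sub>R (bvec P \<theta> \<mu> - Amat P \<theta> \<mu> *v w)) \<le> R_w P"
      using x h small[OF D(3)] small[OF D(4)] by (intro critic_step) (auto simp: Kset_def)
    ultimately show "(\<theta>, w) + h *\<^sub>R slow_field (\<theta>, w, \<mu>) \<in> Theta P \<times> cball 0 (R_w P)"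
      by (simp add: slow_field_def)
  qed
qed

end

section \<open>The fast equation\<close>

lemma l1norm_nonneg: "0 \<le> l1norm x"
  by (simp add: l1norm_def sum_nonneg)

lemma l1norm_triangle: "l1norm (x + y) \<le> l1norm x + l1norm y"
  unfolding l1norm_def sum.distrib[symmetric] by (intro sum_mono) simp

lemma l1norm_minus: "l1norm (- x) = l1norm x"
  by (simp add: l1norm_def)

lemma l1norm_minus_commute: "l1norm (x - y) = l1norm (y - x)"
  using l1norm_minus[of "x - y"] by simp

lemma l1norm_diff_triangle: "l1norm (x - y) \<le> l1norm x + l1norm y"
  using l1norm_triangle[of x "- y"] by (simp add: l1norm_minus)

lemma l1norm_scaleR: "l1norm (c *\<^sub>R x) = \<bar>c\<bar> * l1norm x"
  by (simp add: l1norm_def abs_mult sum_distrib_left)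

lemma norm_le_l1norm: "norm x \<le> l1norm x"
  unfolding l1norm_def by (rule norm_le_l1_cart)

lemma l1norm_le_norm: "l1norm (x :: real^'n) \<le> CARD('n) * norm x"
proof -
  have "l1norm x \<le> (\<Sum>i\<in>(UNIV :: 'n set). norm x)"
    unfolding l1norm_def by (intro sum_mono component_le_norm_cart)
  then show ?thesis by simp
qed

lemma l1norm_zero [simp]: "l1norm 0 = 0"
  by (simp add: l1norm_def)

lemma l1norm_eq_0: "l1norm x = 0 \<longleftrightarrow> x = 0"
  using norm_le_l1norm[of x] by auto

lemma l1norm_matrix_vector_le:
  fixes A :: "real^'n^'n"
  shows "l1norm (A *v x) \<le> (\<Sum>i\<in>UNIV. \<Sum>j\<in>UNIV. \<bar>A $ i $ j\<bar>) * l1norm x"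
proof -
  have "\<bar>(A *v x) $ i\<bar> \<le> (\<Sum>j\<in>UNIV. \<bar>A $ i $ j\<bar>) * l1norm x" for i
  proof -
    have "\<bar>(A *v x) $ i\<bar> \<le> (\<Sum>j\<in>UNIV. \<bar>A $ i $ j\<bar> * \<bar>x $ j\<bar>)"
      unfolding matrix_vector_mult_def by (simp flip: abs_mult)
    also have "\<dots> \<le> (\<Sum>j\<in>UNIV. \<bar>A $ i $ j\<bar> * l1norm x)"
      by (intro sum_mono mult_left_mono) (auto simp: l1norm_def intro!: member_le_sum)
    finally show ?thesis by (simp add: sum_distrib_right)
  qed
  then show ?thesis
    unfolding l1norm_def[of "A *v x"] sum_distrib_right[of _ UNIV] by (intro sum_mono)
qed

text \<open>\<open>opnorm1\<close> is a supremum of reals and is informative only once the quotients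
  are bounded, which the sum of the absolute entries provides. At the zero vector the quotient is 0
  by convention.\<close>

lemma l1norm_mult_le_opnorm1:
  fixes A :: "real^'n^'n"
  shows "l1norm (A *v x) \<le> opnorm1 A * l1norm x"
proof (cases "x = 0")
  case False
  then have pos: "l1norm x > 0" using l1norm_nonneg[of x] l1norm_eq_0[of x] by simp
  have "l1norm (A *v y) / l1norm y \<le> (\<Sum>i\<in>UNIV. \<Sum>j\<in>UNIV. \<bar>A $ i $ j\<bar>)" for y
  proof (cases "y = 0")
    case True
    then show ?thesis by (simp add: sum_nonneg)
  next
    case False
    then have "l1norm y > 0" using l1norm_nonneg[of y] l1norm_eq_0[of y] by simp
    then show ?thesis using l1norm_matrix_vector_le[of A y] by (simp add: pos_divide_le_eq)
  qed
  then have "bdd_above (range (\<lambda>y. l1norm (A *v y) / l1norm y))" by (intro bdd_aboveI2)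
  then have "l1norm (A *v x) / l1norm x \<le> opnorm1 A"
    unfolding opnorm1_def by (rule cSUP_upper[OF UNIV_I])
  then show ?thesis using pos by (simp add: pos_divide_le_eq)
qed simp

text \<open>Testing on a unit vector extracts an entry. In this way the Lipschitz hypothesis on the
  generators passes to the Euclidean matrix norm.\<close>

lemma entry_le_opnorm1:
  fixes A :: "real^'n^'n"
  shows "\<bar>A $ i $ j\<bar> \<le> opnorm1 A"
proof -
  have "\<bar>A $ i $ j\<bar> = \<bar>(A *v axis j 1) $ i\<bar>"
    by (simp add: matrix_vector_mul_component inner_axis)
  also have "\<dots> \<le> l1norm (A *v axis j 1)"
    unfolding l1norm_def by (rule member_le_sum) auto
  also have "\<dots> \<le> opnorm1 A * l1norm (axis j 1 :: real^'n)" by (rule l1norm_mult_le_opnorm1)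
  also have "l1norm (axis j 1 :: real^'n) = 1"
  proof -
    have "l1norm (axis j 1 :: real^'n) = (\<Sum>k\<in>UNIV. if k = j then 1 else 0)"
      unfolding l1norm_def axis_def by (rule sum.cong) auto
    then show ?thesis by simp
  qed
  finally show ?thesis by simp
qed

lemma bounded_lipschitz_on_of_lipschitz:
  assumes "bounded S" "L-lipschitz_on S f"
  shows "bounded_lipschitz_on S f"
proof -
  have "bounded (f ` S)"
  proof (cases "S = {}")
    case False
    then obtain x0 where x0: "x0 \<in> S" by blast
    obtain e where e: "\<And>x. x \<in> S \<Longrightarrow> dist x0 x \<le> e"
      using assms(1) bounded_any_center[of S x0] by blast
    have "dist (f x0) y \<le> L * e" if y: "y \<in> f ` S" for y
    proof -
      obtain x where x: "x \<in> S" "y = f x" using y by blast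
      have "dist (f x0) y \<le> L * dist x0 x" unfolding x(2) by (rule lipschitz_onD[OF assms(2) x0 x(1)])
      also have "\<dots> \<le> L * e" by (intro mult_left_mono e x lipschitz_on_nonneg[OF assms(2)])
      finally show ?thesis .
    qed
    then show ?thesis unfolding bounded_def by blast
  qed simp
  with assms(2) show ?thesis unfolding bounded_lipschitz_on_def by blast
qed

section \<open>Generators, the simplex and stationary measures\<close>

locale fast_slow = actor_critic P
  for P :: "('n::finite, 'k::finite, 'd::finite, 'm::finite) ac_data" +
  fixes L_Q C \<gamma> :: real
  assumes offdiag: "\<theta> \<in> Theta P \<Longrightarrow> i \<noteq> j \<Longrightarrow> 0 \<le> gen P \<theta> $ i $ j"
    and diag: "\<theta> \<in> Theta P \<Longrightarrow> gen P \<theta> $ i $ i = - (\<Sum>j\<in>UNIV - {i}. gen P \<theta> $ i $ j)"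
    and L_Q_pos: "L_Q > 0"
    and gen_lipschitz: "\<theta> \<in> Theta P \<Longrightarrow> \<theta>' \<in> Theta P \<Longrightarrow>
          opnorm1 (Qstar P \<theta> - Qstar P \<theta>') \<le> L_Q * norm (\<theta> - \<theta>')"
    and C_ge_1: "C \<ge> 1" and \<gamma>_pos: "\<gamma> > 0" and pathwise: "pathwise_bound P C \<gamma>"
begin

sublocale mv: bounded_bilinear "(*v) :: real^'n^'n \<Rightarrow> real^'n \<Rightarrow> real^'n"
  by (rule bounded_bilinear_matrix_vector_mult)

lemma Qstar_component: "(Qstar P \<theta> *v x) $ i = (\<Sum>j\<in>UNIV. gen P \<theta> $ j $ i * x $ j)"
  by (simp add: Qstar_def matrix_vector_mult_def transpose_def)

text \<open>Rows of a generator sum to zero, so the transposed equation conserves total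
  mass.\<close>

lemma Qstar_mult_in_Zset:
  assumes "\<theta> \<in> Theta P"
  shows "Qstar P \<theta> *v x \<in> Zset"
proof -
  have row: "(\<Sum>i\<in>UNIV. gen P \<theta> $ j $ i) = 0" for j
    using diag[OF assms, of j] by (simp add: sum.remove[of UNIV j])
  have "(\<Sum>i\<in>UNIV. \<Sum>j\<in>UNIV. gen P \<theta> $ j $ i * x $ j) = (\<Sum>j\<in>UNIV. \<Sum>i\<in>UNIV. gen P \<theta> $ j $ i * x $ j)"
    by (rule sum.swap)
  also have "\<dots> = 0" by (simp add: row flip: sum_distrib_right)
  finally show ?thesis by (simp add: Zset_def Qstar_component)
qed

lemma bounded_lipschitz_Qstar: "bounded_lipschitz_on (Theta P) (\<lambda>\<theta>. Qstar P \<theta>)"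
proof (intro bounded_lipschitz_on_vec bounded_lipschitz_on_of_lipschitz[of _ L_Q])
  fix i j
  show "bounded (Theta P)" by (rule compact_imp_bounded[OF compact_Theta])
  show "L_Q-lipschitz_on (Theta P) (\<lambda>\<theta>. Qstar P \<theta> $ i $ j)"
  proof (rule lipschitz_onI)
    fix \<theta> \<theta>' assume "\<theta> \<in> Theta P" "\<theta>' \<in> Theta P"
    from order_trans[OF entry_le_opnorm1 gen_lipschitz[OF this], of i j]
    show "dist (Qstar P \<theta> $ i $ j) (Qstar P \<theta>' $ i $ j) \<le> L_Q * dist \<theta> \<theta>'"
      by (simp add: dist_norm)
  qed (use L_Q_pos in simp)
qed

lemma continuous_on_Qstar_path:
  assumes "continuous_on S \<zeta>" "\<And>u. u \<in> S \<Longrightarrow> \<zeta> u \<in> Theta P"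
  shows "continuous_on S (\<lambda>u. Qstar P (\<zeta> u))"
proof (rule continuous_on_compose2[OF _ assms(1)])
  show "continuous_on (Theta P) (Qstar P)"
    using bounded_lipschitz_Qstar unfolding bounded_lipschitz_on_def by (auto intro: lipschitz_on_continuous_on)
  show "\<zeta> ` S \<subseteq> Theta P" using assms(2) by blast
qed

text \<open>For small \<open>h\<close> the Euler step is multiplication by a stochastic matrix: the
  off-diagonal rates only add mass to a coordinate, and the diagonal removes at most the fraction
  \<open>h * B\<close>.\<close>

lemma mu_step:
  obtains h0 where "h0 > 0"
    "\<And>\<theta> \<mu> h. \<theta> \<in> Theta P \<Longrightarrow> \<mu> \<in> DeltaS \<Longrightarrow> 0 < h \<Longrightarrow> h \<le> h0 \<Longrightarrow>
       \<mu> + h *\<^sub>R (Qstar P \<theta> *v \<mu>) \<in> DeltaS"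
proof -
  obtain B where B: "B \<ge> 0" "\<And>\<theta>. \<theta> \<in> Theta P \<Longrightarrow> norm (Qstar P \<theta>) \<le> B"
    using bounded_lipschitz_onE[OF bounded_lipschitz_Qstar] by metis
  show thesis
  proof (rule that[of "1 / (B + 1)"])
    show "1 / (B + 1) > 0" using B by simp
    fix \<theta> and \<mu> :: "real^'n" and h :: real assume \<theta>: "\<theta> \<in> Theta P" and \<mu>: "\<mu> \<in> DeltaS" and h: "0 < h" "h \<le> 1 / (B + 1)"
    have "0 \<le> \<mu> $ i + h * (Qstar P \<theta> *v \<mu>) $ i" for i
    proof -
      have "\<bar>gen P \<theta> $ i $ i\<bar> \<le> norm (Qstar P \<theta>)"
        using order_trans[OF component_le_norm_cart Finite_Cartesian_Product.norm_nth_le, of "Qstar P \<theta>" i i]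
        by (simp add: Qstar_def transpose_def)
      then have q: "- B \<le> gen P \<theta> $ i $ i" using B(2)[OF \<theta>] by linarith
      have "0 \<le> (1 - h * B) * \<mu> $ i"
      proof (intro mult_nonneg_nonneg)
        have "h * B \<le> h * (B + 1)" using h by simp
        also have "\<dots> \<le> 1" using h B(1) by (simp add: field_simps)
        finally show "0 \<le> 1 - h * B" by simp
      qed (use DeltaS_le_one[OF \<mu>, of i] in simp)
      also have "\<dots> = \<mu> $ i + h * (- B * \<mu> $ i)" by (simp add: algebra_simps)
      also have "\<dots> \<le> \<mu> $ i + h * (gen P \<theta> $ i $ i * \<mu> $ i + (\<Sum>j\<in>UNIV - {i}. gen P \<theta> $ j $ i * \<mu> $ j))"
      proof (intro add_left_mono mult_left_mono)
        have "0 \<le> (\<Sum>j\<in>UNIV - {i}. gen P \<theta> $ j $ i * \<mu> $ j)"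
          using offdiag[OF \<theta>] DeltaS_le_one[OF \<mu>] by (intro sum_nonneg mult_nonneg_nonneg) auto
        moreover have "- B * \<mu> $ i \<le> gen P \<theta> $ i $ i * \<mu> $ i"
          using q DeltaS_le_one[OF \<mu>, of i] by (intro mult_right_mono) auto
        ultimately show "- B * \<mu> $ i \<le> gen P \<theta> $ i $ i * \<mu> $ i + (\<Sum>j\<in>UNIV - {i}. gen P \<theta> $ j $ i * \<mu> $ j)"
          by linarith
      qed (use h in simp)
      also have "gen P \<theta> $ i $ i * \<mu> $ i + (\<Sum>j\<in>UNIV - {i}. gen P \<theta> $ j $ i * \<mu> $ j) = (Qstar P \<theta> *v \<mu>) $ i"
        unfolding Qstar_component by (simp add: sum.remove[of UNIV i])
      finally show ?thesis .
    qed
    moreover have "(\<Sum>i\<in>UNIV. \<mu> $ i + h * (Qstar P \<theta> *v \<mu>) $ i) = 1"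
      using Qstar_mult_in_Zset[OF \<theta>, of \<mu>] \<mu>
      by (simp add: sum.distrib Zset_def DeltaS_def flip: sum_distrib_left)
    ultimately show "\<mu> + h *\<^sub>R (Qstar P \<theta> *v \<mu>) \<in> DeltaS" by (simp add: DeltaS_def)
  qed
qed

text \<open>Fixed points of the Euler step are exactly the zeros of
  \<open>Qstar P \<theta>\<close>.\<close>

lemma stationary_exists:
  assumes "\<theta> \<in> Theta P"
  obtains \<mu> where "\<mu> \<in> DeltaS" "Qstar P \<theta> *v \<mu> = 0"
proof -
  obtain h0 where h0: "h0 > 0" "\<And>\<theta> \<mu> h. \<theta> \<in> Theta P \<Longrightarrow> \<mu> \<in> DeltaS \<Longrightarrow> 0 < h \<Longrightarrow> h \<le> h0 \<Longrightarrow>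
       \<mu> + h *\<^sub>R (Qstar P \<theta> *v \<mu>) \<in> DeltaS"
    using mu_step by metis
  have "continuous_on DeltaS (\<lambda>\<mu>. \<mu> + h0 *\<^sub>R (Qstar P \<theta> *v \<mu>))"
    by (intro continuous_on_add continuous_on_scaleR continuous_on_const continuous_on_id mv.continuous_on)
  moreover have "(\<lambda>\<mu>. \<mu> + h0 *\<^sub>R (Qstar P \<theta> *v \<mu>)) \<in> DeltaS \<rightarrow> DeltaS"
    using h0 assms by (intro Pi_I h0(2)) auto
  ultimately obtain \<mu> where "\<mu> \<in> DeltaS" "\<mu> + h0 *\<^sub>R (Qstar P \<theta> *v \<mu>) = \<mu>"
    using brouwer[OF compact_DeltaS convex_DeltaS DeltaS_nonempty] by blast
  with h0(1) that show thesis by simp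
qed

text \<open>Makes the pathwise bound usable: along a continuous path, \<open>evol\<close> from
  \<open>s\<close> to \<open>t\<close> is the action of \<open>X t ** Y s\<close> on
  \<open>Zset\<close>, and this product can be differentiated in \<open>s\<close>.\<close>

lemma evolution_matrices:
  assumes \<zeta>: "continuous_on {0..} \<zeta>" "\<And>u. 0 \<le> u \<Longrightarrow> \<zeta> u \<in> Theta P" and \<delta>: "\<delta> > 0"
  obtains X Y :: "real \<Rightarrow> real^'n^'n" where
    "Y 0 = mat 1"
    "\<And>t. 0 \<le> t \<Longrightarrow> (Y has_vector_derivative - (Y t ** ((1 / \<delta>) *\<^sub>R Qstar P (\<zeta> t)))) (at t within {0..})"
    "\<And>t. 0 \<le> t \<Longrightarrow> X t ** Y t = mat 1"
    "\<And>s t \<xi>. 0 \<le> s \<Longrightarrow> s \<le> t \<Longrightarrow> \<xi> \<in> Zset \<Longrightarrow>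
       l1norm (X t *v (Y s *v \<xi>)) \<le> C * exp (- \<gamma> * (t - s) / \<delta>) * l1norm \<xi>"
proof -
  define A where "A t = (1 / \<delta>) *\<^sub>R Qstar P (\<zeta> t)" for t
  obtain B where B: "B \<ge> 0" "\<And>\<theta>. \<theta> \<in> Theta P \<Longrightarrow> norm (Qstar P \<theta>) \<le> B"
    using bounded_lipschitz_onE[OF bounded_lipschitz_Qstar] by metis
  have A_cont: "continuous_on {0..} A"
    unfolding A_def by (intro continuous_on_scaleR continuous_on_const continuous_on_Qstar_path \<zeta>) (use \<zeta> in auto)
  have A_bd: "norm (A t) \<le> B / \<delta>" if "0 \<le> t" for t
    using B(2)[OF \<zeta>(2)[OF that]] \<delta> by (simp add: A_def field_simps)
  obtain X Y where X0: "X 0 = mat 1" and Y0: "Y 0 = mat 1"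
    and X: "\<And>t. 0 \<le> t \<Longrightarrow> (X has_vector_derivative A t ** X t) (at t within {0..})"
    and Y: "\<And>t. 0 \<le> t \<Longrightarrow> (Y has_vector_derivative - (Y t ** A t)) (at t within {0..})"
    and XY: "\<And>t. 0 \<le> t \<Longrightarrow> X t ** Y t = mat 1"
    using linear_fundamental_solution[OF A_cont A_bd] by blast
  obtain K where K: "K \<ge> 0" "\<And>(M :: real^'n^'n) v. norm (M *v v) \<le> norm M * norm v * K"
    using mv.nonneg_bounded by metis
  have A_mult: "(1 / \<delta>) *\<^sub>R (Qstar P (\<zeta> u) *v v) = A u *v v" for u v
    by (simp add: A_def mv.scaleR_left)
  have evol_eq: "evol P \<delta> \<zeta> t s \<xi> = X t *v (Y s *v \<xi>)"
    if st: "0 \<le> s" "s \<le> t" and \<xi>: "\<xi> \<in> Zset" for s t \<xi>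
  proof -
    define x where "x u = X u *v (Y s *v \<xi>)" for u
    have xs: "x s = \<xi>"
      unfolding x_def using XY[OF st(1)] by (simp add: matrix_vector_mul_assoc)
    have dx: "(x has_vector_derivative A u *v x u) (at u within {0..})" if "0 \<le> u" for u
      unfolding x_def matrix_vector_mul_assoc[of "A u" "X u"]
      using bounded_linear.has_vector_derivative[OF mv.bounded_linear_left X[OF that]] .
    have dx_s: "(x has_vector_derivative A u *v x u) (at u within {s..})" if "s \<le> u" for u
      by (rule has_vector_derivative_within_subset[OF dx]) (use st that in auto)
    have x_cont: "continuous_on {0..} x"
      unfolding continuous_on_eq_continuous_within
      using dx has_vector_derivative_continuous by fastforce
    \<comment> \<open>The coordinate sum is conserved, since \<open>A r\<close> maps into
      \<open>Zset\<close>.\<close>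
    have xZ: "x u \<in> Zset" if "0 \<le> u" for u
    proof -
      have lin: "bounded_linear (\<lambda>v :: real^'n. \<Sum>i\<in>UNIV. v $ i)"
        by (intro bounded_linear_sum bounded_linear_vec_nth)
      have "((\<lambda>u. \<Sum>i\<in>UNIV. x u $ i) has_vector_derivative 0) (at r within {0..})" if "r \<in> {0..}" for r
      proof -
        have r: "0 \<le> r" using that by simp
        have "(\<Sum>i\<in>UNIV. (A r *v x r) $ i) = 0"
          using Qstar_mult_in_Zset[OF \<zeta>(2)[OF r], of "x r"]
          by (simp add: A_def mv.scaleR_left Zset_def flip: sum_divide_distrib)
        with bounded_linear.has_vector_derivative[OF lin dx[OF r]] show ?thesis by simp
      qed
      then obtain c where c: "\<And>r. r \<in> {0..} \<Longrightarrow> (\<Sum>i\<in>UNIV. x r $ i) = c"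
        using has_vector_derivative_zero_constant[of "{0..}" "\<lambda>u. \<Sum>i\<in>UNIV. x u $ i"] by auto
      have "(\<Sum>i\<in>UNIV. x u $ i) = (\<Sum>i\<in>UNIV. x s $ i)" using c that st by simp
      with \<xi> xs show ?thesis by (simp add: Zset_def)
    qed
    have x_ac: "abs_cont_on s u x" for u
    proof (rule abs_cont_on_C1)
      show "(x has_vector_derivative A r *v x r) (at r within {s..})" if "r \<in> {s..u}" for r
        using dx_s that by simp
      show "continuous_on {s..u} (\<lambda>r. A r *v x r)"
        by (intro mv.continuous_on continuous_on_subset[OF A_cont] continuous_on_subset[OF x_cont])
           (use st in auto)
    qed
    have x_sol: "path_solution P \<delta> \<zeta> s x"
      unfolding path_solution_def A_mult
      using xZ st x_ac dx_s by (intro conjI allI impI AE_I2) auto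
    show ?thesis
      unfolding evol_def x_def[symmetric]
    proof (rule the_equality)
      show "\<exists>z. path_solution P \<delta> \<zeta> s z \<and> z s = \<xi> \<and> z t = x t" using x_sol xs by blast
      fix y assume "\<exists>z. path_solution P \<delta> \<zeta> s z \<and> z s = \<xi> \<and> z t = y"
      then obtain z where z: "path_solution P \<delta> \<zeta> s z" "z s = \<xi>" "z t = y" by blast
      have "(\<lambda>u. z u - x u) t = 0"
      \<comment> \<open>Freezing the matrix before time \<open>s\<close> makes its bound hold at
        every \<open>u\<close> and changes nothing on \<open>{s..}\<close>; the added 1 keeps the
        constant positive.\<close>
      proof (rule linear_caratheodory_zero[of s t _ "\<lambda>u v. A (max s u) *v v" "B / \<delta> * K + 1"])
        show "s \<le> t" by (rule st)
        show "abs_cont_on s t (\<lambda>u. z u - x u)"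
          using z(1) st x_ac by (intro abs_cont_on_diff) (auto simp: path_solution_def)
        have "AE u in lebesgue. s \<le> u \<longrightarrow> (z has_vector_derivative A u *v z u) (at u within {s..})"
          using z(1) unfolding path_solution_def A_mult by blast
        then show "AE u in lebesgue. s \<le> u \<longrightarrow>
            ((\<lambda>u. z u - x u) has_vector_derivative A (max s u) *v (z u - x u)) (at u within {s..})"
        proof (rule AE_mp, intro AE_I2 impI)
          fix u assume u: "s \<le> u \<longrightarrow> (z has_vector_derivative A u *v z u) (at u within {s..})" "s \<le> u"
          then have "((\<lambda>u. z u - x u) has_vector_derivative A u *v z u - A u *v x u) (at u within {s..})"
            using dx_s by (intro has_vector_derivative_diff) auto
          then show "((\<lambda>u. z u - x u) has_vector_derivative A (max s u) *v (z u - x u)) (at u within {s..})"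
            using u(2) by (simp add: mv.diff_right max_def)
        qed
        show "norm (A (max s u) *v v) \<le> (B / \<delta> * K + 1) * norm v" for u v
        proof -
          have "norm (A (max s u) *v v) \<le> norm (A (max s u)) * norm v * K" by (rule K(2))
          also have "\<dots> \<le> B / \<delta> * norm v * K"
            using A_bd[of "max s u"] st K(1) by (intro mult_right_mono) auto
          also have "\<dots> \<le> (B / \<delta> * K + 1) * norm v" by (simp add: algebra_simps)
          finally show ?thesis .
        qed
        show "B / \<delta> * K + 1 > 0" using B(1) \<delta> K(1) by (intro add_nonneg_pos) auto
        show "z s - x s = 0" using z(2) xs by simp
      qed
      then show "y = x t" using z(3) by simp
    qed
  qed
  have meas: "\<zeta> \<in> borel_measurable (restrict_space borel {0..})"
    by (rule borel_measurable_continuous_on_restrict[OF \<zeta>(1)])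
  have "l1norm (X t *v (Y s *v \<xi>)) \<le> C * exp (- \<gamma> * (t - s) / \<delta>) * l1norm \<xi>"
    if "0 \<le> s" "s \<le> t" "\<xi> \<in> Zset" for s t \<xi>
    using pathwise \<delta> meas \<zeta>(2) that evol_eq[OF that] unfolding pathwise_bound_def by metis
  with Y0 Y XY show thesis using that unfolding A_def by blast
qed

text \<open>The path \<open>m\<close> is only Lipschitz in time, so the Duhamel integral of its derivative is
  replaced by a bound on the increments of \<open>s \<mapsto> X t (Y s (p s - m s))\<close>, where \<open>X t (Y s)\<close> is the
  evolution family.\<close>

lemma duhamel_bound:
  fixes p m :: "real \<Rightarrow> real^'n"
  assumes \<zeta>: "continuous_on {0..} \<zeta>" "\<And>u. 0 \<le> u \<Longrightarrow> \<zeta> u \<in> Theta P" and \<delta>: "\<delta> > 0"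
    and p: "\<And>s. 0 \<le> s \<Longrightarrow>
      (p has_vector_derivative (1 / \<delta>) *\<^sub>R (Qstar P (\<zeta> s) *v (p s - m s))) (at s within {0..})"
    and m: "\<And>u v. 0 \<le> u \<Longrightarrow> 0 \<le> v \<Longrightarrow> m v - m u \<in> Zset"
      "\<And>u v. 0 \<le> u \<Longrightarrow> 0 \<le> v \<Longrightarrow> l1norm (m v - m u) \<le> M * \<bar>v - u\<bar>"
    and M: "M \<ge> 0" and init: "p 0 - m 0 \<in> Zset" and t: "0 \<le> t"
  shows "l1norm (p t - m t) \<le> C * exp (- \<gamma> * t / \<delta>) * l1norm (p 0 - m 0) + C * M * \<delta> / \<gamma>"
proof -
  obtain X Y :: "real \<Rightarrow> real^'n^'n" where Y0: "Y 0 = mat 1"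
    and Y: "\<And>t. 0 \<le> t \<Longrightarrow> (Y has_vector_derivative - (Y t ** ((1 / \<delta>) *\<^sub>R Qstar P (\<zeta> t)))) (at t within {0..})"
    and XY: "\<And>t. 0 \<le> t \<Longrightarrow> X t ** Y t = mat 1"
    and XYb: "\<And>s t \<xi>. 0 \<le> s \<Longrightarrow> s \<le> t \<Longrightarrow> \<xi> \<in> Zset \<Longrightarrow>
       l1norm (X t *v (Y s *v \<xi>)) \<le> C * exp (- \<gamma> * (t - s) / \<delta>) * l1norm \<xi>"
    by (rule evolution_matrices[OF \<zeta> \<delta>]) (assumption | rule that)+
  define \<phi> where "\<phi> s = X t *v (Y s *v (p s - m s))" for s
  define g' where "g' s = C * M * exp (- \<gamma> * (t - s) / \<delta>)" for s
  \<comment> \<open>An antiderivative of \<open>g'\<close>. Its value at \<open>t\<close> is the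
    term of order \<delta>: the decaying kernel has mass at most \<open>\<delta> / \<gamma>\<close>,
    up to the factor \<open>C\<close>.\<close>
  define g where "g s = C * M * \<delta> / \<gamma> * exp (- \<gamma> * (t - s) / \<delta>)" for s
  have "l1norm (\<phi> t - \<phi> 0) \<le> g t - g 0"
  proof (rule metric_increment_bound[of 0 t "\<lambda>u v. l1norm (\<phi> v - \<phi> u)" g' g])
    show "0 \<le> t" by (rule t)
    show "l1norm (\<phi> w - \<phi> u) \<le> l1norm (\<phi> v - \<phi> u) + l1norm (\<phi> w - \<phi> v)" for u v w
      using l1norm_triangle[of "\<phi> v - \<phi> u" "\<phi> w - \<phi> v"] by simp
    show "(g has_real_derivative g' s) (at s within {0..t})" for s
      unfolding g_def g'_def using \<gamma>_pos \<delta> by (auto intro!: derivative_eq_intros)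
    fix s e :: real assume s: "s \<in> {0..t}" and e: "e > 0"
    \<comment> \<open>Here \<open>m\<close> is frozen at time \<open>s\<close>. The derivative of
      \<open>F\<close> at \<open>s\<close> vanishes, because the equation of \<open>Y\<close>
      cancels that of \<open>p\<close>; to first order the increment of \<phi> comes from
      \<open>m\<close> alone.\<close>
    define F where "F v = X t *v (Y v *v (p v - m s))" for v
    \<comment> \<open>The vanishing derivative is controlled in the Euclidean norm; the dimension
      converts this to the l1 norm, hence the tolerance \<open>e / (2 * N)\<close>.\<close>
    define N where "N = real CARD('n)"
    have N: "N > 0" by (simp add: N_def)
    have s0: "0 \<le> s" using s by simp
    have pd: "((\<lambda>v. p v - m s) has_vector_derivative (1 / \<delta>) *\<^sub>R (Qstar P (\<zeta> s) *v (p s - m s)) - 0) (at s within {0..})"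
      by (intro has_vector_derivative_diff p[OF s0] has_vector_derivative_const)
    have "(F has_vector_derivative X t *v (Y s *v ((1 / \<delta>) *\<^sub>R (Qstar P (\<zeta> s) *v (p s - m s)) - 0) +
        - (Y s ** ((1 / \<delta>) *\<^sub>R Qstar P (\<zeta> s))) *v (p s - m s))) (at s within {0..})"
      unfolding F_def
      by (rule bounded_linear.has_vector_derivative[OF mv.bounded_linear_right
            mv.has_vector_derivative[OF Y[OF s0] pd]])
    moreover have "Y s *v ((1 / \<delta>) *\<^sub>R (Qstar P (\<zeta> s) *v (p s - m s)) - 0) +
        - (Y s ** ((1 / \<delta>) *\<^sub>R Qstar P (\<zeta> s))) *v (p s - m s) = 0"
      unfolding mv.minus_left matrix_vector_mul_assoc[symmetric] mv.scaleR_left by simp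
    ultimately have "(F has_vector_derivative 0) (at s within {0..})" by (simp only: mv.zero_right)
    then have "\<forall>e>0. \<exists>d>0. \<forall>v\<in>{0..}. \<bar>v - s\<bar> < d \<longrightarrow> norm (F v - F s) \<le> e * \<bar>v - s\<bar>"
      unfolding has_vector_derivative_def has_derivative_within_alt by simp
    moreover have "e / (2 * N) > 0" using e N by simp
    ultimately obtain d1 where d1: "d1 > 0"
      "\<And>v. v \<in> {0..} \<Longrightarrow> \<bar>v - s\<bar> < d1 \<Longrightarrow> norm (F v - F s) \<le> e / (2 * N) * \<bar>v - s\<bar>"
      by blast
    have "continuous (at s) g'" unfolding g'_def using \<delta> by (intro continuous_intros) auto
    then obtain d2 where d2: "d2 > 0" "\<And>v. \<bar>v - s\<bar> < d2 \<Longrightarrow> \<bar>g' v - g' s\<bar> < e / 2"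
      using half_gt_zero[OF e] unfolding continuous_at_eps_delta dist_real_def by blast
    show "\<exists>d>0. \<forall>v\<in>{0..t}. \<bar>v - s\<bar> < d \<longrightarrow>
        l1norm (\<phi> (max v s) - \<phi> (min v s)) \<le> (g' s + e) * \<bar>v - s\<bar>"
    proof (intro exI conjI ballI impI)
      show "min d1 d2 > 0" using d1 d2 by simp
      fix v assume v: "v \<in> {0..t}" and vd: "\<bar>v - s\<bar> < min d1 d2"
      have "l1norm (\<phi> (max v s) - \<phi> (min v s)) = l1norm (\<phi> v - \<phi> s)"
        by (cases "v \<le> s") (simp_all add: max_def min_def l1norm_minus_commute)
      also have "\<phi> v - \<phi> s = (F v - F s) - X t *v (Y v *v (m v - m s))"
        by (simp add: \<phi>_def F_def mv.diff_right)
      also have "l1norm \<dots> \<le> l1norm (F v - F s) + l1norm (X t *v (Y v *v (m v - m s)))"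
        by (rule l1norm_diff_triangle)
      also have "\<dots> \<le> e / 2 * \<bar>v - s\<bar> + (g' s + e / 2) * \<bar>v - s\<bar>"
      proof (rule add_mono)
        have "l1norm (F v - F s) \<le> N * norm (F v - F s)" unfolding N_def by (rule l1norm_le_norm)
        also have "\<dots> \<le> N * (e / (2 * N) * \<bar>v - s\<bar>)"
          using d1(2)[of v] v vd N by (intro mult_left_mono) auto
        also have "\<dots> = e / 2 * \<bar>v - s\<bar>" using N by simp
        finally show "l1norm (F v - F s) \<le> e / 2 * \<bar>v - s\<bar>" .
        have "l1norm (X t *v (Y v *v (m v - m s))) \<le> C * exp (- \<gamma> * (t - v) / \<delta>) * l1norm (m v - m s)"
          using v s0 by (intro XYb m(1)) auto
        also have "\<dots> \<le> C * exp (- \<gamma> * (t - v) / \<delta>) * (M * \<bar>v - s\<bar>)"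
          using v s0 C_ge_1 by (intro mult_left_mono m(2)) auto
        also have "\<dots> = g' v * \<bar>v - s\<bar>" by (simp add: g'_def)
        also have "\<dots> \<le> (g' s + e / 2) * \<bar>v - s\<bar>"
        proof (intro mult_right_mono abs_ge_zero)
          show "g' v \<le> g' s + e / 2" using d2(2)[of v] vd by linarith
        qed
        finally show "l1norm (X t *v (Y v *v (m v - m s))) \<le> (g' s + e / 2) * \<bar>v - s\<bar>" .
      qed
      also have "\<dots> = (g' s + e) * \<bar>v - s\<bar>" by (simp add: algebra_simps)
      finally show "l1norm (\<phi> (max v s) - \<phi> (min v s)) \<le> (g' s + e) * \<bar>v - s\<bar>" .
    qed
  qed
  also have "\<dots> \<le> g t" using C_ge_1 M \<delta> \<gamma>_pos by (simp add: g_def)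
  also have "\<dots> = C * M * \<delta> / \<gamma>" by (simp add: g_def)
  finally have 1: "l1norm (\<phi> t - \<phi> 0) \<le> C * M * \<delta> / \<gamma>" .
  have "\<phi> t = p t - m t"
    unfolding \<phi>_def matrix_vector_mul_assoc XY[OF t] by simp
  then have "l1norm (p t - m t) \<le> l1norm (\<phi> 0) + l1norm (\<phi> t - \<phi> 0)"
    using l1norm_triangle[of "\<phi> 0" "\<phi> t - \<phi> 0"] by simp
  moreover have "l1norm (\<phi> 0) \<le> C * exp (- \<gamma> * (t - 0) / \<delta>) * l1norm (p 0 - m 0)"
    unfolding \<phi>_def by (intro XYb t init) simp
  ultimately show ?thesis using 1 by simp
qed

end

section \<open>The invariant measure and the two semiflows\<close>

lemma norm_fst_le_norm: "norm (fst x) \<le> norm x" and norm_snd_le_norm: "norm (snd x) \<le> norm x"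
  using dist_fst_le[of x 0] dist_snd_le[of x 0] by simp_all

context fast_slow
begin

section \<open>Coercivity and the invariant measure\<close>

lemma DeltaS_diff_in_Zset: "\<mu> \<in> DeltaS \<Longrightarrow> \<nu> \<in> DeltaS \<Longrightarrow> \<mu> - \<nu> \<in> Zset"
  by (simp add: DeltaS_def Zset_def sum_subtractf)

lemma l1norm_DeltaS_diff: "\<mu> \<in> DeltaS \<Longrightarrow> \<nu> \<in> DeltaS \<Longrightarrow> l1norm (\<mu> - \<nu>) \<le> 2"
  using l1norm_diff_triangle[of \<mu> \<nu>] by (simp add: DeltaS_def l1norm_def)

text \<open>Apply the Duhamel bound along the constant path to the constant function \<open>\<xi>\<close>, and wait
  until the exponential factor drops below \<open>1/2\<close>.\<close>

lemma generator_coercive: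
  assumes \<theta>: "\<theta> \<in> Theta P" and \<xi>: "\<xi> \<in> Zset"
  shows "l1norm \<xi> \<le> 2 * C / \<gamma> * l1norm (Qstar P \<theta> *v \<xi>)"
proof -
  define \<eta> where "\<eta> = Qstar P \<theta> *v \<xi>"
  have \<eta>: "\<eta> \<in> Zset" unfolding \<eta>_def by (rule Qstar_mult_in_Zset[OF \<theta>])
  \<comment> \<open>At this time \<open>C * exp (- \<gamma> * t)\<close> equals 1/2, so half of the
    norm of \<xi> can be absorbed on the left.\<close>
  define t where "t = ln (2 * C) / \<gamma>"
  have t: "0 \<le> t" using C_ge_1 \<gamma>_pos by (simp add: t_def)
  \<comment> \<open>The difference \<open>p - m\<close> is constantly \<xi>, while both paths drift
    with velocity \<open>\<eta> = Qstar P \<theta> *v \<xi>\<close>; this drift plays the part of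
    the inhomogeneity.\<close>
  define p m :: "real \<Rightarrow> real^'n" where "p s = \<xi> + s *\<^sub>R \<eta>" and "m s = s *\<^sub>R \<eta>" for s
  have "l1norm (p t - m t) \<le> C * exp (- \<gamma> * t / 1) * l1norm (p 0 - m 0) + C * l1norm \<eta> * 1 / \<gamma>"
  proof (rule duhamel_bound[of "\<lambda>_. \<theta>" 1 p m "l1norm \<eta>" t])
    show "(p has_vector_derivative (1 / 1) *\<^sub>R (Qstar P \<theta> *v (p s - m s))) (at s within {0..})" for s
    proof -
      have "(p has_vector_derivative 0 + 1 *\<^sub>R \<eta>) (at s within {0..})"
        unfolding p_def
        by (intro has_vector_derivative_add has_vector_derivative_const
            bounded_linear.has_vector_derivative[OF bounded_linear_scaleR_left] has_vector_derivative_id)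
      then show ?thesis by (simp add: p_def m_def \<eta>_def)
    qed
    show "m v - m u \<in> Zset" for u v
      using \<eta> by (simp add: m_def Zset_def flip: scaleR_diff_left sum_distrib_left)
    show "l1norm (m v - m u) \<le> l1norm \<eta> * \<bar>v - u\<bar>" for u v
      by (simp add: m_def l1norm_scaleR flip: scaleR_diff_left)
  qed (use \<theta> \<xi> t in \<open>simp_all add: p_def m_def l1norm_nonneg continuous_on_const\<close>)
  moreover have half: "C * exp (- \<gamma> * t / 1) = 1 / 2"
  proof -
    have "- \<gamma> * t / 1 = - ln (2 * C)" using \<gamma>_pos by (simp add: t_def)
    then have "exp (- \<gamma> * t / 1) = inverse (2 * C)" using C_ge_1 by (simp only: exp_minus) simp
    then have "C * exp (- \<gamma> * t / 1) = C * inverse (2 * C)" by (simp only:)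
    then show ?thesis using C_ge_1 by simp
  qed
  ultimately have "l1norm \<xi> \<le> 1 / 2 * l1norm \<xi> + C * l1norm \<eta> / \<gamma>"
    unfolding half by (simp add: p_def m_def)
  then show ?thesis unfolding \<eta>_def[symmetric] by simp
qed

text \<open>Coercivity on \<open>Zset\<close> forces two stationary measures to coincide, which is
  what the definite description \<open>mu_inv\<close> needs besides existence.\<close>

lemma mu_inv_stationary:
  assumes \<theta>: "\<theta> \<in> Theta P"
  shows "mu_inv P \<theta> \<in> DeltaS" "Qstar P \<theta> *v mu_inv P \<theta> = 0"
proof -
  obtain \<mu> where \<mu>: "\<mu> \<in> DeltaS" "Qstar P \<theta> *v \<mu> = 0" using stationary_exists[OF \<theta>] by metis
  have "\<nu> = \<mu>" if \<nu>: "\<nu> \<in> DeltaS" "Qstar P \<theta> *v \<nu> = 0" for \<nu>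
  proof -
    have "l1norm (\<nu> - \<mu>) \<le> 0"
      using generator_coercive[OF \<theta> DeltaS_diff_in_Zset[OF \<nu>(1) \<mu>(1)]] \<nu>(2) \<mu>(2)
      by (simp add: mv.diff_right)
    then show ?thesis using l1norm_nonneg[of "\<nu> - \<mu>"] l1norm_eq_0[of "\<nu> - \<mu>"] by simp
  qed
  with \<mu> have "\<exists>!\<mu>. \<mu> \<in> DeltaS \<and> Qstar P \<theta> *v \<mu> = 0" by blast
  from theI'[OF this] show "mu_inv P \<theta> \<in> DeltaS" "Qstar P \<theta> *v mu_inv P \<theta> = 0"
    unfolding mu_inv_def by auto
qed

definition L_mu :: real where
  "L_mu = 2 * C / \<gamma> * L_Q"

lemma L_mu_nonneg: "0 \<le> L_mu"
  using C_ge_1 \<gamma>_pos L_Q_pos by (simp add: L_mu_def)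

text \<open>Stationarity of both measures turns the image of their difference under one generator
  into the difference of the generators applied to a probability vector, whose l1 norm is 1.
  Coercivity then inverts the generator on \<open>Zset\<close>.\<close>

lemma mu_inv_lipschitz:
  assumes "\<theta> \<in> Theta P" "\<theta>' \<in> Theta P"
  shows "l1norm (mu_inv P \<theta> - mu_inv P \<theta>') \<le> L_mu * norm (\<theta> - \<theta>')"
proof -
  have "l1norm (mu_inv P \<theta> - mu_inv P \<theta>') \<le> 2 * C / \<gamma> * l1norm (Qstar P \<theta> *v (mu_inv P \<theta> - mu_inv P \<theta>'))"
    by (intro generator_coercive assms DeltaS_diff_in_Zset mu_inv_stationary)
  also have "Qstar P \<theta> *v (mu_inv P \<theta> - mu_inv P \<theta>') = - ((Qstar P \<theta> - Qstar P \<theta>') *v mu_inv P \<theta>')"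
    using mu_inv_stationary(2)[OF assms(1)] mu_inv_stationary(2)[OF assms(2)] by (simp add: mv.diff_right mv.diff_left)
  also have "l1norm \<dots> \<le> L_Q * norm (\<theta> - \<theta>')"
  proof -
    have "l1norm ((Qstar P \<theta> - Qstar P \<theta>') *v mu_inv P \<theta>') \<le>
        opnorm1 (Qstar P \<theta> - Qstar P \<theta>') * l1norm (mu_inv P \<theta>')"
      by (rule l1norm_mult_le_opnorm1)
    also have "l1norm (mu_inv P \<theta>') = 1"
      using mu_inv_stationary(1)[OF assms(2)] by (simp add: l1norm_def DeltaS_def)
    finally show ?thesis using gen_lipschitz[OF assms] by (simp add: l1norm_minus)
  qed
  finally show ?thesis
    using C_ge_1 \<gamma>_pos by (simp add: L_mu_def mult.assoc mult_left_mono divide_right_mono)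
qed

section \<open>Well-posedness of the exact and the reduced system\<close>

lemma Kset_eq: "Kset P = state_box (R_w P)"
  by (simp add: Kset_def state_box_def)

lemma bounded_lipschitz_exact: "bounded_lipschitz_on (state_box \<rho>) (exact_field P \<delta>)"
proof -
  have "bounded_lipschitz_on (state_box \<rho>) (\<lambda>x. fst (slow_field x))"
    "bounded_lipschitz_on (state_box \<rho>) (\<lambda>x. snd (slow_field x))"
  proof -
    obtain B L where BL: "\<And>x. x \<in> state_box \<rho> \<Longrightarrow> norm (slow_field x) \<le> B"
      "\<And>x y. x \<in> state_box \<rho> \<Longrightarrow> y \<in> state_box \<rho> \<Longrightarrow> norm (slow_field x - slow_field y) \<le> L * dist x y"
      using bounded_lipschitz_onE[OF bounded_lipschitz_slow] by metis
    show "bounded_lipschitz_on (state_box \<rho>) (\<lambda>x. fst (slow_field x))"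
    proof (rule bounded_lipschitz_onI[of _ _ B L])
      show "norm (fst (slow_field x)) \<le> B" if "x \<in> state_box \<rho>" for x
        by (rule order_trans[OF norm_fst_le_norm BL(1)[OF that]])
      show "norm (fst (slow_field x) - fst (slow_field y)) \<le> L * dist x y"
        if "x \<in> state_box \<rho>" "y \<in> state_box \<rho>" for x y
        unfolding fst_diff[symmetric] by (rule order_trans[OF norm_fst_le_norm BL(2)[OF that]])
    qed
    show "bounded_lipschitz_on (state_box \<rho>) (\<lambda>x. snd (slow_field x))"
    proof (rule bounded_lipschitz_onI[of _ _ B L])
      show "norm (snd (slow_field x)) \<le> B" if "x \<in> state_box \<rho>" for x
        by (rule order_trans[OF norm_snd_le_norm BL(1)[OF that]])
      show "norm (snd (slow_field x) - snd (slow_field y)) \<le> L * dist x y"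
        if "x \<in> state_box \<rho>" "y \<in> state_box \<rho>" for x y
        unfolding snd_diff[symmetric] by (rule order_trans[OF norm_snd_le_norm BL(2)[OF that]])
    qed
  qed
  moreover have "bounded_lipschitz_on (state_box \<rho>)
      (\<lambda>x. (1 / \<delta>) *\<^sub>R (Qstar P (fst x) *v snd (snd x)))"
    by (intro bounded_lipschitz_on_scaleR bounded_lipschitz_on_const bounded_lipschitz_on_matvec
        bounded_lipschitz_box_fst bounded_lipschitz_Qstar bounded_lipschitz_on_vec[of _ "\<lambda>x. snd (snd x)"] bounded_lipschitz_box_mu)
  ultimately have "bounded_lipschitz_on (state_box \<rho>)
      (\<lambda>x. (fst (slow_field x), snd (slow_field x), (1 / \<delta>) *\<^sub>R (Qstar P (fst x) *v snd (snd x))))"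
    by (intro bounded_lipschitz_on_Pair)
  moreover have "exact_field P \<delta> =
      (\<lambda>x. (fst (slow_field x), snd (slow_field x), (1 / \<delta>) *\<^sub>R (Qstar P (fst x) *v snd (snd x))))"
    by (auto simp: fun_eq_iff slow_field_def)
  ultimately show ?thesis by simp
qed

lemma closed_convex_Kset: "closed (Kset P)" "convex (Kset P)"
  unfolding Kset_def
  by (intro closed_Times convex_Times compact_imp_closed[OF compact_Theta] convex_Theta
      closed_cball convex_cball closed_DeltaS convex_DeltaS)+

text \<open>The solution is built inside the bounded set \<open>Kset\<close>, whereas
  \<open>Sflow\<close> is described over the unbounded \<open>Xset\<close>; uniqueness in the larger
  set identifies the two.\<close>

lemma exact_solution:
  assumes x0: "x0 \<in> Kset P" and \<delta>: "\<delta> > 0"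
  obtains x where "ode_solution_on (Kset P) (exact_field P \<delta>) x" "x 0 = x0"
    "\<And>t. 0 \<le> t \<Longrightarrow> Sflow P \<delta> t x0 = x t"
proof -
  obtain h0 where h0: "h0 > 0" "\<And>\<theta> w \<mu> h. (\<theta>, w, \<mu>) \<in> Kset P \<Longrightarrow> 0 < h \<Longrightarrow> h \<le> h0 \<Longrightarrow>
       (\<theta>, w) + h *\<^sub>R slow_field (\<theta>, w, \<mu>) \<in> Theta P \<times> cball 0 (R_w P)"
    using slow_step by metis
  obtain h1 where h1: "h1 > 0" "\<And>\<theta> \<mu> h. \<theta> \<in> Theta P \<Longrightarrow> \<mu> \<in> DeltaS \<Longrightarrow> 0 < h \<Longrightarrow> h \<le> h1 \<Longrightarrow>
       \<mu> + h *\<^sub>R (Qstar P \<theta> *v \<mu>) \<in> DeltaS"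
    using mu_step by metis
  \<comment> \<open>In the fast component a step \<open>h\<close> acts as a step
    \<open>h / \<delta>\<close> of the generator, so \<open>h\<close> must not exceed
    \<open>h1 * \<delta>\<close>.\<close>
  define h where "h = min h0 (h1 * \<delta>)"
  have h: "h > 0" "h \<le> h0" "h / \<delta> > 0" "h / \<delta> \<le> h1"
    using h0(1) h1(1) \<delta> by (auto simp: h_def min_def field_simps)
  obtain L where L: "L-lipschitz_on (Kset P) (exact_field P \<delta>)"
    using bounded_lipschitz_exact unfolding Kset_eq bounded_lipschitz_on_def by blast
  have step: "x + h *\<^sub>R exact_field P \<delta> x \<in> Kset P" if "x \<in> Kset P" for x
  proof -
    obtain \<theta> w \<mu> where x: "x = (\<theta>, w, \<mu>)" by (cases x) auto
    have "\<theta> \<in> Theta P" "\<mu> \<in> DeltaS" using that by (auto simp: x Kset_def)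
    then have "\<mu> + (h / \<delta>) *\<^sub>R (Qstar P \<theta> *v \<mu>) \<in> DeltaS" using h by (intro h1)
    moreover have "(\<theta>, w) + h *\<^sub>R slow_field (\<theta>, w, \<mu>) \<in> Theta P \<times> cball 0 (R_w P)"
      using h that by (intro h0) (auto simp: x)
    ultimately show ?thesis by (simp add: x slow_field_def Kset_def)
  qed
  obtain x where x: "ode_solution_on (Kset P) (exact_field P \<delta>) x" "x 0 = x0"
    using ode_solution_exists[OF closed_convex_Kset x0 h(1) L step] by blast
  have "Sflow P \<delta> t x0 = x t" if "0 \<le> t" for t
    unfolding Sflow_def x(2)[symmetric]
  proof (rule semiflow_eq)
    show "\<exists>L. L-lipschitz_on (Xset P \<inter> cball 0 r) (exact_field P \<delta>)" for r
    proof -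
      have "Xset P \<inter> cball 0 r \<subseteq> state_box r"
      proof
        fix x assume x: "x \<in> Xset P \<inter> cball 0 r"
        have "norm (fst (snd x)) \<le> norm x"
          by (rule order_trans[OF norm_fst_le_norm norm_snd_le_norm])
        with x show "x \<in> state_box r" by (auto simp: Xset_def state_box_def)
      qed
      then show ?thesis
        using bounded_lipschitz_on_subset[OF bounded_lipschitz_exact] unfolding bounded_lipschitz_on_def by blast
    qed
    show "ode_solution_on (Xset P) (exact_field P \<delta>) x"
      by (rule ode_solution_on_mono[OF x(1)]) (auto simp: Kset_def Xset_def)
  qed (rule that)
  with x that show thesis by blast
qed

text \<open>The graph of the invariant measure over the slow variables; \<open>Gamma0\<close> takes
  its values on it.\<close>

definition slow_manifold :: "(real^'d) \<times> (real^'m) \<Rightarrow> (real^'d) \<times> (real^'m) \<times> (real^'n)" where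
  "slow_manifold y = (fst y, snd y, mu_inv P (fst y))"

lemma reduced_field_eq: "reduced_field P = (\<lambda>y. slow_field (slow_manifold y))"
  by (auto simp: fun_eq_iff slow_field_def slow_manifold_def)

lemma slow_manifold_in_state_box: "y \<in> Theta P \<times> cball 0 \<rho> \<Longrightarrow> slow_manifold y \<in> state_box \<rho>"
  by (auto simp: slow_manifold_def state_box_def mu_inv_stationary)

text \<open>The actor and the critic contribute 1 each and \<open>mu_inv\<close> contributes
  \<open>L_mu\<close>. The \<open>dist\<close> version feeds the Lipschitz estimate of the slow
  field, the \<open>dX\<close> version the final claim.\<close>

lemma slow_manifold_dist:
  assumes "\<theta> \<in> Theta P" "y \<in> Theta P \<times> UNIV"
  shows "dist (\<theta>, w, \<mu>) (slow_manifold y) \<le> (2 + L_mu) * norm ((\<theta>, w) - y) + l1norm (\<mu> - mu_inv P \<theta>)"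
    and "dX (\<theta>, w, \<mu>) (slow_manifold y) \<le> (2 + L_mu) * norm ((\<theta>, w) - y) + l1norm (\<mu> - mu_inv P \<theta>)"
proof -
  obtain \<theta>' w' where y: "y = (\<theta>', w')" by (cases y)
  have \<theta>': "\<theta>' \<in> Theta P" using assms(2) y by simp
  have 1: "norm (\<theta> - \<theta>') \<le> norm ((\<theta>, w) - y)" "norm (w - w') \<le> norm ((\<theta>, w) - y)"
    using norm_fst_le_norm[of "(\<theta>, w) - y"] norm_snd_le_norm[of "(\<theta>, w) - y"] by (auto simp: y)
  have "l1norm (\<mu> - mu_inv P \<theta>') \<le> l1norm (\<mu> - mu_inv P \<theta>) + l1norm (mu_inv P \<theta> - mu_inv P \<theta>')"
    using l1norm_triangle[of "\<mu> - mu_inv P \<theta>" "mu_inv P \<theta> - mu_inv P \<theta>'"] by simp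
  also have "l1norm (mu_inv P \<theta> - mu_inv P \<theta>') \<le> L_mu * norm ((\<theta>, w) - y)"
    using mu_inv_lipschitz[OF assms(1) \<theta>'] mult_left_mono[OF 1(1) L_mu_nonneg] by linarith
  finally have 2: "l1norm (\<mu> - mu_inv P \<theta>') \<le> l1norm (\<mu> - mu_inv P \<theta>) + L_mu * norm ((\<theta>, w) - y)" by simp
  show dX: "dX (\<theta>, w, \<mu>) (slow_manifold y) \<le> (2 + L_mu) * norm ((\<theta>, w) - y) + l1norm (\<mu> - mu_inv P \<theta>)"
    using 1 2 by (simp add: slow_manifold_def y algebra_simps)
  have "dist (\<theta>, w, \<mu>) (slow_manifold y) = norm (\<theta> - \<theta>', w - w', \<mu> - mu_inv P \<theta>')"
    by (simp add: dist_norm slow_manifold_def y)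
  also have "\<dots> \<le> norm (\<theta> - \<theta>') + (norm (w - w') + norm (\<mu> - mu_inv P \<theta>'))"
    by (intro order_trans[OF norm_Pair_le] add_left_mono norm_Pair_le)
  also have "\<dots> \<le> dX (\<theta>, w, \<mu>) (slow_manifold y)"
    using norm_le_l1norm[of "\<mu> - mu_inv P \<theta>'"] by (simp add: slow_manifold_def y)
  finally show "dist (\<theta>, w, \<mu>) (slow_manifold y) \<le> (2 + L_mu) * norm ((\<theta>, w) - y) + l1norm (\<mu> - mu_inv P \<theta>)"
    using dX by linarith
qed

lemma bounded_lipschitz_reduced: "bounded_lipschitz_on (Theta P \<times> cball 0 \<rho>) (reduced_field P)"
  unfolding reduced_field_eq
proof (rule bounded_lipschitz_on_compose[OF bounded_lipschitz_slow])
  show "slow_manifold ` (Theta P \<times> cball 0 \<rho>) \<subseteq> state_box \<rho>" using slow_manifold_in_state_box by blast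
  show "(2 + L_mu)-lipschitz_on (Theta P \<times> cball 0 \<rho>) slow_manifold"
  proof (rule lipschitz_onI)
    fix x y :: "(real^'d) \<times> (real^'m)"
    assume "x \<in> Theta P \<times> cball 0 \<rho>" "y \<in> Theta P \<times> cball 0 \<rho>"
    then show "dist (slow_manifold x) (slow_manifold y) \<le> (2 + L_mu) * dist x y"
      using slow_manifold_dist(1)[of "fst x" y "snd x" "mu_inv P (fst x)"]
      by (auto simp: slow_manifold_def[of x] dist_norm)
  qed (use L_mu_nonneg in simp)
qed

lemma reduced_solution:
  assumes y0: "y0 \<in> Theta P \<times> cball 0 (R_w P)"
  obtains y where "ode_solution_on (Theta P \<times> cball 0 (R_w P)) (reduced_field P) y" "y 0 = y0"
    "\<And>t. 0 \<le> t \<Longrightarrow> Sbar P t y0 = y t"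
proof -
  define D where "D = Theta P \<times> (cball 0 (R_w P) :: (real^'m) set)"
  have D: "closed D" "convex D"
    unfolding D_def
    by (intro closed_Times convex_Times compact_imp_closed[OF compact_Theta] convex_Theta
        closed_cball convex_cball)+
  obtain h0 where h0: "h0 > 0" "\<And>\<theta> w \<mu> h. (\<theta>, w, \<mu>) \<in> Kset P \<Longrightarrow> 0 < h \<Longrightarrow> h \<le> h0 \<Longrightarrow>
       (\<theta>, w) + h *\<^sub>R slow_field (\<theta>, w, \<mu>) \<in> Theta P \<times> cball 0 (R_w P)"
    using slow_step by metis
  obtain L where L: "L-lipschitz_on D (reduced_field P)"
    using bounded_lipschitz_reduced unfolding D_def bounded_lipschitz_on_def by blast
  have step: "y + h0 *\<^sub>R reduced_field P y \<in> D" if "y \<in> D" for y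
  proof -
    have "slow_manifold y \<in> Kset P" using slow_manifold_in_state_box that unfolding Kset_eq D_def by blast
    then show ?thesis
      using h0(2)[of "fst y" "snd y" "mu_inv P (fst y)" h0] h0(1)
      unfolding reduced_field_eq slow_manifold_def D_def by simp
  qed
  obtain y where y: "ode_solution_on D (reduced_field P) y" "y 0 = y0"
    using ode_solution_exists[OF D y0[folded D_def] h0(1) L step] by blast
  have "Sbar P t y0 = y t" if "0 \<le> t" for t
    unfolding Sbar_def y(2)[symmetric]
  proof (rule semiflow_eq)
    show "\<exists>L. L-lipschitz_on (Yset P \<inter> cball 0 r) (reduced_field P)" for r
    proof -
      have "Yset P \<inter> cball 0 r \<subseteq> Theta P \<times> cball 0 r"
      proof
        fix x assume x: "x \<in> Yset P \<inter> cball 0 r"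
        with norm_snd_le_norm[of x] show "x \<in> Theta P \<times> cball 0 r" by (cases x) (auto simp: Yset_def)
      qed
      then show ?thesis
        using bounded_lipschitz_on_subset[OF bounded_lipschitz_reduced] unfolding bounded_lipschitz_on_def by blast
    qed
    show "ode_solution_on (Yset P) (reduced_field P) y"
      by (rule ode_solution_on_mono[OF y(1)]) (auto simp: D_def Yset_def)
  qed (rule that)
  with y that show thesis unfolding D_def by blast
qed

end

section \<open>Comparison of the exact and the reduced flow\<close>

lemma exp_minus_le_inverse:
  assumes "(z :: real) > 0"
  shows "exp (- z) \<le> 1 / z"
proof -
  have "z \<le> exp z" using exp_ge_add_one_self[of z] by linarith
  then show ?thesis using assms by (simp add: exp_minus field_simps)
qed

context fast_slow
begin

lemma averaging_bound:
  assumes T: "T > 0"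
  obtains C_T where "C_T > 0"
    "\<And>\<theta>0 w0 \<mu>0 \<delta> t. (\<theta>0, w0, \<mu>0) \<in> Kset P \<Longrightarrow> 0 < \<delta> \<Longrightarrow> t \<in> {0..T} \<Longrightarrow>
       (case Sflow P \<delta> t (\<theta>0, w0, \<mu>0) of (\<theta>, w, \<mu>) \<Rightarrow> l1norm (\<mu> - mu_inv P \<theta>))
         \<le> C_T * (exp (- \<gamma> * t / \<delta>) * l1norm (\<mu>0 - mu_inv P \<theta>0) + \<delta>) \<and>
       dX (Sflow P \<delta> t (\<theta>0, w0, \<mu>0)) (Gamma0 P t (\<theta>0, w0, \<mu>0))
         \<le> C_T * (exp (- \<gamma> * t / \<delta>) * l1norm (\<mu>0 - mu_inv P \<theta>0) + \<delta>)"
proof -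
  obtain B L where BL: "B \<ge> 0" "L \<ge> 0" "\<And>x. x \<in> Kset P \<Longrightarrow> norm (slow_field x) \<le> B"
    "\<And>x y. x \<in> Kset P \<Longrightarrow> y \<in> Kset P \<Longrightarrow> norm (slow_field x - slow_field y) \<le> L * dist x y"
    using bounded_lipschitz_onE[OF bounded_lipschitz_slow] unfolding Kset_eq by metis
  \<comment> \<open>\<open>M\<close> bounds the speed of \<open>mu_inv\<close> along exact
    trajectories. \<open>E0\<close> collects the time integral of the fast error:
    \<open>2 * C / \<gamma>\<close> from the initial layer, whose height involves an l1 distance at
    most 2, and \<open>C * M / \<gamma> * T\<close> from the persistent lag. \<open>S\<close> is the
    resulting Gronwall bound, \<open>F\<close> the lag itself; the added 1 in \<open>L'\<close>
    keeps it positive.\<close>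
  define M where "M = L_mu * B"
  define L' where "L' = L * (2 + L_mu) + 1"
  define E0 where "E0 = L * (2 * C / \<gamma> + C * M / \<gamma> * T)"
  define S where "S = (2 + L_mu) * (2 * E0 * exp (2 * L' * T))"
  define F where "F = C * M / \<gamma>"
  define C_T where "C_T = S + C + F"
  have M: "M \<ge> 0" using BL(1) L_mu_nonneg by (simp add: M_def)
  have C: "C > 0" using C_ge_1 by simp
  have L': "L' > 0" using BL(2) L_mu_nonneg by (simp add: L'_def add_nonneg_pos)
  have E0: "E0 \<ge> 0" unfolding E0_def using BL(2) C M \<gamma>_pos T by simp
  have SF: "0 \<le> S" "0 \<le> F" using E0 L_mu_nonneg C M \<gamma>_pos by (simp_all add: S_def F_def)
  then have C_T: "C_T > 0" "C \<le> C_T" "F \<le> C_T" "S + F \<le> C_T" using C unfolding C_T_def by linarith+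
  have "(case Sflow P \<delta> t (\<theta>0, w0, \<mu>0) of (\<theta>, w, \<mu>) \<Rightarrow> l1norm (\<mu> - mu_inv P \<theta>))
         \<le> C_T * (exp (- \<gamma> * t / \<delta>) * l1norm (\<mu>0 - mu_inv P \<theta>0) + \<delta>) \<and>
       dX (Sflow P \<delta> t (\<theta>0, w0, \<mu>0)) (Gamma0 P t (\<theta>0, w0, \<mu>0))
         \<le> C_T * (exp (- \<gamma> * t / \<delta>) * l1norm (\<mu>0 - mu_inv P \<theta>0) + \<delta>)"
    if x0: "(\<theta>0, w0, \<mu>0) \<in> Kset P" and \<delta>: "0 < \<delta>" and t: "t \<in> {0..T}" for \<theta>0 w0 \<mu>0 \<delta> t
  proof -
    obtain x where x: "ode_solution_on (Kset P) (exact_field P \<delta>) x" "x 0 = (\<theta>0, w0, \<mu>0)"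
      and Sflow: "\<And>t. 0 \<le> t \<Longrightarrow> Sflow P \<delta> t (\<theta>0, w0, \<mu>0) = x t"
      using exact_solution[OF x0 \<delta>] by metis
    have y0: "(\<theta>0, w0) \<in> Theta P \<times> cball 0 (R_w P)" using x0 by (simp add: Kset_def)
    obtain y where y: "ode_solution_on (Theta P \<times> cball 0 (R_w P)) (reduced_field P) y" "y 0 = (\<theta>0, w0)"
      and Sbar: "\<And>t. 0 \<le> t \<Longrightarrow> Sbar P t (\<theta>0, w0) = y t"
      using reduced_solution[OF y0] by metis
    define \<zeta> where "\<zeta> s = fst (x s)" for s
    define w where "w s = fst (snd (x s))" for s
    define \<mu> where "\<mu> s = snd (snd (x s))" for s
    have x_eq: "x s = (\<zeta> s, w s, \<mu> s)" for s by (simp add: \<zeta>_def w_def \<mu>_def)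
    have init: "\<zeta> 0 = \<theta>0" "w 0 = w0" "\<mu> 0 = \<mu>0" using x(2) by (simp_all add: x_eq)
    have xK: "x s \<in> Kset P" if "0 \<le> s" for s using ode_solution_onD(1)[OF x(1) that] .
    have \<zeta>\<Theta>: "\<zeta> s \<in> Theta P" and \<mu>\<Delta>: "\<mu> s \<in> DeltaS" if "0 \<le> s" for s
      using xK[OF that] by (auto simp: x_eq Kset_def)
    have yY: "y s \<in> Theta P \<times> cball 0 (R_w P)" if "0 \<le> s" for s
      using ode_solution_onD(1)[OF y(1) that] .
    have slow_manifold_K: "slow_manifold (y s) \<in> Kset P" if "0 \<le> s" for s
      unfolding Kset_eq by (rule slow_manifold_in_state_box[OF yY[OF that]])
    have dx: "(x has_vector_derivative exact_field P \<delta> (x s)) (at s within {0..})" if "0 \<le> s" for s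
      using ode_solution_onD(2)[OF x(1) that] .
    have dz: "((\<lambda>s. (\<zeta> s, w s)) has_vector_derivative slow_field (x s)) (at s within {0..})" if "0 \<le> s" for s
    proof -
      have lin: "bounded_linear (\<lambda>v :: (real^'d) \<times> (real^'m) \<times> (real^'n). (fst v, fst (snd v)))"
        by (intro bounded_linear_Pair bounded_linear_fst bounded_linear_compose[OF bounded_linear_fst]
            bounded_linear_snd)
      have "(fst (exact_field P \<delta> (x s)), fst (snd (exact_field P \<delta> (x s)))) = slow_field (x s)"
        by (simp add: x_eq slow_field_def)
      with bounded_linear.has_vector_derivative[OF lin dx[OF that]] show ?thesis
        by (simp add: \<zeta>_def w_def)
    qed
    \<comment> \<open>Subtracting the stationary measure changes nothing and brings the equation
      into the form of the Duhamel bound.\<close>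
    have d\<mu>: "(\<mu> has_vector_derivative (1 / \<delta>) *\<^sub>R (Qstar P (\<zeta> s) *v (\<mu> s - mu_inv P (\<zeta> s))))
        (at s within {0..})" if "0 \<le> s" for s
    proof -
      have lin: "bounded_linear (\<lambda>v :: (real^'d) \<times> (real^'m) \<times> (real^'n). snd (snd v))"
        by (intro bounded_linear_compose[OF bounded_linear_snd] bounded_linear_snd)
      have "snd (snd (exact_field P \<delta> (x s))) = (1 / \<delta>) *\<^sub>R (Qstar P (\<zeta> s) *v (\<mu> s - mu_inv P (\<zeta> s)))"
        using mu_inv_stationary(2)[OF \<zeta>\<Theta>[OF that]] by (simp add: x_eq mv.diff_right)
      with bounded_linear.has_vector_derivative[OF lin dx[OF that]] show ?thesis
        by (simp add: \<mu>_def[abs_def])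
    qed
    have z_int: "((\<lambda>r. slow_field (x r)) has_integral ((\<zeta> s, w s) - (\<zeta> 0, w 0))) {0..s}" if "0 \<le> s" for s
      using vector_integral_equation[OF that dz] by simp
    have \<zeta>_cont: "continuous_on {0..} \<zeta>"
      unfolding \<zeta>_def by (intro continuous_on_fst ode_solution_onD(3)[OF x(1)])
    \<comment> \<open>Only the slow components enter, so the speed \<open>B\<close> is free of
      \<delta>.\<close>
    have \<zeta>_lip: "norm (\<zeta> v - \<zeta> u) \<le> B * \<bar>v - u\<bar>" if uv: "0 \<le> u" "0 \<le> v" for u v
    proof -
      have "norm ((\<zeta> v, w v) - (\<zeta> u, w u)) \<le> B * norm (v - u)"
      proof (rule differentiable_bound[of "{0..}" "\<lambda>s. (\<zeta> s, w s)" "\<lambda>s h. h *\<^sub>R slow_field (x s)"])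
        fix s :: real assume "s \<in> {0..}"
        then have s: "0 \<le> s" by simp
        show "((\<lambda>s. (\<zeta> s, w s)) has_derivative (\<lambda>h. h *\<^sub>R slow_field (x s))) (at s within {0..})"
          using dz[OF s] by (simp add: has_vector_derivative_def)
        show "onorm (\<lambda>h. h *\<^sub>R slow_field (x s)) \<le> B"
          using BL(3)[OF xK[OF s]] by (simp add: onorm_scaleR_left onorm_id)
      qed (use uv in \<open>auto simp: convex_real_interval\<close>)
      then show ?thesis
        using norm_fst_le_norm[of "(\<zeta> v, w v) - (\<zeta> u, w u)"] by simp
    qed
    define a where "a = l1norm (\<mu>0 - mu_inv P \<theta>0)"
    have \<theta>0: "\<theta>0 \<in> Theta P" "\<mu>0 \<in> DeltaS" using x0 by (auto simp: Kset_def)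
    have a: "0 \<le> a" "a \<le> 2"
      unfolding a_def by (intro l1norm_nonneg l1norm_DeltaS_diff \<theta>0 mu_inv_stationary)+
    have fast: "l1norm (\<mu> s - mu_inv P (\<zeta> s)) \<le> C * exp (- \<gamma> * s / \<delta>) * a + C * M * \<delta> / \<gamma>"
      if s: "0 \<le> s" for s
    proof -
      have "l1norm (\<mu> s - mu_inv P (\<zeta> s)) \<le>
          C * exp (- \<gamma> * s / \<delta>) * l1norm (\<mu> 0 - mu_inv P (\<zeta> 0)) + C * M * \<delta> / \<gamma>"
      proof (rule duhamel_bound[OF \<zeta>_cont \<zeta>\<Theta> \<delta> d\<mu> _ _ M _ s])
        fix u v :: real assume uv: "0 \<le> u" "0 \<le> v"
        show "mu_inv P (\<zeta> v) - mu_inv P (\<zeta> u) \<in> Zset"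
          by (intro DeltaS_diff_in_Zset mu_inv_stationary \<zeta>\<Theta> uv)
        have "l1norm (mu_inv P (\<zeta> v) - mu_inv P (\<zeta> u)) \<le> L_mu * norm (\<zeta> v - \<zeta> u)"
          by (intro mu_inv_lipschitz \<zeta>\<Theta> uv)
        also have "\<dots> \<le> L_mu * (B * \<bar>v - u\<bar>)"
          by (intro mult_left_mono \<zeta>_lip uv L_mu_nonneg)
        finally show "l1norm (mu_inv P (\<zeta> v) - mu_inv P (\<zeta> u)) \<le> M * \<bar>v - u\<bar>"
          by (simp add: M_def mult.assoc)
      qed (simp_all add: DeltaS_diff_in_Zset mu_inv_stationary \<zeta>\<Theta> \<mu>\<Delta>)
      then show ?thesis by (simp add: a_def init)
    qed
    define v where "v s = norm ((\<zeta> s, w s) - y s)" for s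
    have v_cont: "continuous_on {0..T} v"
    proof -
      have "continuous_on {0..} v"
        unfolding v_def \<zeta>_def w_def
        by (intro continuous_on_norm continuous_on_diff continuous_on_Pair continuous_on_fst
            continuous_on_snd ode_solution_onD(3)[OF x(1)] ode_solution_onD(3)[OF y(1)])
      then show ?thesis by (rule continuous_on_subset) auto
    qed
    have v_bound: "v s \<le> E0 * \<delta> + L' * integral {0..s} v" if s: "s \<in> {0..T}" for s
    proof -
      have s0: "0 \<le> s" using s by simp
      have y_int: "((\<lambda>r. slow_field (slow_manifold (y r))) has_integral (y s - y 0)) {0..s}"
        using vector_integral_equation[OF s0 ode_solution_onD(2)[OF y(1)]] by (simp add: reduced_field_eq)
      have diff_int: "((\<lambda>r. slow_field (x r) - slow_field (slow_manifold (y r))) has_integral ((\<zeta> s, w s) - y s)) {0..s}"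
      proof -
        have "((\<zeta> s, w s) - (\<zeta> 0, w 0)) - (y s - y 0) = (\<zeta> s, w s) - y s"
          unfolding init y(2) by simp
        with has_integral_diff[OF z_int[OF s0] y_int] show ?thesis by (simp only:)
      qed
      have v_int: "v integrable_on {0..s}"
        using s by (intro integrable_continuous_real continuous_on_subset[OF v_cont]) auto
      \<comment> \<open>The decaying exponential is written with the negative scale
        \<open>- (\<delta> / \<gamma>)\<close>.\<close>
      have exp_int: "((\<lambda>r. exp (r / (- (\<delta> / \<gamma>)))) has_integral
          (- (\<delta> / \<gamma>)) * (exp (s / (- (\<delta> / \<gamma>))) - 1)) {0..s}"
        by (rule has_integral_exp_div) (use \<delta> \<gamma>_pos s0 in auto)
      have const_int: "((\<lambda>r :: real. C * M * \<delta> / \<gamma>) has_integral C * M * \<delta> / \<gamma> * s) {0..s}"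
        using has_integral_const_real[of "C * M * \<delta> / \<gamma>" 0 s] s0 by (simp add: mult.commute)
      have g_int: "((\<lambda>r. L' * v r + L * (C * a * exp (r / (- (\<delta> / \<gamma>))) + C * M * \<delta> / \<gamma>)) has_integral
          L' * integral {0..s} v + L * (C * a * ((- (\<delta> / \<gamma>)) * (exp (s / (- (\<delta> / \<gamma>))) - 1)) +
            C * M * \<delta> / \<gamma> * s)) {0..s}"
        by (intro has_integral_add has_integral_mult_right integrable_integral v_int exp_int const_int)
      have "v s = norm (integral {0..s} (\<lambda>r. slow_field (x r) - slow_field (slow_manifold (y r))))"
        unfolding integral_unique[OF diff_int] v_def ..
      also have "\<dots> \<le> integral {0..s} (\<lambda>r. L' * v r + L * (C * a * exp (r / (- (\<delta> / \<gamma>))) + C * M * \<delta> / \<gamma>))"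
      proof (rule integral_norm_bound_integral)
        show "(\<lambda>r. slow_field (x r) - slow_field (slow_manifold (y r))) integrable_on {0..s}"
          using diff_int by (rule has_integral_integrable)
        show "(\<lambda>r. L' * v r + L * (C * a * exp (r / (- (\<delta> / \<gamma>))) + C * M * \<delta> / \<gamma>)) integrable_on {0..s}"
          using g_int by (rule has_integral_integrable)
        fix r assume "r \<in> {0..s}"
        then have r: "0 \<le> r" by simp
        have "norm (slow_field (x r) - slow_field (slow_manifold (y r))) \<le> L * dist (x r) (slow_manifold (y r))"
          by (intro BL(4) xK slow_manifold_K r)
        also have "\<dots> \<le> L * ((2 + L_mu) * v r + l1norm (\<mu> r - mu_inv P (\<zeta> r)))"
          unfolding x_eq v_def using yY[OF r] by (intro mult_left_mono slow_manifold_dist(1) \<zeta>\<Theta> r BL(2)) auto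
        also have "\<dots> \<le> L * ((2 + L_mu) * v r + (C * exp (- \<gamma> * r / \<delta>) * a + C * M * \<delta> / \<gamma>))"
          by (intro mult_left_mono add_left_mono fast r BL(2))
        also have "- \<gamma> * r / \<delta> = r / (- (\<delta> / \<gamma>))" using \<delta> \<gamma>_pos by (simp add: field_simps)
        also have "L * ((2 + L_mu) * v r + (C * exp (r / (- (\<delta> / \<gamma>))) * a + C * M * \<delta> / \<gamma>)) =
            L * (2 + L_mu) * v r + L * (C * a * exp (r / (- (\<delta> / \<gamma>))) + C * M * \<delta> / \<gamma>)"
          by (simp only: distrib_left mult_ac)
        also have "\<dots> \<le> L' * v r + L * (C * a * exp (r / (- (\<delta> / \<gamma>))) + C * M * \<delta> / \<gamma>)"
          by (intro add_right_mono mult_right_mono) (simp_all add: L'_def v_def)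
        finally show "norm (slow_field (x r) - slow_field (slow_manifold (y r))) \<le>
            L' * v r + L * (C * a * exp (r / (- (\<delta> / \<gamma>))) + C * M * \<delta> / \<gamma>)" .
      qed
      also have "\<dots> = L' * integral {0..s} v + L * (C * a * ((- (\<delta> / \<gamma>)) * (exp (s / (- (\<delta> / \<gamma>))) - 1)) +
            C * M * \<delta> / \<gamma> * s)"
        by (rule integral_unique[OF g_int])
      \<comment> \<open>The initial layer has area at most
        \<open>C * a * (\<delta> / \<gamma>)\<close>. With \<open>a \<le> 2\<close> this is of order
        \<delta>, so the slow error has no exponential term of its own.\<close>
      also have "\<dots> \<le> L' * integral {0..s} v + L * (C * 2 * (\<delta> / \<gamma>) + C * M * \<delta> / \<gamma> * T)"
      proof (intro add_left_mono mult_left_mono[OF add_mono] BL(2))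
        have "(- (\<delta> / \<gamma>)) * (exp (s / (- (\<delta> / \<gamma>))) - 1) = (\<delta> / \<gamma>) * (1 - exp (s / (- (\<delta> / \<gamma>))))"
          by (simp add: algebra_simps)
        also have "\<dots> \<le> (\<delta> / \<gamma>) * 1" using \<delta> \<gamma>_pos by (intro mult_left_mono) auto
        finally have e: "(- (\<delta> / \<gamma>)) * (exp (s / (- (\<delta> / \<gamma>))) - 1) \<le> \<delta> / \<gamma>" by simp
        have "C * a * ((- (\<delta> / \<gamma>)) * (exp (s / (- (\<delta> / \<gamma>))) - 1)) \<le> C * a * (\<delta> / \<gamma>)"
          using C a(1) by (intro mult_left_mono[OF e]) simp
        also have "\<dots> \<le> C * 2 * (\<delta> / \<gamma>)"
          using C a \<delta> \<gamma>_pos by (intro mult_right_mono mult_left_mono) auto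
        finally show "C * a * ((- (\<delta> / \<gamma>)) * (exp (s / (- (\<delta> / \<gamma>))) - 1)) \<le> C * 2 * (\<delta> / \<gamma>)" .
        show "C * M * \<delta> / \<gamma> * s \<le> C * M * \<delta> / \<gamma> * T"
          using s C M \<delta> \<gamma>_pos by (intro mult_left_mono) auto
      qed
      also have "L * (C * 2 * (\<delta> / \<gamma>) + C * M * \<delta> / \<gamma> * T) = E0 * \<delta>"
        using \<gamma>_pos by (simp add: E0_def field_simps)
      finally show ?thesis by simp
    qed
    have "v t \<le> 2 * (E0 * \<delta>) * exp (2 * L' * (t - 0))"
      by (rule gronwall[OF v_cont _ L' v_bound t]) (simp add: v_def)
    also have "\<dots> \<le> 2 * (E0 * \<delta>) * exp (2 * L' * T)"
      using t L' E0 \<delta> by (intro mult_left_mono) auto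
    finally have "(2 + L_mu) * v t \<le> (2 + L_mu) * (2 * (E0 * \<delta>) * exp (2 * L' * T))"
      using L_mu_nonneg by (intro mult_left_mono) auto
    also have "\<dots> = S * \<delta>" by (simp add: S_def mult_ac)
    finally have v_le: "(2 + L_mu) * v t \<le> S * \<delta>" .
    have t0: "0 \<le> t" using t by simp
    define e where "e = exp (- \<gamma> * t / \<delta>)"
    have e: "0 \<le> e" by (simp add: e_def)
    have fast_t: "l1norm (\<mu> t - mu_inv P (\<zeta> t)) \<le> C * (e * a) + F * \<delta>"
      using fast[OF t0] by (simp add: e_def F_def mult.assoc)
    have "C * (e * a) \<le> C_T * (e * a)"
      using e a(1) by (intro mult_right_mono C_T(2)) auto
    moreover have "F * \<delta> \<le> C_T * \<delta>" using \<delta> by (intro mult_right_mono C_T(3)) auto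
    moreover have "S * \<delta> + F * \<delta> \<le> C_T * \<delta>"
      unfolding distrib_right[symmetric] using \<delta> by (intro mult_right_mono C_T(4)) auto
    moreover have "dX (x t) (slow_manifold (y t)) \<le> (2 + L_mu) * v t + l1norm (\<mu> t - mu_inv P (\<zeta> t))"
      unfolding x_eq v_def using yY[OF t0] by (intro slow_manifold_dist(2) \<zeta>\<Theta> t0) auto
    ultimately have "l1norm (\<mu> t - mu_inv P (\<zeta> t)) \<le> C_T * (e * a + \<delta>)"
      "dX (x t) (slow_manifold (y t)) \<le> C_T * (e * a + \<delta>)"
      using fast_t v_le unfolding distrib_left by linarith+
    moreover have "Gamma0 P t (\<theta>0, w0, \<mu>0) = slow_manifold (y t)"
      by (simp add: Sbar[OF t0] slow_manifold_def case_prod_beta)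
    ultimately show ?thesis
      by (simp add: Sflow[OF t0] a_def e_def) (simp add: x_eq)
  qed
  with C_T(1) show thesis by (rule that)
qed

text \<open>For times beyond \<open>t_star\<close> the exponential is itself of order \<delta>,
  because \<open>exp (- z) \<le> 1 / z\<close>. The suprema are taken in \<open>ennreal\<close>,
  where they need no boundedness proof.\<close>

lemma layer_limit:
  assumes "0 < t_star"
    and C_T: "C_T > 0"
      "\<And>\<theta>0 w0 \<mu>0 \<delta> t. (\<theta>0, w0, \<mu>0) \<in> Kset P \<Longrightarrow> 0 < \<delta> \<Longrightarrow> t \<in> {0..T} \<Longrightarrow>
       dX (Sflow P \<delta> t (\<theta>0, w0, \<mu>0)) (Gamma0 P t (\<theta>0, w0, \<mu>0))
         \<le> C_T * (exp (- \<gamma> * t / \<delta>) * l1norm (\<mu>0 - mu_inv P \<theta>0) + \<delta>)"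
  shows "((\<lambda>\<delta>. SUP x0\<in>Kset P. SUP t\<in>{t_star..T}.
                 ennreal (dX (Sflow P \<delta> t x0) (Gamma0 P t x0))) \<longlongrightarrow> 0) (at_right 0)"
proof (rule tendsto_sandwich)
  \<comment> \<open>The 2 is the l1 bound for differences in the simplex;
    \<open>1 / (\<gamma> * t_star)\<close> comes from the bound on the exponential.\<close>
  define c where "c = C_T * (2 / (\<gamma> * t_star) + 1)"
  show "((\<lambda>_. 0) \<longlongrightarrow> (0 :: ennreal)) (at_right (0 :: real))" by (rule tendsto_const)
  show "\<forall>\<^sub>F \<delta> in at_right 0. 0 \<le> (SUP x0\<in>Kset P. SUP t\<in>{t_star..T}.
      ennreal (dX (Sflow P \<delta> t x0) (Gamma0 P t x0)))"
    by simp
  have "((\<lambda>\<delta>. c * \<delta>) \<longlongrightarrow> c * 0) (at_right 0)" by (intro tendsto_intros)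
  then show "((\<lambda>\<delta>. ennreal (c * \<delta>)) \<longlongrightarrow> 0) (at_right 0)"
    using tendsto_ennrealI[of "\<lambda>\<delta>. c * \<delta>" 0 "at_right 0"] by simp
  have "(SUP x0\<in>Kset P. SUP t\<in>{t_star..T}. ennreal (dX (Sflow P \<delta> t x0) (Gamma0 P t x0)))
      \<le> ennreal (c * \<delta>)" if \<delta>: "0 < \<delta>" for \<delta>
  proof (intro SUP_least ennreal_leI)
    fix x0 t assume x0: "x0 \<in> Kset P" and t: "t \<in> {t_star..T}"
    obtain \<theta>0 w0 \<mu>0 where x0_eq: "x0 = (\<theta>0, w0, \<mu>0)" by (cases x0) auto
    have \<theta>0: "\<theta>0 \<in> Theta P" "\<mu>0 \<in> DeltaS" using x0 by (auto simp: x0_eq Kset_def)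
    have "exp (- \<gamma> * t / \<delta>) \<le> exp (- (\<gamma> * t_star / \<delta>))"
      using t \<gamma>_pos \<delta> by (simp add: divide_right_mono)
    also have "\<dots> \<le> 1 / (\<gamma> * t_star / \<delta>)"
      using assms(1) \<gamma>_pos \<delta> by (intro exp_minus_le_inverse) simp
    finally have e: "exp (- \<gamma> * t / \<delta>) \<le> \<delta> / (\<gamma> * t_star)" by simp
    have "dX (Sflow P \<delta> t x0) (Gamma0 P t x0) \<le>
        C_T * (exp (- \<gamma> * t / \<delta>) * l1norm (\<mu>0 - mu_inv P \<theta>0) + \<delta>)"
      unfolding x0_eq using x0 \<delta> t assms(1) by (intro C_T(2)) (auto simp: x0_eq)
    also have "\<dots> \<le> C_T * (\<delta> / (\<gamma> * t_star) * 2 + \<delta>)"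
    proof (intro mult_left_mono add_right_mono mult_mono e l1norm_DeltaS_diff \<theta>0 mu_inv_stationary l1norm_nonneg)
      show "0 \<le> \<delta> / (\<gamma> * t_star)" using \<delta> \<gamma>_pos assms(1) by simp
      show "0 \<le> C_T" using C_T(1) by simp
    qed
    also have "\<dots> = c * \<delta>" by (simp add: c_def algebra_simps)
    finally show "dX (Sflow P \<delta> t x0) (Gamma0 P t x0) \<le> c * \<delta>" .
  qed
  then show "\<forall>\<^sub>F \<delta> in at_right 0. (SUP x0\<in>Kset P. SUP t\<in>{t_star..T}.
      ennreal (dX (Sflow P \<delta> t x0) (Gamma0 P t x0))) \<le> ennreal (c * \<delta>)"
    unfolding eventually_at_filter by (intro always_eventually) auto
qed

end

theorem theorem8:
  fixes P :: "('n::finite, 'k::finite, 'd::finite, 'm::finite) ac_data"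
    and C_path \<gamma>_path T :: real
  assumes "Rtheta P > 0" and "tau P > 0" and "lamc P > 0"
    and "generator_hyp P"
    and "mixing_hyp P"
    and "C_path \<ge> 1" and "\<gamma>_path > 0" and "pathwise_bound P C_path \<gamma>_path"
    and "T > 0"
  shows "(\<exists>C_T>0. \<forall>\<theta>0 w0 \<mu>0. (\<theta>0, w0, \<mu>0) \<in> Kset P \<longrightarrow>
            (\<forall>\<delta>. 0 < \<delta> \<and> \<delta> \<le> 1 \<longrightarrow> (\<forall>t\<in>{0..T}.
               (case Sflow P \<delta> t (\<theta>0, w0, \<mu>0) of (\<theta>, w, \<mu>) \<Rightarrow> l1norm (\<mu> - mu_inv P \<theta>))
                 \<le> C_T * (exp (- \<gamma>_path * t / \<delta>) * l1norm (\<mu>0 - mu_inv P \<theta>0) + \<delta>) \<and>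
               dX (Sflow P \<delta> t (\<theta>0, w0, \<mu>0)) (Gamma0 P t (\<theta>0, w0, \<mu>0))
                 \<le> C_T * (exp (- \<gamma>_path * t / \<delta>) * l1norm (\<mu>0 - mu_inv P \<theta>0) + \<delta>))))
       \<and> (\<forall>t_star. 0 < t_star \<and> t_star \<le> T \<longrightarrow>
            ((\<lambda>\<delta>. SUP x0\<in>Kset P. SUP t\<in>{t_star..T}.
                 ennreal (dX (Sflow P \<delta> t x0) (Gamma0 P t x0))) \<longlongrightarrow> 0) (at_right 0))"
proof -
  note gen = \<open>generator_hyp P\<close>[unfolded generator_hyp_def]
  obtain L_Q where L_Q: "L_Q > 0" "\<forall>\<theta>\<in>Theta P. \<forall>\<theta>'\<in>Theta P.
      opnorm1 (Qstar P \<theta> - Qstar P \<theta>') \<le> L_Q * norm (\<theta> - \<theta>')"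
    using conjunct2[OF gen] by (elim exE conjE)
  interpret fast_slow P L_Q C_path \<gamma>_path
  proof
    show "0 \<le> gen P \<theta> $ i $ j" if "\<theta> \<in> Theta P" "i \<noteq> j" for \<theta> i j
      using bspec[OF conjunct1[OF gen] that(1)] that(2) by simp
    show "gen P \<theta> $ i $ i = - (\<Sum>j\<in>UNIV - {i}. gen P \<theta> $ i $ j)" if "\<theta> \<in> Theta P" for \<theta> i
      using bspec[OF conjunct1[OF gen] that] by (elim conjE allE)
    show "opnorm1 (Qstar P \<theta> - Qstar P \<theta>') \<le> L_Q * norm (\<theta> - \<theta>')"
      if "\<theta> \<in> Theta P" "\<theta>' \<in> Theta P" for \<theta> \<theta>'
      by (rule bspec[OF bspec[OF L_Q(2) that(1)] that(2)])
  qed (fact assms L_Q)+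
  obtain C_T where C_T: "C_T > 0"
    "\<And>\<theta>0 w0 \<mu>0 \<delta> t. (\<theta>0, w0, \<mu>0) \<in> Kset P \<Longrightarrow> 0 < \<delta> \<Longrightarrow> t \<in> {0..T} \<Longrightarrow>
       (case Sflow P \<delta> t (\<theta>0, w0, \<mu>0) of (\<theta>, w, \<mu>) \<Rightarrow> l1norm (\<mu> - mu_inv P \<theta>))
         \<le> C_T * (exp (- \<gamma>_path * t / \<delta>) * l1norm (\<mu>0 - mu_inv P \<theta>0) + \<delta>) \<and>
       dX (Sflow P \<delta> t (\<theta>0, w0, \<mu>0)) (Gamma0 P t (\<theta>0, w0, \<mu>0))
         \<le> C_T * (exp (- \<gamma>_path * t / \<delta>) * l1norm (\<mu>0 - mu_inv P \<theta>0) + \<delta>)"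
    by (rule averaging_bound[OF \<open>T > 0\<close>]) (rule that)
  show ?thesis
  proof (intro conjI exI[of _ C_T] allI impI ballI)
    show "C_T > 0" by (rule C_T(1))
  next
    fix t_star assume "0 < t_star \<and> t_star \<le> T"
    then show "((\<lambda>\<delta>. SUP x0\<in>Kset P. SUP t\<in>{t_star..T}.
        ennreal (dX (Sflow P \<delta> t x0) (Gamma0 P t x0))) \<longlongrightarrow> 0) (at_right 0)"
      by (intro layer_limit[OF _ C_T(1) C_T(2)[THEN conjunct2]]) auto
  qed (use C_T(2) in blast)+
qed

end
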